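(* Let $N\in\mathbb N$ and $\xi=\sum_{j=1}^N\delta_{u_j}$ with $u_1<\dots<u_N$ even integers. Let $t,T\in\mathbb N$ with $t\le T$. For every bounded $\mathcal F(t)$-measurable function $F$, the noncolliding random walk satisfies $$\mathbb E_\xi[F(\Xi(\cdot))]=\mathrm E_{\boldsymbol u}\Big[F\Big(\sum_{j=1}^N\delta_{V_j(\cdot)}\Big)\mathcal D_\xi(T,\boldsymbol V(T))\Big]=\mathbf E_{\boldsymbol u}\Big[F\Big(\sum_{j=1}^N\delta_{\Re Z_j(\cdot)}\Big)\det_{1\le j,k\le N}\big[\Phi_\xi^{u_k}(Z_j(T))\big]\Big].$$
   Context: $\boldsymbol V(t)=(V_1(t),\dots,V_N(t))$, $t\in\mathbb N_0$: independent simple symmetric random walks on $\mathbb Z$ (steps $\pm1$ with probability $1/2$ each) with $V_j(0)=u_j$; expectation $\mathrm E_{\boldsymbol u}$. $\mathbb W_N=\{\boldsymbol x\in\mathbb R^N:x_1<\dots<x_N\}$, $\tau_{\boldsymbol u}=\inf\{t\ge1:\boldsymbol V(t)\notin\mathbb W_N\}$. Noncolliding random walk: the random walk conditioned to stay in $\mathbb W_N$ forever, regarded as the process $\Xi(t,\cdot)=\sum_{j=1}^N\delta_{X_j(t)}(\cdot)$, $t\in\mathbb N_0$, with filtration $\mathcal F(t)=\sigma(\Xi(s):0\le s\le t,\ s\in\mathbb N_0)$; its expectation $\mathbb E_\xi$ is defined by $\mathbb E_\xi[F(\Xi(\cdot))]=\lim_{n\to\infty}\mathrm E_{\boldsymbol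 u}[F(\sum_j\delta_{V_j(\cdot)})\mid\tau_{\boldsymbol u}>n]$ for bounded $\mathcal F(t)$-measurable $F$. Equivalently, it is the Doob transform $\mathbb E_\xi[F(\Xi(\cdot))]=\mathrm E_{\boldsymbol u}[F(\sum_j\delta_{V_j(\cdot)})\mathbf 1(\tau_{\boldsymbol u}>T)h(\boldsymbol V(T))/h(\boldsymbol u)]$ with $h(\boldsymbol x)=\prod_{1\le j<k\le N}(x_k-x_j)$. Complex process: for $t\in\mathbb N$, let $C(t)=\frac2{\pi^2}\sum_{\ell\in\mathbb N}\frac{\eta_\ell(t)}{(\ell-1/2)^2}$ with $\eta_\ell(t)$, $\ell\in\mathbb N$, i.i.d. Gamma variables with density $\frac1{\Gamma(t)}x^{t-1}e^{-x}$, $x>0$ (so $\mathrm E[e^{-\lambda C(t)}]=(\cosh\sqrt{2\lambda})^{-t}$). Let $W$ be a standard Brownian motion with $W(0)=0$ independent of the $\eta_\ell(t)$, and let $\widetilde W(t)$ have the law of $W(C(t))$, $\widetilde W(0)=0$; $\widetilde{\mathrm E}$ denotes expectation over $\widetilde W$. Let $\widetilde W_1,\dots,\widetilde W_N$ be independent copies, independent of $\boldsymbol V$, and $Z_j(t)=V_j(t)+i\widetilde W_j(t)$; $\mathbf E_{\boldsymbol u}$ is expectation over $(\boldsymbol V,\widetilde W_1,\dots,\widetilde W_N)$. $\Phi_\xi^{u_k}(z)=\prod_{1\le j\le N,\,j\ne k}\frac{z-u_j}{u_k-u_j}$, $\ \mathcal M_\xi^{u_k}(t,x)=\widetilde{\mathrm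 E}[\Phi_\xi^{u_k}(x+i\widetilde W(t))]$, $\ \mathcal D_\xi(t,\boldsymbol V(t))=\det_{1\le j,k\le N}[\mathcal M_\xi^{u_k}(t,V_j(t))]$. *)

theory Defs
  imports
    "HOL-Probability.Probability"
    "HOL-Library.Multiset"
    "HOL-Library.Extended_Nat"
    "Jordan_Normal_Form.Determinant"
begin

text \<open>Particles are indexed by \<open>j < N\<close>, that is by \<open>0, \<dots>, N - 1\<close> instead of \<open>1, \<dots>, N\<close>.\<close>

text \<open>The system of events \<open>\<sigma>(X i : i \<in> I)\<close>.\<close>

definition sigma_gen :: "'a measure \<Rightarrow> 'i set \<Rightarrow> ('i \<Rightarrow> 'a \<Rightarrow> real) \<Rightarrow> 'a set set" where
  "sigma_gen M I X =
     sigma_sets (space M) {X i -` A \<inter> space M | i A. i \<in> I \<and> A \<in> sets borel}"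

subsection \<open>Simple random walks, Weyl chamber, exit time\<close>

definition simple_random_walks ::
    "'a measure \<Rightarrow> nat \<Rightarrow> (nat \<Rightarrow> int) \<Rightarrow> (nat \<Rightarrow> nat \<Rightarrow> 'a \<Rightarrow> int) \<Rightarrow> bool" where
  "simple_random_walks M N u V \<longleftrightarrow>
     prob_space M \<and>
     (\<forall>j<N. \<forall>\<omega>\<in>space M. V j 0 \<omega> = u j) \<and>
     prob_space.indep_vars M (\<lambda>_. count_space UNIV)
       (\<lambda>(j, s) \<omega>. V j (Suc s) \<omega> - V j s \<omega>) ({..<N} \<times> UNIV) \<and>
     (\<forall>j<N. \<forall>s.
        measure M {\<omega> \<in> space M. V j (Suc s) \<omega> - V j s \<omega> = 1} = 1 / 2 \<and>
        measure M {\<omega> \<in> space M. V j (Suc s) \<omega> - V j s \<omega> = -1} = 1 / 2)"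

definition weyl :: "nat \<Rightarrow> (nat \<Rightarrow> real) set" where
  "weyl N = {x. \<forall>j k. j < k \<and> k < N \<longrightarrow> x j < x k}"

definition exit_time :: "nat \<Rightarrow> (nat \<Rightarrow> nat \<Rightarrow> 'a \<Rightarrow> int) \<Rightarrow> 'a \<Rightarrow> enat" where
  "exit_time N V \<omega> = Inf (enat ` {t. 1 \<le> t \<and> (\<lambda>j. real_of_int (V j t \<omega>)) \<notin> weyl N})"

subsection \<open>Configurations and the filtration on their paths\<close>

text \<open>The point measure \<open>\<Sum>\<^sub>j \<delta>(x j)\<close> is represented by the multiset of its atoms.
  The sigma-algebra is the usual one for point processes, generated by \<open>\<mu> \<mapsto> \<mu>(A)\<close>
  for Borel sets \<open>A\<close>.\<close>

definition config :: "nat \<Rightarrow> (nat \<Rightarrow> real) \<Rightarrow> real multiset" where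
  "config N x = image_mset x (mset_set {..<N})"

definition config_space :: "real multiset measure" where
  "config_space = sigma UNIV
     {{\<mu>. size (filter_mset (\<lambda>x. x \<in> A) \<mu>) = m} | A m. A \<in> sets (borel :: real measure)}"

text \<open>The sigma-algebra \<open>\<sigma>(\<Xi>(s) : s \<le> t)\<close> on the space of paths \<open>\<Xi>\<close>.\<close>

definition path_filtration :: "nat \<Rightarrow> (nat \<Rightarrow> real multiset) measure" where
  "path_filtration t = sigma UNIV {{\<Xi>. \<Xi> s \<in> B} | s B. s \<le> t \<and> B \<in> sets config_space}"

definition walk_path ::
    "nat \<Rightarrow> (nat \<Rightarrow> nat \<Rightarrow> 'a \<Rightarrow> int) \<Rightarrow> 'a \<Rightarrow> nat \<Rightarrow> real multiset" where
  "walk_path N V \<omega> = (\<lambda>s. config N (\<lambda>j. real_of_int (V j s \<omega>)))"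

subsection \<open>The noncolliding random walk\<close>

definition survival_expectation ::
    "'a measure \<Rightarrow> nat \<Rightarrow> (nat \<Rightarrow> nat \<Rightarrow> 'a \<Rightarrow> int) \<Rightarrow> nat \<Rightarrow>
     ((nat \<Rightarrow> real multiset) \<Rightarrow> real) \<Rightarrow> real" where
  "survival_expectation M N V n F =
     (let S = {\<omega> \<in> space M. exit_time N V \<omega> > enat n}
      in (LINT \<omega>|M. F (walk_path N V \<omega>) * indicator S \<omega>) / measure M S)"

definition noncolliding_expectation ::
    "'a measure \<Rightarrow> nat \<Rightarrow> (nat \<Rightarrow> nat \<Rightarrow> 'a \<Rightarrow> int) \<Rightarrow>
     ((nat \<Rightarrow> real multiset) \<Rightarrow> real) \<Rightarrow> real" where
  "noncolliding_expectation M N V F = lim (\<lambda>n. survival_expectation M N V n F)"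

subsection \<open>The time-changed Brownian motion\<close>

definition brownian_motion :: "'q measure \<Rightarrow> (real \<Rightarrow> 'q \<Rightarrow> real) \<Rightarrow> bool" where
  "brownian_motion Q B \<longleftrightarrow>
     prob_space Q \<and>
     (\<forall>s\<ge>0. B s \<in> borel_measurable Q) \<and>
     (\<forall>\<omega>\<in>space Q. B 0 \<omega> = 0 \<and> continuous_on {0..} (\<lambda>s. B s \<omega>)) \<and>
     (\<forall>r s. 0 \<le> r \<and> r < s \<longrightarrow>
        distributed Q lborel (\<lambda>\<omega>. B s \<omega> - B r \<omega>) (normal_density 0 (sqrt (s - r)))) \<and>
     (\<forall>(n::nat) \<tau>. 0 \<le> \<tau> 0 \<and> (\<forall>i<n. \<tau> i < \<tau> (Suc i)) \<longrightarrow>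
        prob_space.indep_vars Q (\<lambda>_. borel) (\<lambda>i \<omega>. B (\<tau> (Suc i)) \<omega> - B (\<tau> i) \<omega>) {..<n})"

definition iid_gamma :: "'q measure \<Rightarrow> nat \<Rightarrow> (nat \<Rightarrow> 'q \<Rightarrow> real) \<Rightarrow> bool" where
  "iid_gamma Q t \<eta> \<longleftrightarrow>
     prob_space.indep_vars Q (\<lambda>_. borel) \<eta> {1..} \<and>
     (\<forall>l\<ge>1. distributed Q lborel (\<eta> l)
        (\<lambda>x. if x > 0 then x ^ (t - 1) * exp (- x) / Gamma (real t) else 0))"

text \<open>\<open>\<eta> l t\<close>, with \<open>l \<ge> 1\<close> and \<open>t \<ge> 1\<close>, is the variable \<open>\<eta>\<^sub>l(t)\<close>. The series is summed in
  \<open>[0, \<infinity>]\<close>, so that \<open>C(t) \<ge> 0\<close> also on the null event where it diverges or a summand is negative.\<close>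

definition random_clock :: "(nat \<Rightarrow> nat \<Rightarrow> 'q \<Rightarrow> real) \<Rightarrow> nat \<Rightarrow> 'q \<Rightarrow> real" where
  "random_clock \<eta> t \<omega> = 2 / pi\<^sup>2 *
     enn2real (\<Sum>l. ennreal (\<eta> (Suc l) t \<omega> / (real (Suc l) - 1 / 2)\<^sup>2))"

definition clock_setup ::
    "'q measure \<Rightarrow> (real \<Rightarrow> 'q \<Rightarrow> real) \<Rightarrow> (nat \<Rightarrow> nat \<Rightarrow> 'q \<Rightarrow> real) \<Rightarrow> bool" where
  "clock_setup Q B \<eta> \<longleftrightarrow>
     brownian_motion Q B \<and>
     (\<forall>t\<ge>1. iid_gamma Q t (\<lambda>l. \<eta> l t) \<and>
        prob_space.indep_set Q (sigma_gen Q {0..} B) (sigma_gen Q {1..} (\<lambda>l. \<eta> l t)))"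

text \<open>The law of \<open>W~(t)\<close>; integration against it is the expectation \<open>E~\<close>.\<close>

definition tilde_law ::
    "'q measure \<Rightarrow> (real \<Rightarrow> 'q \<Rightarrow> real) \<Rightarrow> (nat \<Rightarrow> nat \<Rightarrow> 'q \<Rightarrow> real) \<Rightarrow> nat \<Rightarrow> real measure" where
  "tilde_law Q B \<eta> t =
     (if t = 0 then return borel 0 else distr Q borel (\<lambda>\<omega>. B (random_clock \<eta> t \<omega>) \<omega>))"

text \<open>\<open>W j\<close>, \<open>j < N\<close>, are independent processes with one-dimensional marginals \<open>L t\<close>, independent
  of \<open>V\<close>. The joint law in \<open>t\<close> of a single \<open>W j\<close> is left open, as for \<open>W~\<close> itself.\<close>

definition independent_copies ::
    "'a measure \<Rightarrow> nat \<Rightarrow> (nat \<Rightarrow> nat \<Rightarrow> 'a \<Rightarrow> int) \<Rightarrow> (nat \<Rightarrow> real measure) \<Rightarrow>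
     (nat \<Rightarrow> nat \<Rightarrow> 'a \<Rightarrow> real) \<Rightarrow> bool" where
  "independent_copies M N V L W \<longleftrightarrow>
     (\<forall>j<N. \<forall>t. W j t \<in> borel_measurable M \<and> distr M borel (W j t) = L t) \<and>
     prob_space.indep_sets M (\<lambda>j. sigma_gen M UNIV (W j)) {..<N} \<and>
     prob_space.indep_set M
       (sigma_gen M ({..<N} \<times> UNIV) (\<lambda>(j, t) \<omega>. real_of_int (V j t \<omega>)))
       (sigma_gen M ({..<N} \<times> UNIV) (\<lambda>(j, t). W j t))"

definition cprocess ::
    "(nat \<Rightarrow> nat \<Rightarrow> 'a \<Rightarrow> int) \<Rightarrow> (nat \<Rightarrow> nat \<Rightarrow> 'a \<Rightarrow> real) \<Rightarrow> nat \<Rightarrow> nat \<Rightarrow> 'a \<Rightarrow> complex" where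
  "cprocess V W j t \<omega> = Complex (real_of_int (V j t \<omega>)) (W j t \<omega>)"

subsection \<open>The determinantal martingale\<close>

definition Phi :: "nat \<Rightarrow> (nat \<Rightarrow> int) \<Rightarrow> nat \<Rightarrow> complex \<Rightarrow> complex" where
  "Phi N u k z = (\<Prod>j\<in>{..<N} - {k}. (z - of_int (u j)) / (of_int (u k) - of_int (u j)))"

definition mart ::
    "nat \<Rightarrow> (nat \<Rightarrow> int) \<Rightarrow> (nat \<Rightarrow> real measure) \<Rightarrow> nat \<Rightarrow> nat \<Rightarrow> real \<Rightarrow> complex" where
  "mart N u L k t x = (LINT w|L t. Phi N u k (Complex x w))"

definition det_mart ::
    "nat \<Rightarrow> (nat \<Rightarrow> int) \<Rightarrow> (nat \<Rightarrow> real measure) \<Rightarrow> nat \<Rightarrow> (nat \<Rightarrow> real) \<Rightarrow> complex" where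
  "det_mart N u L t x = Determinant.det (Matrix.mat N N (\<lambda>(j, k). mart N u L k t (x j)))"

end

theory Submission
  imports Defs
begin

text \<open>
  The determinant \<open>D(T, x)\<close> does not depend on the law of \<open>W~(T)\<close>: as soon as that law has moments,
  \<open>E~ (x + i W~)\<^sup>l\<close> is a monic polynomial of degree \<open>l\<close> in \<open>x\<close>, so column operations give
  \<open>D(T, x) = h(x) / h(u)\<close>. The equality with the complex process is then Fubini, carried out conditionally on
  the finitely many values of \<open>V\<close>. What remains is that conditioning on survival tends to the
  \<open>h\<close>-transform, where the indicator of survival can be dropped by reflection because \<open>F\<close> does not see
  the labels and \<open>h\<close> is antisymmetric.

  For the limit, reflection writes the survival probability as the expectation of an antisymmetric sign of the
  endpoint. Newton's difference formula in the starting points then gives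
  \<open>q n k = \<beta> n * h(k) + O(n powr (- (a + 1) / 2))\<close> with \<open>a = N (N - 1) / 2\<close>, since each difference of the
  binomial weights costs a factor \<open>n powr (- 1 / 2)\<close> in total variation. The remainder is negligible because
  \<open>h(k) = E (h; survival)\<close> and the moments of \<open>h\<close> at the endpoint force \<open>q n k\<close> to be at least of
  order \<open>n powr (- a / 2 - 1 / 4)\<close>.
\<close>

subsection \<open>Vandermonde determinants\<close>

text \<open>The Doob form of the conditioned walk is not its definition here: the limit itself has
  to be shown to exist, which calls for ratios of survival probabilities from different starting
  points. No asymptotic constant is evaluated for them. The factor \<open>\<beta> n\<close> stays an
  unevaluated signed count; what matters is that one sequence serves all starting points up to a
  bound K at once, so that it cancels in the ratio. A lower bound for survival that misses the true
  order by n powr (1 / 4) is enough, since the remainder gains n powr (1 / 2). Shifting and halving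
  the coordinates makes every step 0 or 1. Laws are then coefficients of powers of (1 + z) / 2, a
  finite difference is multiplication by 1 - z, and every mean over walks is a finite sum. The
  moments of the clock and of the time-changed motion are bounded by Fatou's lemma, along partial
  sums of the series and along time grids respectively.\<close>

definition vandermonde_det :: "nat \<Rightarrow> (nat \<Rightarrow> 'a::comm_ring_1) \<Rightarrow> 'a" where
  "vandermonde_det N x = Determinant.det (Matrix.mat N N (\<lambda>(j, l). x j ^ l))"

lemma det_mat_leibniz:
  "Determinant.det (Matrix.mat N N f) =
     (\<Sum>p | p permutes {..<N}. signof p * (\<Prod>j<N. f (j, p j)))"
  by (subst det_def'[of _ N])
     (auto simp: atLeast0LessThan permutes_in_image intro!: sum.cong prod.cong arg_cong2[where f = "(*)"])

lemma vandermonde_det_leibniz: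
  "vandermonde_det N x = (\<Sum>p | p permutes {..<N}. signof p * (\<Prod>j<N. x j ^ p j))"
  unfolding vandermonde_det_def det_mat_leibniz by simp

text \<open>Expanding every \<open>P k\<close> in monomials factors the evaluation matrix into the
  Vandermonde matrix times the matrix of coefficients. This is how column operations are carried out
  below.\<close>

lemma det_poly_eval:
  fixes P :: "nat \<Rightarrow> 'a::comm_ring_1 poly"
  assumes "\<And>k. k < N \<Longrightarrow> degree (P k) < N"
  shows "Determinant.det (Matrix.mat N N (\<lambda>(j, k). poly (P k) (x j))) =
    vandermonde_det N x * Determinant.det (Matrix.mat N N (\<lambda>(l, k). coeff (P k) l))"
proof -
  have ev: "poly (P k) y = (\<Sum>l\<in>{0..<N}. y ^ l * coeff (P k) l)" if "k < N" for k y
  proof -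
    have "(\<Sum>l\<le>degree (P k). coeff (P k) l * y ^ l) = (\<Sum>l\<in>{0..<N}. coeff (P k) l * y ^ l)"
      using assms[OF that] by (intro sum.mono_neutral_left) (auto simp: coeff_eq_0)
    then show ?thesis
      by (simp add: poly_altdef mult.commute)
  qed
  have "Matrix.mat N N (\<lambda>(j, k). poly (P k) (x j)) =
      Matrix.mat N N (\<lambda>(j, l). x j ^ l) * Matrix.mat N N (\<lambda>(l, k). coeff (P k) l)"
    by (rule eq_matI) (auto simp: scalar_prod_def ev)
  then show ?thesis
    unfolding vandermonde_det_def by (simp add: det_mult[where n = N])
qed

text \<open>The coefficient matrix is upper triangular here, so only leading coefficients remain.
  Affine changes, one-step averages, binomials and moment polynomials all enter through this
  form.\<close>

lemma det_poly_eval_triangular: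
  fixes P :: "nat \<Rightarrow> 'a::comm_ring_1 poly"
  assumes "\<And>k. k < N \<Longrightarrow> degree (P k) \<le> k"
  shows "Determinant.det (Matrix.mat N N (\<lambda>(j, k). poly (P k) (x j))) =
    (\<Prod>k<N. coeff (P k) k) * vandermonde_det N x"
proof -
  have "Determinant.det (Matrix.mat N N (\<lambda>(l, k). coeff (P k) l)) =
      prod_list (diag_mat (Matrix.mat N N (\<lambda>(l, k). coeff (P k) l)))"
    by (rule det_upper_triangular[of _ N])
      (auto simp: upper_triangular_def intro!: coeff_eq_0 intro: le_less_trans[OF assms])
  also have "\<dots> = (\<Prod>k<N. coeff (P k) k)"
    by (simp add: prod_list_diag_prod atLeast0LessThan)
  finally have *: "Determinant.det (Matrix.mat N N (\<lambda>(l, k). coeff (P k) l)) = (\<Prod>k<N. coeff (P k) k)" .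
  have "degree (P k) < N" if "k < N" for k
    using assms[OF that] that by linarith
  then show ?thesis
    by (subst det_poly_eval) (simp_all add: * mult.commute)
qed

lemma vandermonde_det_cong:
  "(\<And>j. j < N \<Longrightarrow> x j = y j) \<Longrightarrow> vandermonde_det N x = vandermonde_det N y"
  unfolding vandermonde_det_leibniz by (auto intro!: sum.cong prod.cong arg_cong2[where f = "(*)"])

text \<open>The powers of a + c x have leading coefficients \<open>c ^ l\<close>. Slope 1 serves to
  centre the endpoint by n / 2, slope 2 to return from half-steps to positions.\<close>

lemma vandermonde_det_affine:
  fixes a c :: "'a::{comm_ring_1, ring_no_zero_divisors}"
  shows "vandermonde_det N (\<lambda>j. a + c * x j) = (\<Prod>l<N. c ^ l) * vandermonde_det N x"
proof -
  have "vandermonde_det N (\<lambda>j. a + c * x j) =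
      Determinant.det (Matrix.mat N N (\<lambda>(j, l). poly ([:a, c:] ^ l) (x j)))"
    unfolding vandermonde_det_def by (simp add: mult.commute)
  also have "\<dots> = (\<Prod>l<N. coeff ([:a, c:] ^ l) l) * vandermonde_det N x"
  proof (rule det_poly_eval_triangular)
    show "degree ([:a, c:] ^ l) \<le> l" for l
      by (rule order.trans[OF degree_power_le]) (auto simp: degree_linear_power)
  qed
  also have "(\<lambda>l. coeff ([:a, c:] ^ l) l) = (\<lambda>l. c ^ l)"
  proof
    fix l show "coeff ([:a, c:] ^ l) l = c ^ l"
    proof (induction l)
    case (Suc l)
    have "coeff ([:a, c:] ^ l) (Suc l) = 0"
      by (rule coeff_eq_0) (rule le_imp_less_Suc, rule order.trans[OF degree_power_le], simp)
    with Suc show ?case by simp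
    qed simp
  qed
  finally show ?thesis .
qed

lemma vandermonde_det_permute:
  assumes p: "p permutes {..<N}"
  shows "vandermonde_det N (x \<circ> p) = signof p * vandermonde_det N x"
proof -
  have "Matrix.mat N N (\<lambda>(j, l). (x \<circ> p) j ^ l) =
      Matrix.mat N N (\<lambda>(j, l). Matrix.mat N N (\<lambda>(j, l). x j ^ l) $$ (p j, l))"
    using permutes_in_image[OF p] by (intro eq_matI) auto
  then show ?thesis
    using p unfolding vandermonde_det_def
    by (simp add: det_permute_rows[where n = N] atLeast0LessThan)
qed

lemma vandermonde_det_of_real: "vandermonde_det N (\<lambda>j. complex_of_real (x j)) = of_real (vandermonde_det N x)"
  unfolding vandermonde_det_leibniz by simp

section \<open>Lagrange interpolation and the inverse of the Vandermonde determinant\<close>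

definition lagrange_poly :: "nat \<Rightarrow> (nat \<Rightarrow> complex) \<Rightarrow> nat \<Rightarrow> complex poly" where
  "lagrange_poly N u k = (\<Prod>j\<in>{..<N} - {k}. Polynomial.smult (1 / (u k - u j)) [:- u j, 1:])"

lemma degree_lagrange_poly:
  assumes "k < N" shows "degree (lagrange_poly N u k) < N"
proof -
  have "degree (lagrange_poly N u k) \<le> (\<Sum>j\<in>{..<N} - {k}. 1)"
    unfolding lagrange_poly_def
  proof (rule order.trans[OF degree_prod_sum_le])
    have "degree (Polynomial.smult c [:- u j, 1:]) \<le> 1" for c j
      by (rule order.trans[OF degree_smult_le]) simp
    then show "sum (degree \<circ> (\<lambda>j. Polynomial.smult (1 / (u k - u j)) [:- u j, 1:])) ({..<N} - {k})
        \<le> (\<Sum>j\<in>{..<N} - {k}. 1)"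
      by (intro sum_mono) (simp only: o_def)
  qed simp
  also have "\<dots> < N" using assms by simp
  finally show ?thesis .
qed

lemma Phi_eq_poly: "Phi N u k z = poly (lagrange_poly N (\<lambda>j. of_int (u j)) k) z"
  unfolding Phi_def lagrange_poly_def poly_prod by (intro prod.cong refl) (simp add: diff_divide_distrib)

text \<open>For distinct nodes this is 1 / h(u), the normalisation of the Doob transform.\<close>

definition lagrange_coeff_det :: "nat \<Rightarrow> (nat \<Rightarrow> complex) \<Rightarrow> complex" where
  "lagrange_coeff_det N u = Determinant.det (Matrix.mat N N (\<lambda>(l, k). coeff (lagrange_poly N u k) l))"

text \<open>Evaluating the Lagrange basis at its own nodes gives the identity matrix; this also shows that the
  Vandermonde determinant does not vanish, without its product formula.\<close>

lemma vandermonde_det_lagrange: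
  assumes inj: "inj_on u {..<N}"
  shows "vandermonde_det N u * lagrange_coeff_det N u = 1"
proof -
  have "poly (lagrange_poly N u k) (u j) = (if j = k then 1 else 0)" if "j < N" "k < N" for j k
  proof (cases "j = k")
    case True
    have "u k - u i \<noteq> 0" if "i \<in> {..<N} - {k}" for i
      using that \<open>k < N\<close> inj by (auto dest: inj_onD)
    then show ?thesis
      using True unfolding lagrange_poly_def poly_prod
      by (auto simp: diff_divide_distrib[symmetric] intro!: prod.neutral)
  next
    case False
    then show ?thesis
      using that unfolding lagrange_poly_def poly_prod by (auto simp: prod_zero_iff)
  qed
  then have "Matrix.mat N N (\<lambda>(j, k). poly (lagrange_poly N u k) (u j)) = 1\<^sub>m N"
    by (intro eq_matI) auto
  then show ?thesis
    using det_poly_eval[of N "lagrange_poly N u" u] degree_lagrange_poly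
    unfolding lagrange_coeff_det_def by simp
qed

lemma vandermonde_det_nonzero:
  fixes u :: "nat \<Rightarrow> real"
  assumes "inj_on u {..<N}"
  shows "vandermonde_det N u \<noteq> 0"
proof -
  have "inj_on (\<lambda>j. complex_of_real (u j)) {..<N}"
    using assms by (auto simp: inj_on_def)
  from vandermonde_det_lagrange[OF this] show ?thesis
    by (auto simp: vandermonde_det_of_real)
qed

subsection \<open>Differences of binomial weights\<close>

lemma poly_eq_sum_atMost:
  fixes p :: "real poly"
  assumes "degree p \<le> L"
  shows "poly p x = (\<Sum>i\<le>L. coeff p i * x ^ i)"
  unfolding poly_altdef using assms by (intro sum.mono_neutral_left) (auto simp: coeff_eq_0)

lemma degree_map_poly_abs: "degree (map_poly abs p :: real poly) \<le> degree p"
  by (rule degree_le) (simp add: coeff_map_poly coeff_eq_0)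

text \<open>The l1 norm of the coefficients, that is, the total variation of the signed measure with
  generating polynomial p. Written as a value at 1, it reduces the convolution inequality to
  multiplicativity of evaluation.\<close>

definition coeff_norm :: "real poly \<Rightarrow> real" where
  "coeff_norm p = poly (map_poly abs p) 1"

lemma coeff_norm_sum:
  assumes "degree p \<le> L"
  shows "coeff_norm p = (\<Sum>i\<le>L. \<bar>coeff p i\<bar>)"
proof -
  have "degree (map_poly abs p) \<le> L"
    using degree_map_poly_abs[of p] assms by linarith
  then show ?thesis
    unfolding coeff_norm_def by (simp add: poly_eq_sum_atMost coeff_map_poly)
qed

lemma sum_coeff_le_coeff_norm: "(\<Sum>i\<le>L. \<bar>coeff p i\<bar>) \<le> coeff_norm p"
  unfolding coeff_norm_sum[of p "max L (degree p)", OF max.cobounded2]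
  by (intro sum_mono2) auto

lemma coeff_norm_nonneg: "0 \<le> coeff_norm p"
  by (simp add: coeff_norm_sum[of p "degree p"] sum_nonneg)

lemma coeff_norm_mult: "coeff_norm (p * q) \<le> coeff_norm p * coeff_norm q"
proof -
  let ?p = "map_poly abs p" and ?q = "map_poly abs q"
  let ?L = "degree p + degree q"
  have "coeff_norm (p * q) = (\<Sum>n\<le>?L. \<bar>coeff (p * q) n\<bar>)"
    by (rule coeff_norm_sum) (rule degree_mult_le)
  also have "\<dots> \<le> (\<Sum>n\<le>?L. coeff (?p * ?q) n)"
    unfolding coeff_mult by (intro sum_mono order.trans[OF sum_abs]) (simp add: coeff_map_poly abs_mult)
  also have "\<dots> = poly (?p * ?q) 1"
  proof -
    have "degree (?p * ?q) \<le> ?L"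
      by (rule order.trans[OF degree_mult_le]) (intro add_mono degree_map_poly_abs)
    from poly_eq_sum_atMost[OF this, of 1] show ?thesis by simp
  qed
  finally show ?thesis by (simp add: coeff_norm_def)
qed

lemma coeff_norm_power: "coeff_norm (p ^ n) \<le> coeff_norm p ^ n"
proof (induction n)
  case 0
  then show ?case by (simp add: coeff_norm_def)
next
  case (Suc n)
  have "coeff_norm (p ^ Suc n) \<le> coeff_norm p * coeff_norm (p ^ n)"
    by (simp add: coeff_norm_mult)
  also have "\<dots> \<le> coeff_norm p * coeff_norm p ^ n"
    by (intro mult_left_mono Suc coeff_norm_nonneg)
  finally show ?case by simp
qed

text \<open>Generating polynomial of one fair step 0 or 1: the coefficients of its n-th power are
  the binomial law, and a factor z^k moves the start to k.\<close>

definition step_poly :: "real poly" where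
  "step_poly = [:1/2, 1/2:]"

lemma step_poly_mult: "step_poly * p = Polynomial.smult (1/2) (p + pCons 0 p)"
  by (simp add: step_poly_def smult_add_right)

lemma coeff_step_poly_power_nonneg: "0 \<le> coeff (step_poly ^ n) b"
proof (induction n arbitrary: b)
  case (Suc n)
  then show ?case
    by (cases b) (simp_all add: step_poly_mult)
qed simp

lemma degree_step_poly_power: "degree (step_poly ^ n) \<le> n"
  by (rule order.trans[OF degree_power_le]) (simp add: step_poly_def)

lemma poly_step_poly_1: "poly step_poly 1 = 1"
  by (simp add: step_poly_def)

lemma coeff_norm_step_poly_power: "coeff_norm (step_poly ^ n) = 1"
proof -
  have "map_poly abs (step_poly ^ n) = step_poly ^ n"
    by (rule poly_eqI) (simp add: coeff_map_poly coeff_step_poly_power_nonneg)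
  then show ?thesis
    by (simp add: coeff_norm_def poly_step_poly_1)
qed

text \<open>The operator n - 2 z d/dz. It weights the coefficient of z^b by n - 2 b, which is minus
  the displacement of a symmetric walk with b up-steps out of n.\<close>

definition displacement_op :: "nat \<Rightarrow> real poly \<Rightarrow> real poly" where
  "displacement_op n p = Polynomial.smult (real n) p - Polynomial.smult 2 (pCons 0 (pderiv p))"

lemma coeff_displacement_op: "coeff (displacement_op n p) b = (real n - 2 * real b) * coeff p b"
  by (cases b) (simp_all add: displacement_op_def coeff_pderiv algebra_simps)

text \<open>With s = (1 + z) / 2 the left side is (n + 1) s^n (s - z), and s - z = (1 - z) / 2. So
  first differences of the binomial law are binomial weights times displacement.\<close>

lemma displacement_op_step_poly:
  "displacement_op (Suc n) (step_poly ^ Suc n) = Polynomial.smult (real (Suc n) / 2) ([:1, -1:] * step_poly ^ n)"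
proof -
  have "pderiv (step_poly ^ Suc n) = Polynomial.smult (real (Suc n) / 2) (step_poly ^ n)"
    unfolding pderiv_power_Suc by (simp add: pderiv_pCons step_poly_def)
  then show ?thesis
    by (rule_tac poly_eqI)
      (simp add: displacement_op_def coeff_pCons step_poly_mult field_simps split: nat.split)
qed

text \<open>The variance of the walk, from two applications of the operator evaluated at z = 1. The
  first one produces a factor 1 - z, so only the derivative of that factor contributes.\<close>

lemma sum_displacement_square:
  "(\<Sum>b\<le>n. (real n - 2 * real b)\<^sup>2 * coeff (step_poly ^ n) b) = real n"
proof (cases n)
  case (Suc m)
  let ?q = "displacement_op n (displacement_op n (step_poly ^ n))"
  have "(\<Sum>b\<le>n. (real n - 2 * real b)\<^sup>2 * coeff (step_poly ^ n) b) = (\<Sum>b\<le>n. coeff ?q b)"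
    by (simp add: coeff_displacement_op power2_eq_square algebra_simps)
  also have "\<dots> = poly ?q 1"
  proof -
    have "degree ?q \<le> n"
      using degree_step_poly_power[of n]
      by (intro degree_le) (auto simp: coeff_displacement_op coeff_eq_0)
    from poly_eq_sum_atMost[OF this, of 1] show ?thesis by simp
  qed
  also have "\<dots> = real n"
    unfolding Suc displacement_op_step_poly
    by (simp add: displacement_op_def pderiv_smult pderiv_pCons pderiv_add pderiv_minus poly_step_poly_1)
  finally show ?thesis .
qed (simp)

text \<open>Up to the factor \<open>2 / (n + 1)\<close>, the coefficients are the displacement times the law of the walk after
  \<open>n + 1\<close> steps, so the sum of their absolute values is controlled by the standard deviation.\<close>

lemma coeff_norm_difference_step_poly:
  "coeff_norm ([:1, -1:] * step_poly ^ n) \<le> 2 / sqrt (real (Suc n))"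
proof -
  let ?s = "sqrt (real (Suc n))" and ?w = "coeff (step_poly ^ Suc n)"
  have s: "?s > 0" "?s * ?s = real (Suc n)" by simp_all
  have deg: "degree ([:1, -1:] * step_poly ^ n) \<le> Suc n"
    by (rule order.trans[OF degree_mult_le]) (use degree_step_poly_power[of n] in simp)
  have c: "coeff ([:1, -1:] * step_poly ^ n) b = 2 / real (Suc n) * ((real (Suc n) - 2 * real b) * ?w b)" for b
    using arg_cong[OF displacement_op_step_poly[of n], of "\<lambda>p. coeff p b"]
    by (simp add: coeff_displacement_op field_simps del: power_Suc mult_pCons_left)
  have "coeff_norm ([:1, -1:] * step_poly ^ n)
      = (\<Sum>b\<le>Suc n. 2 / real (Suc n) * (\<bar>real (Suc n) - 2 * real b\<bar> * ?w b))"
    unfolding coeff_norm_sum[OF deg] c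
    by (intro sum.cong) (simp_all add: abs_mult coeff_step_poly_power_nonneg del: power_Suc)
  \<comment> \<open>The inequality 2 |x| s \<le> x^2 + s^2 with s the standard deviation sqrt (n +
    1), for which both halves have the same mean.\<close>
  also have "\<dots> \<le> (\<Sum>b\<le>Suc n. 2 / real (Suc n) * ((((real (Suc n) - 2 * real b)\<^sup>2 / ?s + ?s) / 2) * ?w b))"
  proof (intro sum_mono mult_left_mono mult_right_mono coeff_step_poly_power_nonneg)
    fix b
    let ?x = "\<bar>real (Suc n) - 2 * real b\<bar>"
    have "0 \<le> (?x - ?s)\<^sup>2" by simp
    then have "2 * ?x * ?s \<le> ?x\<^sup>2 + ?s * ?s" by (simp add: power2_eq_square algebra_simps)
    then show "?x \<le> ((real (Suc n) - 2 * real b)\<^sup>2 / ?s + ?s) / 2"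
      using s by (simp add: field_simps)
  qed simp
  also have "\<dots> = (\<Sum>b\<le>Suc n. 1 / real (Suc n) * ((real (Suc n) - 2 * real b)\<^sup>2 * ?w b / ?s + ?s * ?w b))"
  proof (intro sum.cong refl)
    have "2 / c * ((x / d + d) / 2 * w) = 1 / c * (x * w / d + d * w)" for c d x w :: real
      by (simp add: algebra_simps add_divide_distrib)
    then show "2 / real (Suc n) * (((real (Suc n) - 2 * real b)\<^sup>2 / ?s + ?s) / 2 * ?w b) =
        1 / real (Suc n) * ((real (Suc n) - 2 * real b)\<^sup>2 * ?w b / ?s + ?s * ?w b)" for b .
  qed
  also have "\<dots> = 1 / real (Suc n) * ((\<Sum>b\<le>Suc n. (real (Suc n) - 2 * real b)\<^sup>2 * ?w b) / ?s + ?s * (\<Sum>b\<le>Suc n. ?w b))"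
    by (simp only: sum_distrib_left[symmetric] sum_divide_distrib[symmetric] sum.distrib)
  also have "(\<Sum>b\<le>Suc n. ?w b) = 1"
    using coeff_norm_sum[OF degree_step_poly_power, of "Suc n"]
    by (simp add: coeff_step_poly_power_nonneg coeff_norm_step_poly_power del: power_Suc)
  also have "1 / real (Suc n) * ((\<Sum>b\<le>Suc n. (real (Suc n) - 2 * real b)\<^sup>2 * ?w b) / ?s + ?s * 1) = 2 / ?s"
  proof -
    have "1 / c * (c / d + d * 1) = 2 / d" if "d > 0" "d * d = c" for c d :: real
      using that(1) unfolding that(2)[symmetric] by (simp add: field_simps)
    from this[OF s] show ?thesis
      unfolding sum_displacement_square .
  qed
  finally show ?thesis .
qed

text \<open>The n steps are cut into m blocks of length k = n div m and one difference is spent on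
  each; the leftover steps have norm 1. The factor sqrt m comes from n \<le> m (k + 1).\<close>

lemma coeff_norm_iterated_difference:
  assumes "n > 0"
  shows "coeff_norm ([:1, -1:] ^ m * step_poly ^ n) \<le> (2 * sqrt (real m) / sqrt (real n)) ^ m"
proof (cases "m = 0")
  case False
  define k where "k = n div m"
  have n: "n = k * m + n mod m" by (simp add: k_def)
  have k: "real n \<le> real m * real (Suc k)"
    by (metis False dividend_less_times_div k_def less_imp_le mult_Suc_right of_nat_le_iff of_nat_mult bot_nat_0.not_eq_extremum)
  have "[:1, -1:] ^ m * step_poly ^ n = ([:1, -1:] * step_poly ^ k) ^ m * step_poly ^ (n mod m)"
    by (subst n) (simp only: power_add power_mult power_mult_distrib mult.assoc)
  then have "coeff_norm ([:1, -1:] ^ m * step_poly ^ n) \<le> coeff_norm (([:1, -1:] * step_poly ^ k) ^ m) * 1"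
    using coeff_norm_mult coeff_norm_step_poly_power by metis
  also have "\<dots> \<le> coeff_norm ([:1, -1:] * step_poly ^ k) ^ m"
    using coeff_norm_power by simp
  also have "\<dots> \<le> (2 / sqrt (real (Suc k))) ^ m"
    by (intro power_mono coeff_norm_difference_step_poly coeff_norm_nonneg)
  also have "\<dots> \<le> (2 * sqrt (real m) / sqrt (real n)) ^ m"
  proof (intro power_mono)
    have "sqrt (real n) \<le> sqrt (real m) * sqrt (real (Suc k))"
      using k by (metis real_sqrt_le_iff real_sqrt_mult)
    then show "2 / sqrt (real (Suc k)) \<le> 2 * sqrt (real m) / sqrt (real n)"
      using assms by (simp add: field_simps)
  qed simp
  finally show ?thesis .
qed (simp add: coeff_norm_step_poly_power)

subsection \<open>Means over Bernoulli walks\<close>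

definition advance :: "nat set \<Rightarrow> (nat \<Rightarrow> nat) \<Rightarrow> nat \<Rightarrow> nat" where
  "advance S k = (\<lambda>j. if j \<in> S then Suc (k j) else k j)"

text \<open>The mean over n independent steps, S being the set of coordinates that move up. The
  argument of g lists all n + 1 positions, the start included, so that functionals of the path and
  not only of the endpoint can be averaged.\<close>

fun walk_mean :: "nat \<Rightarrow> nat \<Rightarrow> ((nat \<Rightarrow> nat) list \<Rightarrow> real) \<Rightarrow> (nat \<Rightarrow> nat) \<Rightarrow> real" where
  "walk_mean N 0 g k = g [k]"
| "walk_mean N (Suc n) g k =
     (\<Sum>S\<in>Pow {..<N}. walk_mean N n (\<lambda>l. g (k # l)) (advance S k)) / 2 ^ N"

lemma walk_mean_cong:
  assumes "\<And>l. length l = Suc n \<Longrightarrow> hd l = k \<Longrightarrow> g l = g' l"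
  shows "walk_mean N n g k = walk_mean N n g' k"
  using assms
proof (induction n arbitrary: g g' k)
  case (Suc n)
  have "walk_mean N n (\<lambda>l. g (k # l)) k' = walk_mean N n (\<lambda>l. g' (k # l)) k'" for k'
    by (rule Suc.IH) (simp add: Suc.prems)
  then show ?case by simp
qed simp

lemma walk_mean_cmult: "walk_mean N n (\<lambda>l. c * g l) k = c * walk_mean N n g k"
  by (induction n arbitrary: g k) (simp_all add: sum_distrib_left)

lemma walk_mean_0: "walk_mean N n (\<lambda>l. 0) k = 0"
  using walk_mean_cmult[of N n 0 "\<lambda>l. 0" k] by simp

lemma walk_mean_minus: "walk_mean N n (\<lambda>l. - g l) k = - walk_mean N n g k"
  using walk_mean_cmult[of N n "-1" g k] by simp

lemma walk_mean_add: "walk_mean N n (\<lambda>l. g l + g' l) k = walk_mean N n g k + walk_mean N n g' k"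
  by (induction n arbitrary: g g' k) (simp_all add: sum.distrib add_divide_distrib)

lemma walk_mean_sum: "walk_mean N n (\<lambda>l. \<Sum>i\<in>A. g i l) k = (\<Sum>i\<in>A. walk_mean N n (g i) k)"
  by (induction A rule: infinite_finite_induct) (simp_all add: walk_mean_add walk_mean_0)

lemma walk_mean_mono:
  assumes "\<And>l. g l \<le> g' l"
  shows "walk_mean N n g k \<le> walk_mean N n g' k"
  using assms by (induction n arbitrary: g g' k) (simp_all add: divide_right_mono sum_mono)

lemma walk_mean_abs: "\<bar>walk_mean N n g k\<bar> \<le> walk_mean N n (\<lambda>l. \<bar>g l\<bar>) k"
  using walk_mean_mono[of g "\<lambda>l. \<bar>g l\<bar>" N n k] walk_mean_mono[of "\<lambda>l. - g l" "\<lambda>l. \<bar>g l\<bar>" N n k]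
  by (simp add: walk_mean_minus abs_le_iff)

lemma walk_mean_tendsto:
  assumes "\<And>l. (\<lambda>m. g m l) \<longlonglongrightarrow> g' l"
  shows "(\<lambda>m. walk_mean N n (g m) k) \<longlonglongrightarrow> walk_mean N n g' k"
  using assms by (induction n arbitrary: g g' k) (auto intro!: tendsto_intros)

text \<open>The Markov property at time t. Position t is shared: it ends the list seen by g and
  begins the one seen by h.\<close>

lemma walk_mean_markov:
  "walk_mean N (t + n) (\<lambda>l. g (take (Suc t) l) * h (drop t l)) k =
     walk_mean N t (\<lambda>l. g l * walk_mean N n h (last l)) k"
proof (induction t arbitrary: g k)
  case 0
  have "walk_mean N n (\<lambda>l. g (take (Suc 0) l) * h l) k = walk_mean N n (\<lambda>l. g [k] * h l) k"
    by (rule walk_mean_cong) (auto simp: length_Suc_conv)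
  then show ?case by (simp add: walk_mean_cmult)
next
  case (Suc t)
  have "walk_mean N t (\<lambda>l. g (k # l) * walk_mean N n h (last l)) k' =
      walk_mean N t (\<lambda>l. g (k # l) * walk_mean N n h (last (k # l))) k'" for k'
    by (rule walk_mean_cong) (auto simp: length_Suc_conv)
  with Suc[of "\<lambda>l. g (k # l)"] show ?case by simp
qed

subsection \<open>Reflection\<close>

definition chamber :: "nat \<Rightarrow> (nat \<Rightarrow> nat) \<Rightarrow> bool" where
  "chamber N k \<longleftrightarrow> (\<forall>i j. i < j \<and> j < N \<longrightarrow> k i < k j)"

definition alive :: "nat \<Rightarrow> (nat \<Rightarrow> nat) list \<Rightarrow> bool" where
  "alive N l \<longleftrightarrow> (\<forall>k\<in>set l. chamber N k)"

text \<open>Exchanging two labels from some time on reverses the sign. The arbitrary prefix a allows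
  reflection at a time that depends on the path; the case \<open>l = []\<close>, where nothing is
  exchanged, would force g to vanish.\<close>

definition future_antisymmetric :: "nat \<Rightarrow> ((nat \<Rightarrow> nat) list \<Rightarrow> real) \<Rightarrow> bool" where
  "future_antisymmetric N g \<longleftrightarrow> (\<forall>a l i j. i < N \<longrightarrow> j < N \<longrightarrow> i \<noteq> j \<longrightarrow> l \<noteq> [] \<longrightarrow>
     g (a @ map (\<lambda>k. k \<circ> Transposition.transpose i j) l) = - g (a @ l))"

lemma future_antisymmetric_Cons:
  assumes "future_antisymmetric N g"
  shows "future_antisymmetric N (\<lambda>l. g (k # l))"
  unfolding future_antisymmetric_def
proof (intro allI impI)
  fix a l i j assume "i < N" "j < N" "i \<noteq> (j::nat)" "l \<noteq> ([] :: (nat \<Rightarrow> nat) list)"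
  with assms show "g (k # (a @ map (\<lambda>k. k \<circ> Transposition.transpose i j) l)) = - g (k # (a @ l))"
    unfolding future_antisymmetric_def by (metis append_Cons)
qed

lemma advance_permute:
  assumes "p permutes A"
  shows "advance S (k \<circ> p) = advance (p ` S) k \<circ> p"
proof
  have "p j \<in> p ` S \<longleftrightarrow> j \<in> S" for j
    using permutes_inj[OF assms] by (auto dest: injD)
  then show "advance S (k \<circ> p) j = (advance (p ` S) k \<circ> p) j" for j
    by (simp add: advance_def)
qed

lemma walk_mean_permute:
  assumes p: "p permutes {..<N}"
  shows "walk_mean N n g (k \<circ> p) = walk_mean N n (\<lambda>l. g (map (\<lambda>k. k \<circ> p) l)) k"
proof (induction n arbitrary: g k)
  case (Suc n)
  have bij: "bij_betw ((`) p) (Pow {..<N}) (Pow {..<N})"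
    using permutes_imp_bij[OF p] by (rule bij_betw_Pow)
  have "(\<Sum>S\<in>Pow {..<N}. walk_mean N n (\<lambda>l. g ((k \<circ> p) # l)) (advance S (k \<circ> p))) =
      (\<Sum>S\<in>Pow {..<N}. walk_mean N n (\<lambda>l. g ((k \<circ> p) # map (\<lambda>k. k \<circ> p) l)) (advance (p ` S) k))"
    unfolding advance_permute[OF p] Suc.IH ..
  also have "\<dots> = (\<Sum>S\<in>Pow {..<N}. walk_mean N n (\<lambda>l. g ((k \<circ> p) # map (\<lambda>k. k \<circ> p) l)) (advance S k))"
    by (rule sum.reindex_bij_betw[OF bij])
  finally show ?case by (simp only: walk_mean.simps list.map)
qed simp

text \<open>The swap of i and j fixes the start and preserves the law of the walk, but negates g, so
  the mean equals its own negative.\<close>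

lemma walk_mean_collision:
  assumes g: "future_antisymmetric N g" and ij: "i < N" "j < N" "i \<noteq> j" and k: "k i = k j"
  shows "walk_mean N n g k = 0"
proof -
  let ?p = "Transposition.transpose i j"
  have p: "?p permutes {..<N}"
    using ij by (intro permutes_swap_id) auto
  have "k \<circ> ?p = k"
    using k by (auto simp: fun_eq_iff Transposition.transpose_def)
  then have "walk_mean N n g k = walk_mean N n (\<lambda>l. g (map (\<lambda>k. k \<circ> ?p) l)) k"
    using walk_mean_permute[OF p, of n g k] by simp
  also have "\<dots> = walk_mean N n (\<lambda>l. - g l) k"
  proof (rule walk_mean_cong)
    fix l :: "(nat \<Rightarrow> nat) list" assume "length l = Suc n"
    then have "l \<noteq> []" by auto
    with g ij show "g (map (\<lambda>k. k \<circ> ?p) l) = - g l"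
      unfolding future_antisymmetric_def by (metis append_Nil)
  qed
  finally show ?thesis by (simp add: walk_mean_minus)
qed

text \<open>Sign reversal at the first collision: a step of length at most one cannot leave the chamber
  without hitting its boundary, and from the boundary the contributions cancel.\<close>

lemma walk_mean_alive:
  assumes "future_antisymmetric N g" and "\<And>i j. i < j \<Longrightarrow> j < N \<Longrightarrow> k i \<le> k j"
  shows "walk_mean N n (\<lambda>l. of_bool (alive N l) * g l) k = walk_mean N n g k"
  using assms
proof (induction n arbitrary: g k)
  case 0
  show ?case
  proof (cases "chamber N k")
    case False
    then obtain i j where "i < j" "j < N" "k i = k j"
      using 0(2) unfolding chamber_def by (meson le_neq_implies_less)
    then have "g [k] = 0"
      using walk_mean_collision[of N g i j k 0] 0 by simp
    then show ?thesis by simp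
  qed (simp add: alive_def)
next
  case (Suc n)
  show ?case
  proof (cases "chamber N k")
    case False
    then obtain i j where "i < j" "j < N" "k i = k j"
      using Suc.prems(2) unfolding chamber_def by (meson le_neq_implies_less)
    then have "walk_mean N (Suc n) g k = 0"
      using walk_mean_collision[of N g i j k "Suc n"] Suc.prems by (simp del: walk_mean.simps)
    moreover have "walk_mean N (Suc n) (\<lambda>l. of_bool (alive N l) * g l) k = walk_mean N (Suc n) (\<lambda>l. 0) k"
      using False by (intro walk_mean_cong) (auto simp: alive_def length_Suc_conv)
    ultimately show ?thesis by (simp add: walk_mean_0 del: walk_mean.simps)
  next
    case True
    have "walk_mean N n (\<lambda>l. of_bool (alive N l) * g (k # l)) (advance S k) =
        walk_mean N n (\<lambda>l. g (k # l)) (advance S k)" for S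
    proof (rule Suc.IH)
      fix i j assume "i < j" "j < N"
      with True have "k i < k j" by (auto simp: chamber_def)
      then show "advance S k i \<le> advance S k j" by (auto simp: advance_def)
    qed (rule future_antisymmetric_Cons[OF Suc.prems(1)])
    with True show ?thesis by (simp add: alive_def)
  qed
qed

subsection \<open>Product functions of the endpoint\<close>

definition step_avg :: "(nat \<Rightarrow> real) \<Rightarrow> nat \<Rightarrow> real" where
  "step_avg f x = (f x + f (Suc x)) / 2"

text \<open>Independence of the coordinates within one step: the sum over subsets is the expansion
  of a product of two-term sums.\<close>

lemma sum_Pow_advance_prod:
  fixes f :: "nat \<Rightarrow> nat \<Rightarrow> real"
  shows "(\<Sum>S\<in>Pow {..<N}. \<Prod>j<N. f j (advance S k j)) / 2 ^ N = (\<Prod>j<N. step_avg (f j) (k j))"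
proof -
  have "(\<Sum>S\<in>Pow {..<N}. \<Prod>j<N. f j (advance S k j)) =
      (\<Sum>S\<in>Pow {..<N}. (\<Prod>j\<in>S. f j (Suc (k j))) * (\<Prod>j\<in>{..<N} - S. f j (k j)))"
  proof (rule sum.cong)
    fix S assume "S \<in> Pow {..<N}"
    then have "(\<Prod>j<N. f j (advance S k j)) =
        (\<Prod>j\<in>{..<N} - S. f j (advance S k j)) * (\<Prod>j\<in>S. f j (advance S k j))"
      by (intro prod.subset_diff) auto
    then show "(\<Prod>j<N. f j (advance S k j)) = (\<Prod>j\<in>S. f j (Suc (k j))) * (\<Prod>j\<in>{..<N} - S. f j (k j))"
      by (simp add: advance_def mult.commute)
  qed simp
  also have "\<dots> = (\<Prod>j<N. f j (Suc (k j)) + f j (k j))"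
    by (rule prod_add[symmetric]) simp
  finally show ?thesis
    by (simp add: step_avg_def prod_dividef add.commute)
qed

lemma walk_mean_last_Suc:
  "walk_mean N (Suc n) (\<lambda>l. f (last l)) k =
     (\<Sum>S\<in>Pow {..<N}. walk_mean N n (\<lambda>l. f (last l)) (advance S k)) / 2 ^ N"
proof -
  have "walk_mean N n (\<lambda>l. f (last (k # l))) k' = walk_mean N n (\<lambda>l. f (last l)) k'" for k'
    by (rule walk_mean_cong) (auto simp: length_Suc_conv)
  then show ?thesis by simp
qed

lemma walk_mean_prod:
  "walk_mean N n (\<lambda>l. \<Prod>j<N. f j (last l j)) k = (\<Prod>j<N. (step_avg ^^ n) (f j) (k j))"
proof (induction n arbitrary: k)
  case (Suc n)
  show ?case
    unfolding walk_mean_last_Suc[where f = "\<lambda>k. \<Prod>j<N. f j (k j)"] Suc.IH sum_Pow_advance_prod[where f = "\<lambda>j. (step_avg ^^ n) (f j)"]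
    by simp
qed simp

abbreviation "vandermonde_nat N k \<equiv> vandermonde_det N (\<lambda>j. real (k j))"

text \<open>Every Leibniz term is a product over coordinates, so one step averages each matrix entry
  separately. The average of x^l over a step 0 or 1 is again monic of degree l, hence the
  determinant does not change.\<close>

lemma vandermonde_martingale: "walk_mean N n (\<lambda>l. vandermonde_nat N (last l)) k = vandermonde_nat N k"
proof (induction n arbitrary: k)
  case (Suc n)
  define P :: "nat \<Rightarrow> real poly" where "P l = Polynomial.smult (1/2) (monom 1 l + [:1, 1:] ^ l)" for l
  have P: "poly (P l) (real x) = step_avg (\<lambda>x. real x ^ l) x" for l x
    by (simp add: P_def step_avg_def poly_monom add.commute)
  have deg: "degree ([:1, 1:] ^ l :: real poly) = l" for l
    by (simp add: degree_linear_power)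
  have "(\<Sum>S\<in>Pow {..<N}. vandermonde_nat N (advance S k)) / 2 ^ N =
      (\<Sum>p | p permutes {..<N}. signof p * ((\<Sum>S\<in>Pow {..<N}. \<Prod>j<N. real (advance S k j) ^ p j) / 2 ^ N))"
    unfolding vandermonde_det_leibniz
    by (subst sum.swap) (simp add: sum_distrib_left sum_divide_distrib)
  also have "\<dots> = Determinant.det (Matrix.mat N N (\<lambda>(j, l). poly (P l) (real (k j))))"
    unfolding det_mat_leibniz P
    by (simp add: sum_Pow_advance_prod[where f = "\<lambda>j x. real x ^ (p j)" for p])
  also have "\<dots> = (\<Prod>l<N. coeff (P l) l) * vandermonde_nat N k"
  proof (rule det_poly_eval_triangular)
    show "degree (P l) \<le> l" for l
      unfolding P_def using deg[of l]
      by (intro order.trans[OF degree_smult_le] degree_add_le) (simp_all add: degree_monom_le)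
  qed
  also have "(\<Prod>l<N. coeff (P l) l) = 1"
  proof (rule prod.neutral, rule ballI)
    fix l
    have "coeff ([:1, 1:] ^ l :: real poly) l = 1"
      using coeff_linear_power[of "1::real" l] by simp
    then show "coeff (P l) l = 1" by (simp add: P_def)
  qed
  finally show ?case
    unfolding walk_mean_last_Suc[where f = "vandermonde_nat N"] Suc.IH by simp
qed simp

text \<open>A factor that ignores relabelling of the future, such as a functional of configurations,
  inherits antisymmetry from h.\<close>

lemma future_antisymmetric_vandermonde:
  assumes "\<And>a l i j. i < N \<Longrightarrow> j < N \<Longrightarrow> i \<noteq> j \<Longrightarrow> l \<noteq> [] \<Longrightarrow>
     g (a @ map (\<lambda>k. k \<circ> Transposition.transpose i j) l) = g (a @ l)"
  shows "future_antisymmetric N (\<lambda>l. g l * vandermonde_nat N (last l))"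
  unfolding future_antisymmetric_def
proof (intro allI impI)
  fix a l i j assume ij: "i < N" "j < N" "i \<noteq> (j::nat)" and l: "l \<noteq> ([] :: (nat \<Rightarrow> nat) list)"
  let ?p = "Transposition.transpose i j"
  have "?p permutes {..<N}"
    using ij by (intro permutes_swap_id) auto
  then have "vandermonde_nat N (last l \<circ> ?p) = - vandermonde_nat N (last l)"
    using vandermonde_det_permute[of ?p N "\<lambda>j. real (last l j)"] ij by (simp add: sign_swap_id o_def)
  then show "g (a @ map (\<lambda>k. k \<circ> ?p) l) * vandermonde_nat N (last (a @ map (\<lambda>k. k \<circ> ?p) l)) =
      - (g (a @ l) * vandermonde_nat N (last (a @ l)))"
    using assms[OF ij l] l by (simp add: last_map)
qed

subsection \<open>Asymptotics of the survival probability\<close>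

text \<open>The bound on the endpoint makes it possible to sum over a finite grid of endpoints, and
  to stay in the range where the asymptotics hold with one common \<open>\<beta>\<close>.\<close>

lemma walk_mean_cong_bounded:
  assumes "\<And>l. length l = Suc n \<Longrightarrow> hd l = k \<Longrightarrow> (\<And>j. last l j \<le> k j + n) \<Longrightarrow> g l = g' l"
  shows "walk_mean N n g k = walk_mean N n g' k"
  using assms
proof (induction n arbitrary: g g' k)
  case (Suc n)
  have "walk_mean N n (\<lambda>l. g (k # l)) (advance S k) = walk_mean N n (\<lambda>l. g' (k # l)) (advance S k)" for S
  proof (rule Suc.IH)
    fix l assume l: "length l = Suc n" "hd l = advance S k" "\<And>j. last l j \<le> advance S k j + n"
    have "last (k # l) j \<le> k j + Suc n" for j
    proof -
      have "last l j \<le> advance S k j + n" by (rule l(3))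
      also have "\<dots> \<le> k j + Suc n" by (simp add: advance_def)
      finally show ?thesis using l(1) by auto
    qed
    then show "g (k # l) = g' (k # l)"
      using l by (intro Suc.prems) auto
  qed
  then show ?case by simp
qed simp

text \<open>The sign of the permutation that sorts the first N coordinates of b, and 0 if two of
  them coincide: the antisymmetric extension of the indicator of the chamber.\<close>

definition chamber_sign :: "nat \<Rightarrow> (nat \<Rightarrow> nat) \<Rightarrow> real" where
  "chamber_sign N b = (\<Sum>p | p permutes {..<N}. signof p * of_bool (chamber N (b \<circ> p)))"

text \<open>Both orders being strict, p is increasing; then i \<le> p i by induction, and a
  permutation with this property is the identity.\<close>

lemma chamber_permute_id:
  assumes p: "p permutes {..<N}" and "chamber N b" "chamber N (b \<circ> p)"
  shows "p = id"
proof (rule permutes_natset_ge[OF p])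
  have mono: "p i < p j" if "i < j" "j < N" for i j
  proof (rule ccontr)
    assume "\<not> p i < p j"
    moreover have "p i \<noteq> p j" using that permutes_inj[OF p] by (auto dest: injD)
    ultimately have "p j < p i" by simp
    moreover have "p i < N" using permutes_in_image[OF p, of i] that by simp
    ultimately have "b (p j) < b (p i)" using assms(2) unfolding chamber_def by blast
    moreover have "b (p i) < b (p j)" using assms(3) that unfolding chamber_def by simp
    ultimately show False by simp
  qed
  have "i < N \<Longrightarrow> i \<le> p i" for i
  proof (induction i)
    case (Suc i)
    with mono[of i "Suc i"] show ?case by simp
  qed simp
  then show "\<forall>i\<in>{..<N}. i \<le> p i" by simp
qed

lemma chamber_sign_chamber:
  assumes "chamber N b" shows "chamber_sign N b = 1"
proof -
  have "chamber_sign N b = (\<Sum>p\<in>{id}. signof p * of_bool (chamber N (b \<circ> p)))"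
    unfolding chamber_sign_def
    by (rule sum.mono_neutral_right)
      (use chamber_permute_id[OF _ assms] in \<open>auto simp: finite_permutations permutes_id\<close>)
  then show ?thesis using assms by simp
qed

lemma chamber_sign_cong:
  assumes "\<And>j. j < N \<Longrightarrow> b j = b' j" shows "chamber_sign N b = chamber_sign N b'"
proof -
  have "chamber N (b \<circ> p) = chamber N (b' \<circ> p)" if "p permutes {..<N}" for p
    using permutes_in_image[OF that] assms unfolding chamber_def by auto
  then show ?thesis unfolding chamber_sign_def by (auto intro!: sum.cong)
qed

lemma chamber_sign_permute:
  assumes q: "q permutes {..<N}"
  shows "chamber_sign N (b \<circ> q) = signof q * chamber_sign N b"
proof -
  have "(\<Sum>p | p permutes {..<N}. signof p * of_bool (chamber N (b \<circ> p))) =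
      (\<Sum>p | p permutes {..<N}. signof (q \<circ> p) * of_bool (chamber N (b \<circ> (q \<circ> p))) :: real)"
    using q by (rule setum_permutations_compose_left)
  also have "\<dots> = (\<Sum>p | p permutes {..<N}. signof q * (signof p * of_bool (chamber N (b \<circ> q \<circ> p))))"
  proof (rule sum.cong)
    fix p assume "p \<in> {p. p permutes {..<N}}"
    then have "sign (q \<circ> p) = sign q * sign p"
      using q permutation_permutes by (intro sign_compose) blast+
    then show "(signof (q \<circ> p) * of_bool (chamber N (b \<circ> (q \<circ> p))) :: real) =
        signof q * (signof p * of_bool (chamber N (b \<circ> q \<circ> p)))"
      by (simp add: o_assoc)
  qed simp
  also have "\<dots> = signof q * chamber_sign N (b \<circ> q)"
    by (simp add: chamber_sign_def sum_distrib_left)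
  finally have "chamber_sign N b = signof q * chamber_sign N (b \<circ> q)"
    by (simp add: chamber_sign_def)
  moreover have "signof q * signof q = (1::real)"
    by (simp flip: of_int_mult)
  ultimately show ?thesis
    by (metis mult.assoc mult_1)
qed

text \<open>The number of summands. The sharp bound is 1, but any bound free of n will do.\<close>

lemma chamber_sign_bound: "\<bar>chamber_sign N b\<bar> \<le> fact N"
proof -
  have "\<bar>chamber_sign N b\<bar> \<le> (\<Sum>p | p permutes {..<N}. 1)"
    unfolding chamber_sign_def
    by (intro order.trans[OF sum_abs] sum_mono) (auto simp: abs_mult sign_def)
  also have "\<dots> = fact N"
    by (simp add: card_permutations)
  finally show ?thesis .
qed

definition survival :: "nat \<Rightarrow> nat \<Rightarrow> (nat \<Rightarrow> nat) \<Rightarrow> real" where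
  "survival N n = walk_mean N n (\<lambda>l. of_bool (alive N l))"

lemma future_antisymmetric_chamber_sign: "future_antisymmetric N (\<lambda>l. chamber_sign N (last l))"
  unfolding future_antisymmetric_def
proof (intro allI impI)
  fix a l i j assume ij: "i < N" "j < N" "i \<noteq> (j::nat)" and l: "l \<noteq> ([] :: (nat \<Rightarrow> nat) list)"
  let ?p = "Transposition.transpose i j"
  have "?p permutes {..<N}"
    using ij by (intro permutes_swap_id) auto
  then show "chamber_sign N (last (a @ map (\<lambda>k. k \<circ> ?p) l)) = - chamber_sign N (last (a @ l))"
    using chamber_sign_permute[of ?p N "last l"] ij l by (simp add: sign_swap_id last_map)
qed

text \<open>A surviving path ends in the chamber, where the sign is 1, and reflection then lifts the
  restriction to surviving paths. This is a Karlin-McGregor formula summed over the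
  endpoints.\<close>

lemma survival_eq_chamber_sign:
  assumes "chamber N k"
  shows "survival N n k = walk_mean N n (\<lambda>l. chamber_sign N (last l)) k"
proof -
  have "survival N n k = walk_mean N n (\<lambda>l. of_bool (alive N l) * chamber_sign N (last l)) k"
    unfolding survival_def
  proof (rule walk_mean_cong)
    fix l :: "(nat \<Rightarrow> nat) list" assume "length l = Suc n"
    then have "l \<noteq> []" by auto
    then have "alive N l \<Longrightarrow> chamber N (last l)" by (auto simp: alive_def)
    then show "of_bool (alive N l) = of_bool (alive N l) * chamber_sign N (last l)"
      by (auto simp: chamber_sign_chamber)
  qed
  also have "\<dots> = walk_mean N n (\<lambda>l. chamber_sign N (last l)) k"
    using assms by (intro walk_mean_alive future_antisymmetric_chamber_sign) (auto simp: chamber_def less_imp_le)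
  finally show ?thesis .
qed

section \<open>Signed counts of endpoints and their Newton expansion\<close>

definition grid :: "nat \<Rightarrow> nat \<Rightarrow> (nat \<Rightarrow> nat) set" where
  "grid N L = PiE {..<N} (\<lambda>_. {..L})"

lemma finite_grid [simp]: "finite (grid N L)"
  by (simp add: grid_def finite_PiE)

text \<open>The signed count of endpoints when the coordinates have generating polynomials \<open>P j\<close>.\<close>

definition signed_count :: "nat \<Rightarrow> nat \<Rightarrow> (nat \<Rightarrow> real poly) \<Rightarrow> real" where
  "signed_count N L P = (\<Sum>b\<in>grid N L. chamber_sign N b * (\<Prod>j<N. coeff (P j) (b j)))"

lemma step_avg_power_indicator:
  "(step_avg ^^ n) (\<lambda>x. of_bool (x = b)) k = coeff (monom 1 k * step_poly ^ n) b"
proof (induction n arbitrary: k)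
  case (Suc n)
  have "coeff (monom 1 k * step_poly ^ n) b + coeff (monom 1 (Suc k) * step_poly ^ n) b =
      2 * coeff (monom 1 k * (step_poly * step_poly ^ n)) b"
    by (simp add: step_poly_mult monom_Suc distrib_left)
  with Suc show ?case by (simp add: step_avg_def)
qed simp

lemma survival_eq_signed_count:
  assumes "chamber N k" and L: "\<And>j. j < N \<Longrightarrow> k j + n \<le> L"
  shows "survival N n k = signed_count N L (\<lambda>j. monom 1 (k j) * step_poly ^ n)"
proof -
  \<comment> \<open>Writing the endpoint as a sum of indicators over the grid yields products over
    coordinates, whose means factor. The bound L is large enough that no endpoint is cut
    off.\<close>
  have "survival N n k =
      walk_mean N n (\<lambda>l. \<Sum>b\<in>grid N L. chamber_sign N b * (\<Prod>j<N. of_bool (last l j = b j))) k"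
    unfolding survival_eq_chamber_sign[OF assms(1)]
  proof (rule walk_mean_cong_bounded)
    fix l :: "(nat \<Rightarrow> nat) list" assume "\<And>j. last l j \<le> k j + n"
    then have bound: "j < N \<Longrightarrow> last l j \<le> L" for j
      using L[of j] by (meson order.trans)
    let ?b = "restrict (last l) {..<N}"
    have "(\<Sum>b\<in>grid N L. chamber_sign N b * (\<Prod>j<N. of_bool (last l j = b j))) =
        (\<Sum>b\<in>{?b}. chamber_sign N b * (\<Prod>j<N. of_bool (last l j = b j)))"
    proof (rule sum.mono_neutral_right)
      show "{?b} \<subseteq> grid N L" using bound by (auto simp: grid_def)
      show "\<forall>b\<in>grid N L - {?b}. chamber_sign N b * (\<Prod>j<N. of_bool (last l j = b j)) = 0"
      proof
        fix b assume b: "b \<in> grid N L - {?b}"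
        have "\<exists>j<N. last l j \<noteq> b j"
        proof (rule ccontr)
          assume "\<not> (\<exists>j<N. last l j \<noteq> b j)"
          then have "b = ?b" using b by (intro extensionalityI[of b "{..<N}"]) (auto simp: grid_def PiE_def)
          with b show False by simp
        qed
        then show "chamber_sign N b * (\<Prod>j<N. of_bool (last l j = b j)) = 0"
          by (auto simp: prod_zero_iff)
      qed
    qed simp
    also have "\<dots> = chamber_sign N (last l)"
      by (simp add: prod.neutral chamber_sign_cong[of N ?b "last l"])
    finally show "chamber_sign N (last l) = (\<Sum>b\<in>grid N L. chamber_sign N b * (\<Prod>j<N. of_bool (last l j = b j)))"
      by simp
  qed
  also have "\<dots> = signed_count N L (\<lambda>j. monom 1 (k j) * step_poly ^ n)"
    unfolding walk_mean_sum walk_mean_cmult signed_count_def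
    by (simp add: walk_mean_prod[where f = "\<lambda>j x. of_bool (x = b j)" for b] step_avg_power_indicator)
  finally show ?thesis .
qed

text \<open>After the sign is bounded, the sum over the grid of a product of absolute coefficients
  factors into l1 norms.\<close>

lemma signed_count_bound: "\<bar>signed_count N L P\<bar> \<le> fact N * (\<Prod>j<N. coeff_norm (P j))"
proof -
  have "\<bar>signed_count N L P\<bar> \<le> (\<Sum>b\<in>grid N L. fact N * (\<Prod>j<N. \<bar>coeff (P j) (b j)\<bar>))"
    unfolding signed_count_def
    by (intro order.trans[OF sum_abs] sum_mono)
      (auto simp: abs_mult abs_prod intro!: mult_right_mono chamber_sign_bound prod_nonneg)
  also have "\<dots> = fact N * (\<Prod>j<N. \<Sum>b\<le>L. \<bar>coeff (P j) b\<bar>)"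
    unfolding grid_def by (subst prod_sum_PiE) (simp_all add: sum_distrib_left)
  also have "\<dots> \<le> fact N * (\<Prod>j<N. coeff_norm (P j))"
    by (intro mult_left_mono prod_mono conjI sum_nonneg sum_coeff_le_coeff_norm) auto
  finally show ?thesis .
qed

lemma signed_count_permute:
  assumes p: "p permutes {..<N}"
  shows "signed_count N L (P \<circ> p) = signof p * signed_count N L P"
proof -
  have inv: "b \<circ> q \<in> grid N L" if "b \<in> grid N L" "q permutes {..<N}" for b q
    using that permutes_in_image[OF that(2)] unfolding grid_def PiE_iff extensional_def
    by (auto simp: permutes_not_in)
  have "signed_count N L (P \<circ> p) = (\<Sum>b\<in>grid N L. chamber_sign N (b \<circ> p) * (\<Prod>j<N. coeff ((P \<circ> p) j) ((b \<circ> p) j)))"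
    unfolding signed_count_def
    by (rule sum.reindex_bij_witness[of _ "\<lambda>b. b \<circ> p" "\<lambda>b. b \<circ> Hilbert_Choice.inv p"])
      (auto simp: inv p permutes_inv o_assoc[symmetric] permutes_inv_o[OF p] )
  also have "\<dots> = (\<Sum>b\<in>grid N L. signof p * (chamber_sign N b * (\<Prod>j<N. coeff (P j) (b j))))"
  proof (rule sum.cong)
    fix b
    have "(\<Prod>j<N. coeff ((P \<circ> p) j) ((b \<circ> p) j)) = (\<Prod>j<N. coeff (P j) (b j))"
      using prod.permute[OF p, of "\<lambda>j. coeff (P j) (b j)"] by (simp add: o_def)
    then show "chamber_sign N (b \<circ> p) * (\<Prod>j<N. coeff ((P \<circ> p) j) ((b \<circ> p) j)) =
        signof p * (chamber_sign N b * (\<Prod>j<N. coeff (P j) (b j)))"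
      using chamber_sign_permute[OF p] by simp
  qed simp
  finally show ?thesis by (simp add: signed_count_def sum_distrib_left)
qed

text \<open>Exchanging two equal generating polynomials both fixes and negates the count.\<close>

lemma signed_count_eq_0:
  assumes "\<not> inj_on P {..<N}"
  shows "signed_count N L P = 0"
proof -
  obtain i j where ij: "i < N" "j < N" "i \<noteq> j" "P i = P j"
    using assms by (auto simp: inj_on_def)
  let ?p = "Transposition.transpose i j"
  have "P \<circ> ?p = P" using ij by (auto simp: fun_eq_iff Transposition.transpose_def)
  moreover have "?p permutes {..<N}" using ij by (intro permutes_swap_id) auto
  ultimately have "signed_count N L P = - signed_count N L P"
    using signed_count_permute[of ?p N L P] ij by (simp add: sign_swap_id)
  then show ?thesis by simp
qed

text \<open>Newton's forward difference formula, \<open>z\<^sup>k = (1 - (1 - z))\<^sup>k\<close>.\<close>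

lemma coeff_monom_mult_newton:
  assumes "k \<le> K"
  shows "coeff (monom 1 k * q) b =
    (\<Sum>i\<le>K. real (k choose i) * (-1) ^ i * coeff ([:1, -1:] ^ i * q) b)"
proof -
  have "monom 1 k = (monom 1 1 :: real poly) ^ k"
    by (simp add: monom_power)
  also have "(monom 1 1 :: real poly) = Polynomial.smult (-1) [:1, -1:] + 1"
    by (simp add: monom_altdef one_pCons)
  also have "\<dots> ^ k = (\<Sum>i\<le>k. of_nat (k choose i) * Polynomial.smult (-1) [:1, -1:] ^ i)"
    by (subst binomial_ring) simp
  also have "\<dots> = (\<Sum>i\<le>k. Polynomial.smult (real (k choose i) * (-1) ^ i) ([:1, -1:] ^ i))"
  proof (intro sum.cong refl)
    have "of_nat c * Polynomial.smult (-1) d ^ i = Polynomial.smult (real c * (-1) ^ i) (d ^ i)" for c i and d :: "real poly"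
      unfolding smult_power of_nat_poly by (simp add: mult.commute)
    then show "of_nat (k choose i) * Polynomial.smult (-1) [:1, -1:] ^ i =
        Polynomial.smult (real (k choose i) * (-1) ^ i) ([:1, -1:] ^ i)" for i .
  qed
  also have "\<dots> = (\<Sum>i\<le>K. Polynomial.smult (real (k choose i) * (-1) ^ i) ([:1, -1:] ^ i))"
    using assms by (intro sum.mono_neutral_left) (auto simp: binomial_eq_0)
  finally show ?thesis
    by (simp add: sum_distrib_right coeff_sum)
qed

text \<open>The count is multilinear in the generating polynomials. Letting all orders run up to K,
  past the single \<open>k j\<close>, gives an index set common to all starting points.\<close>

lemma signed_count_newton:
  assumes "\<And>j. j < N \<Longrightarrow> k j \<le> K"
  shows "signed_count N L (\<lambda>j. monom 1 (k j) * q) =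
    (\<Sum>m\<in>grid N K. (\<Prod>j<N. real (k j choose m j) * (-1) ^ m j) *
       signed_count N L (\<lambda>j. [:1, -1:] ^ m j * q))"
proof -
  have "signed_count N L (\<lambda>j. monom 1 (k j) * q) =
      (\<Sum>b\<in>grid N L. chamber_sign N b *
        (\<Sum>m\<in>grid N K. \<Prod>j<N. real (k j choose m j) * (-1) ^ m j * coeff ([:1, -1:] ^ m j * q) (b j)))"
    unfolding signed_count_def grid_def
    by (subst prod_sum_PiE[symmetric]) (simp_all add: coeff_monom_mult_newton[OF assms])
  also have "\<dots> = (\<Sum>m\<in>grid N K. \<Sum>b\<in>grid N L. chamber_sign N b *
        (\<Prod>j<N. real (k j choose m j) * (-1) ^ m j * coeff ([:1, -1:] ^ m j * q) (b j)))"
    unfolding sum_distrib_left by (rule sum.swap)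
  finally show ?thesis
    by (simp add: signed_count_def sum_distrib_left prod.distrib mult_ac)
qed

text \<open>The elements of A outside \<open>{..<N}\<close> are as many as the missing ones and each
  is larger. Hence distinct orders of differences other than a permutation of \<open>{..<N}\<close>
  have total at least one more, which is the gain in the remainder.\<close>

lemma sum_nat_set_gt:
  fixes A :: "nat set"
  assumes "finite A" "card A = N" "A \<noteq> {..<N}"
  shows "\<Sum>{..<N} < \<Sum>A"
proof -
  let ?X = "A - {..<N}" and ?Y = "{..<N} - A"
  have fin: "finite ?X" "finite ?Y" using assms by auto
  have "card A = card (A \<inter> {..<N}) + card ?X" "card {..<N} = card (A \<inter> {..<N}) + card ?Y"
    using sum.Int_Diff[of A "\<lambda>_. 1::nat" "{..<N}"] sum.Int_Diff[of "{..<N}" "\<lambda>_. 1::nat" A] assms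
    by (simp_all add: Int_commute)
  then have c: "card ?X = card ?Y" using assms(2) by simp
  have "?Y \<noteq> {}"
  proof
    assume "?Y = {}"
    then have "{..<N} \<subseteq> A" by auto
    with assms card_subset_eq[of A "{..<N}"] show False by auto
  qed
  then have "0 < card ?Y" using fin by (simp add: card_gt_0_iff)
  have "\<Sum>?Y + card ?Y = (\<Sum>y\<in>?Y. y + 1)" by (simp only: sum.distrib card_eq_sum)
  also have "\<dots> \<le> (\<Sum>y\<in>?Y. N)" by (intro sum_mono) auto
  also have "\<dots> = (\<Sum>x\<in>?X. N)" by (simp add: c)
  also have "\<dots> \<le> \<Sum>?X" by (intro sum_mono) auto
  finally have "\<Sum>?Y < \<Sum>?X" using \<open>0 < card ?Y\<close> by linarith
  moreover have "\<Sum>A = \<Sum>(A \<inter> {..<N}) + \<Sum>?X"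
    using assms by (simp add: sum.Int_Diff)
  moreover have "\<Sum>{..<N} = \<Sum>(A \<inter> {..<N}) + \<Sum>?Y"
    using sum.Int_Diff[of "{..<N}" "\<lambda>x. x" A] by (simp add: Int_commute)
  ultimately show ?thesis by linarith
qed

text \<open>The binomial x choose l is a polynomial in x with leading coefficient 1 / l!.\<close>

lemma det_binomial:
  "Determinant.det (Matrix.mat N N (\<lambda>(j, l). real (k j choose l))) =
     (\<Prod>l<N. 1 / fact l) * vandermonde_nat N k"
proof -
  define P :: "nat \<Rightarrow> real poly" where "P l = Polynomial.smult (1 / fact l) (\<Prod>i<l. [:- real i, 1:])" for l
  have ev: "poly (P l) (real x) = real (x choose l)" for l x
    by (simp add: P_def binomial_gbinomial gbinomial_prod_rev poly_prod atLeast0LessThan)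
  have deg: "degree (\<Prod>i<l. [:- real i, 1:]) = l" for l
    by (subst degree_prod_eq_sum_degree) auto
  have co: "coeff (P l) l = 1 / fact l" for l
    using lead_coeff_prod[of "\<lambda>i. [:- real i, 1:]" "{..<l}"] by (simp add: P_def deg)
  show ?thesis
    using det_poly_eval_triangular[of N P "\<lambda>j. real (k j)"]
    by (simp add: ev co) (simp add: P_def deg)
qed

text \<open>In the Newton expansion, antisymmetry leaves only the orders of differences that are pairwise distinct:
  permutations of \<open>0, \<dots>, N - 1\<close>, which sum up to a determinant, and families of larger total order.\<close>

lemma survival_expansion:
  assumes "N \<le> K"
  shows "\<exists>\<beta>. \<forall>k. chamber N k \<longrightarrow> (\<forall>j<N. k j \<le> K) \<longrightarrow> (\<exists>C. \<forall>n>0.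
     \<bar>survival N n k - \<beta> n * vandermonde_nat N k\<bar> \<le> C * (1 / sqrt (real n)) ^ Suc (\<Sum>{..<N}))"
proof -
  let ?D = "\<lambda>n m j. [:1, -1:] ^ m j * step_poly ^ n"
  \<comment> \<open>The count for the orders 0, ..., N - 1 in this arrangement, with Newton's signs
    and the constant of \<open>det_binomial\<close>. It depends on n and K, not on the starting
    point.\<close>
  define \<beta> where "\<beta> n = (\<Prod>l<N. (-1) ^ l) * signed_count N (K + n) (?D n id) * (\<Prod>l<N. 1 / fact l)" for n
  define Perm where "Perm = (\<lambda>p. restrict p {..<N}) ` {p. p permutes {..<N}}"
  have PermI: "m \<in> Perm" if m: "m \<in> grid N K" "m ` {..<N} = {..<N}" for m
  proof -
    define p where "p j = (if j < N then m j else j)" for j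
    have "p ` {..<N} = {..<N}" using m(2) by (auto simp: p_def)
    moreover from this have "inj_on p {..<N}" by (intro eq_card_imp_inj_on) auto
    ultimately have "bij_betw p {..<N} {..<N}" by (simp add: bij_betw_def)
    then have "p permutes {..<N}" by (rule bij_imp_permutes) (simp add: p_def)
    moreover have "m = restrict p {..<N}"
      using m(1) by (auto simp: fun_eq_iff p_def grid_def PiE_def extensional_def)
    ultimately show ?thesis by (auto simp: Perm_def)
  qed
  have Perm_sub: "Perm \<subseteq> grid N K"
  proof
    fix m assume "m \<in> Perm"
    then obtain p where p: "p permutes {..<N}" "m = restrict p {..<N}" by (auto simp: Perm_def)
    have "p j < N" if "j < N" for j using permutes_in_image[OF p(1), of j] that by simp
    then show "m \<in> grid N K" using assms p(2) by (auto simp: grid_def) (meson less_imp_le order.trans)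
  qed
  show ?thesis
  proof (intro exI[of _ \<beta>] allI impI)
    fix k assume k: "chamber N k" "\<forall>j<N. k j \<le> K"
    let ?c = "\<lambda>m. \<Prod>j<N. real (k j choose m j) * (-1) ^ m j"
    define C where "C = (\<Sum>m\<in>grid N K - Perm. \<bar>?c m\<bar> * (fact N * (\<Prod>j<N. (2 * sqrt (real (m j))) ^ m j)))"
    have "\<bar>survival N n k - \<beta> n * vandermonde_nat N k\<bar> \<le> C * (1 / sqrt (real n)) ^ Suc (\<Sum>{..<N})"
      if n: "n > 0" for n
    proof -
      let ?A = "\<lambda>m. signed_count N (K + n) (?D n m)"
      have "survival N n k = (\<Sum>m\<in>grid N K. ?c m * ?A m)"
        using k by (subst survival_eq_signed_count[where L = "K + n"]) (auto simp: signed_count_newton)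
      also have "\<dots> = (\<Sum>m\<in>grid N K - Perm. ?c m * ?A m) + (\<Sum>m\<in>Perm. ?c m * ?A m)"
        using Perm_sub by (intro sum.subset_diff) auto
      also have "(\<Sum>m\<in>Perm. ?c m * ?A m) = (\<Sum>p | p permutes {..<N}. ?c (restrict p {..<N}) * ?A (restrict p {..<N}))"
        unfolding Perm_def
      proof (rule sum.reindex[unfolded o_def])
        show "inj_on (\<lambda>p. restrict p {..<N}) {p. p permutes {..<N}}"
        proof (rule inj_onI, rule ext)
          fix p q x assume "p \<in> {p. p permutes {..<N}}" "q \<in> {p. p permutes {..<N}}"
            "restrict p {..<N} = restrict q {..<N}"
          then show "p x = q x"
            by (cases "x < N") (auto simp: permutes_not_in dest: fun_cong[of _ _ x])
        qed
      qed
      also have "\<dots> = (\<Sum>p | p permutes {..<N}.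
          (\<Prod>l<N. (-1) ^ l) * ?A id * (signof p * (\<Prod>j<N. real (k j choose p j))))"
      proof (rule sum.cong)
        fix p assume "p \<in> {p. p permutes {..<N}}"
        then have p: "p permutes {..<N}" by simp
        have "?A (restrict p {..<N}) = signed_count N (K + n) (?D n id \<circ> p)"
          unfolding signed_count_def by (intro sum.cong prod.cong arg_cong2[where f = "(*)"]) auto
        then have A: "?A (restrict p {..<N}) = signof p * ?A id"
          using signed_count_permute[OF p] by simp
        have "(\<Prod>j<N. (-1::real) ^ p j) = (\<Prod>l<N. (-1) ^ l)"
          using prod.permute[OF p, of "\<lambda>l. (-1::real) ^ l"] by (simp add: o_def)
        then have "?c (restrict p {..<N}) = (\<Prod>j<N. real (k j choose p j)) * (\<Prod>l<N. (-1) ^ l)"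
          by (simp add: prod.distrib)
        with A show "?c (restrict p {..<N}) * ?A (restrict p {..<N}) =
            (\<Prod>l<N. (-1) ^ l) * ?A id * (signof p * (\<Prod>j<N. real (k j choose p j)))"
          by (simp add: mult_ac)
      qed simp
      also have "\<dots> = \<beta> n * vandermonde_nat N k"
        using det_binomial[of N k] unfolding det_mat_leibniz sum_distrib_left[symmetric]
        by (simp add: \<beta>_def)
      finally have "\<bar>survival N n k - \<beta> n * vandermonde_nat N k\<bar> \<le> (\<Sum>m\<in>grid N K - Perm. \<bar>?c m * ?A m\<bar>)"
        using sum_abs[of "\<lambda>m. ?c m * ?A m" "grid N K - Perm"] by simp
      also have "\<dots> \<le> (\<Sum>m\<in>grid N K - Perm. \<bar>?c m\<bar> * (fact N * (\<Prod>j<N. (2 * sqrt (real (m j))) ^ m j) *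
          (1 / sqrt (real n)) ^ Suc (\<Sum>{..<N})))"
      proof (rule sum_mono)
        fix m assume m: "m \<in> grid N K - Perm"
        \<comment> \<open>Repeated orders cancel by antisymmetry. Distinct ones that are no
          permutation have total at least a + 1, and surplus powers of 1 / sqrt n \<le> 1 are
          dropped.\<close>
        have "\<bar>?A m\<bar> \<le> fact N * (\<Prod>j<N. (2 * sqrt (real (m j))) ^ m j) * (1 / sqrt (real n)) ^ Suc (\<Sum>{..<N})"
        proof (cases "inj_on m {..<N}")
          case False
          then obtain i j where "i < N" "j < N" "i \<noteq> j" "m i = m j" by (auto simp: inj_on_def)
          then have "\<not> inj_on (?D n m) {..<N}" by (intro notI) (auto dest: inj_onD[of _ _ i j])
          then show ?thesis
            using signed_count_eq_0[of "?D n m" N] by (simp add: prod_nonneg)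
        next
          case True
          have "m ` {..<N} \<noteq> {..<N}" using m PermI by blast
          then have "\<Sum>{..<N} < \<Sum>(m ` {..<N})"
            using True by (intro sum_nat_set_gt) (auto simp: card_image)
          then have gt: "Suc (\<Sum>{..<N}) \<le> (\<Sum>j<N. m j)"
            using True by (simp add: sum.reindex)
          have "\<bar>?A m\<bar> \<le> fact N * (\<Prod>j<N. coeff_norm (?D n m j))"
            by (rule signed_count_bound)
          also have "\<dots> \<le> fact N * (\<Prod>j<N. (2 * sqrt (real (m j)) / sqrt (real n)) ^ m j)"
            by (intro mult_left_mono prod_mono conjI coeff_norm_nonneg coeff_norm_iterated_difference n) auto
          also have "(\<Prod>j<N. (2 * sqrt (real (m j)) / sqrt (real n)) ^ m j) =
              (\<Prod>j<N. (2 * sqrt (real (m j))) ^ m j) * (1 / sqrt (real n)) ^ (\<Sum>j<N. m j)"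
            by (simp add: power_divide prod_dividef power_sum)
          also have "fact N * ((\<Prod>j<N. (2 * sqrt (real (m j))) ^ m j) * (1 / sqrt (real n)) ^ (\<Sum>j<N. m j)) \<le>
              fact N * ((\<Prod>j<N. (2 * sqrt (real (m j))) ^ m j) * (1 / sqrt (real n)) ^ Suc (\<Sum>{..<N}))"
            using n gt by (intro mult_left_mono power_decreasing prod_nonneg) auto
          finally show ?thesis by (simp add: mult.assoc)
        qed
        then show "\<bar>?c m * ?A m\<bar> \<le> \<bar>?c m\<bar> * (fact N * (\<Prod>j<N. (2 * sqrt (real (m j))) ^ m j) *
            (1 / sqrt (real n)) ^ Suc (\<Sum>{..<N}))"
          unfolding abs_mult by (intro mult_left_mono) auto
      qed
      also have "\<dots> = C * (1 / sqrt (real n)) ^ Suc (\<Sum>{..<N})"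
        unfolding C_def sum_distrib_right by (intro sum.cong) (auto simp: mult_ac)
      finally show ?thesis .
    qed
    then show "\<exists>C. \<forall>n>0. \<bar>survival N n k - \<beta> n * vandermonde_nat N k\<bar> \<le> C * (1 / sqrt (real n)) ^ Suc (\<Sum>{..<N})"
      by blast
  qed
qed

section \<open>Moments of the endpoint and the order of the survival probability\<close>

lemma cosh_le_one_plus_square:
  fixes u :: real
  assumes "0 \<le> u" "u \<le> 1"
  shows "cosh u \<le> 1 + u\<^sup>2"
proof -
  have "exp (- u) \<le> 1 / (1 + u)"
    using assms exp_ge_add_one_self[of u] by (simp add: exp_minus field_simps)
  also have "\<dots> \<le> 1 - u + u\<^sup>2"
  proof -
    have "(1 - u + u\<^sup>2) * (1 + u) = 1 + u * u\<^sup>2" by (simp add: algebra_simps power2_eq_square)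
    then show ?thesis using assms by (simp add: divide_le_eq)
  qed
  finally have "exp (- u) \<le> 1 - u + u\<^sup>2" .
  moreover have "exp u \<le> 1 + u + u\<^sup>2" using assms by (rule exp_bound)
  ultimately show ?thesis by (simp add: cosh_def)
qed

text \<open>By the addition formula, cosh is an eigenfunction of averaging, up to the drift 1 / 2 of
  each step.\<close>

lemma step_avg_power_cosh:
  "(step_avg ^^ n) (\<lambda>x. A * cosh (\<theta> * (real x - c))) x =
    A * cosh (\<theta> / 2) ^ n * cosh (\<theta> * (real x + real n / 2 - c))"
proof (induction n arbitrary: x)
  case (Suc n)
  let ?y = "\<theta> * (real x + real (Suc n) / 2 - c)"
  have "\<theta> * (real x + real n / 2 - c) = ?y - \<theta> / 2" "\<theta> * (real (Suc x) + real n / 2 - c) = ?y + \<theta> / 2"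
    by (simp_all add: field_simps)
  with Suc show ?case
    by (simp add: step_avg_def cosh_add cosh_diff del: of_nat_Suc) (simp add: algebra_simps)
qed simp

lemma abs_vandermonde_le:
  fixes x :: "nat \<Rightarrow> real"
  assumes "\<And>j. j < N \<Longrightarrow> \<bar>x j\<bar> \<le> Y"
  shows "\<bar>vandermonde_det N x\<bar> \<le> fact N * Y ^ \<Sum>{..<N}"
proof -
  have "\<bar>vandermonde_det N x\<bar> \<le> (\<Sum>p | p permutes {..<N}. Y ^ \<Sum>{..<N})"
    unfolding vandermonde_det_leibniz
  proof (intro order.trans[OF sum_abs] sum_mono)
    fix p assume "p \<in> {p. p permutes {..<N}}"
    then have p: "p permutes {..<N}" by simp
    have "\<bar>signof p * (\<Prod>j<N. x j ^ p j)\<bar> = (\<Prod>j<N. \<bar>x j\<bar> ^ p j)"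
      by (simp add: abs_mult abs_prod power_abs sign_def)
    also have "\<dots> \<le> (\<Prod>j<N. Y ^ p j)"
      using assms by (intro prod_mono conjI power_mono) auto
    also have "\<dots> = Y ^ \<Sum>{..<N}"
      using sum.permute[OF p, of "\<lambda>j. j"] by (simp add: o_def flip: power_sum)
    finally show "\<bar>signof p * (\<Prod>j<N. x j ^ p j)\<bar> \<le> Y ^ \<Sum>{..<N}" .
  qed
  then show ?thesis by (simp add: card_permutations)
qed

lemma power_le_fact_exp:
  fixes y :: real
  assumes "0 \<le> y"
  shows "y ^ e \<le> fact e * exp y"
proof -
  have "y ^ e / fact e \<le> (\<Sum>n. y ^ n / fact n)"
    using sum_le_suminf[OF summable_exp_generic[of y], of "{e}"] assms
    by (simp add: divide_inverse mult.commute scaleR_conv_of_real)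
  also have "\<dots> = exp y" by (simp add: exp_def scaleR_conv_of_real divide_inverse mult.commute)
  finally show ?thesis by (simp add: divide_le_eq mult.commute)
qed

text \<open>After centring, |h|^r is at most a power of sqrt n times an exponential of the rescaled
  coordinates. That exponential splits into factors bounded by cosh, whose means stay bounded in
  n.\<close>

lemma vandermonde_moment:
  "\<exists>G. \<forall>n>0. walk_mean N n (\<lambda>l. \<bar>vandermonde_nat N (last l)\<bar> ^ r) k \<le> G * sqrt (real n) ^ (\<Sum>{..<N} * r)"
proof -
  let ?a = "\<Sum>{..<N}"
  \<comment> \<open>The product collects exp |w| \<le> 2 cosh w, the bound cosh (1 / (2 s))^n \<le>
    exp (n / (4 s^2)) = exp (1/4) for s = sqrt n, and the effect of the start. The other factors
    come from Leibniz' formula and from y^e \<le> e! exp y.\<close>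
  define G where "G = fact N ^ r * fact (?a * r) * exp 1 * (\<Prod>j<N. 2 * exp (1/4) * cosh (real (k j)))"
  have "walk_mean N n (\<lambda>l. \<bar>vandermonde_nat N (last l)\<bar> ^ r) k \<le> G * sqrt (real n) ^ (?a * r)"
    if n: "n > 0" for n
  proof -
    define s where "s = sqrt (real n)"
    have s: "s \<ge> 1" using n by (simp add: s_def)
    have ss: "s\<^sup>2 = real n" by (simp add: s_def)
    define x where "x b j = real (b j) - real n / 2" for b :: "nat \<Rightarrow> nat" and j
    define A where "A = fact N ^ r * s ^ (?a * r) * fact (?a * r) * exp 1"
    have pt: "\<bar>vandermonde_nat N b\<bar> ^ r \<le> A * (\<Prod>j<N. 2 * cosh (1 / s * (real (b j) - real n / 2)))" for b
    proof -
      define y where "y = 1 + (\<Sum>j<N. \<bar>x b j\<bar> / s)"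
      have y: "y \<ge> 0" using s by (auto simp: y_def intro!: add_nonneg_nonneg sum_nonneg)
      have "\<bar>x b j\<bar> \<le> s * y" if "j < N" for j
      proof -
        have "\<bar>x b j\<bar> / s \<le> (\<Sum>j<N. \<bar>x b j\<bar> / s)"
          using that s by (intro member_le_sum) auto
        then have "\<bar>x b j\<bar> / s \<le> y" by (simp add: y_def)
        then show ?thesis using s by (simp add: divide_le_eq mult.commute)
      qed
      then have "\<bar>vandermonde_det N (x b)\<bar> \<le> fact N * (s * y) ^ ?a"
        by (rule abs_vandermonde_le)
      moreover have "vandermonde_nat N b = vandermonde_det N (x b)"
        using vandermonde_det_affine[of N "- real n / 2" 1 "\<lambda>j. real (b j)"] by (simp add: x_def[abs_def])
      ultimately have "\<bar>vandermonde_nat N b\<bar> ^ r \<le> (fact N * (s * y) ^ ?a) ^ r"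
        by (intro power_mono) auto
      also have "\<dots> = fact N ^ r * s ^ (?a * r) * y ^ (?a * r)"
        by (simp add: power_mult_distrib power_mult)
      also have "\<dots> \<le> fact N ^ r * s ^ (?a * r) * (fact (?a * r) * exp y)"
        using s y by (intro mult_left_mono power_le_fact_exp) auto
      also have "exp y = exp 1 * (\<Prod>j<N. exp (\<bar>x b j\<bar> / s))"
        by (simp add: y_def exp_add exp_sum)
      also have "fact N ^ r * s ^ (?a * r) * (fact (?a * r) * (exp 1 * (\<Prod>j<N. exp (\<bar>x b j\<bar> / s)))) =
          A * (\<Prod>j<N. exp (\<bar>x b j\<bar> / s))"
        by (simp add: A_def)
      also have "\<dots> \<le> A * (\<Prod>j<N. 2 * cosh (1 / s * (real (b j) - real n / 2)))"
      proof (intro mult_left_mono prod_mono conjI)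
        fix j
        have "exp \<bar>w\<bar> \<le> 2 * cosh w" for w :: real
          by (cases "w \<ge> 0") (simp_all add: cosh_def)
        from this[of "x b j / s"] show "exp (\<bar>x b j\<bar> / s) \<le> 2 * cosh (1 / s * (real (b j) - real n / 2))"
          using s by (simp add: x_def)
      qed (use s in \<open>auto simp: A_def\<close>)
      finally show ?thesis .
    qed
    have "walk_mean N n (\<lambda>l. \<bar>vandermonde_nat N (last l)\<bar> ^ r) k \<le>
        A * walk_mean N n (\<lambda>l. \<Prod>j<N. 2 * cosh (1 / s * (real (last l j) - real n / 2))) k"
      unfolding walk_mean_cmult[symmetric] by (intro walk_mean_mono pt)
    also have "walk_mean N n (\<lambda>l. \<Prod>j<N. 2 * cosh (1 / s * (real (last l j) - real n / 2))) k =
        (\<Prod>j<N. 2 * cosh (1 / s / 2) ^ n * cosh (1 / s * real (k j)))"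
      by (subst walk_mean_prod[where f = "\<lambda>j x. 2 * cosh (1 / s * (real x - real n / 2))"])
        (subst step_avg_power_cosh, simp)
    also have "A * \<dots> \<le> A * (\<Prod>j<N. 2 * exp (1/4) * cosh (real (k j)))"
    proof (intro mult_left_mono prod_mono conjI mult_mono)
      have "cosh (1 / s / 2) ^ n \<le> (1 + (1 / s / 2)\<^sup>2) ^ n"
        using s by (intro power_mono cosh_le_one_plus_square) (auto simp: field_simps)
      also have "\<dots> \<le> exp ((1 / s / 2)\<^sup>2) ^ n"
        using exp_ge_add_one_self by (intro power_mono) auto
      also have "\<dots> = exp (real n * (1 / s / 2)\<^sup>2)"
        by (rule exp_of_nat_mult[symmetric])
      also have "real n * (1 / s / 2)\<^sup>2 = 1/4"
        using s by (simp flip: ss add: power2_eq_square field_simps)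
      finally show "cosh (1 / s / 2) ^ n \<le> exp (1/4)" .
      have "1 / s * real (k j) \<le> real (k j)" for j
        using s by (simp add: divide_le_eq mult_le_cancel_left1)
      then show "cosh (1 / s * real (k j)) \<le> cosh (real (k j))" for j
        using s by (subst cosh_real_nonneg_le_iff) auto
    qed (use s in \<open>auto simp: A_def cosh_real_nonneg\<close>)
    also have "\<dots> = G * s ^ (?a * r)"
      by (simp add: A_def G_def)
    finally show ?thesis by (simp add: s_def)
  qed
  then show ?thesis by blast
qed

text \<open>Truncation of \<open>h(k) = E (h; survival)\<close> at the level \<open>n powr (a / 2 + 1 / 4)\<close>; fourth roots of \<open>n\<close>
  turn all exponents into natural numbers.\<close>

lemma survival_lower_bound:
  assumes "chamber N k"
  shows "\<exists>G. \<forall>n>0. \<bar>vandermonde_nat N k\<bar> \<le>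
    sqrt (sqrt (real n)) ^ (2 * \<Sum>{..<N} + 1) * survival N n k + G / sqrt (sqrt (real n))"
proof -
  let ?a = "\<Sum>{..<N}" and ?V = "vandermonde_nat N"
  obtain G where G: "\<And>n. n > 0 \<Longrightarrow>
      walk_mean N n (\<lambda>l. \<bar>?V (last l)\<bar> ^ (2 * ?a + 2)) k \<le> G * sqrt (real n) ^ (?a * (2 * ?a + 2))"
    using vandermonde_moment by blast
  have "\<bar>?V k\<bar> \<le> sqrt (sqrt (real n)) ^ (2 * ?a + 1) * survival N n k + G / sqrt (sqrt (real n))"
    if n: "n > 0" for n
  proof -
    define z where "z = sqrt (sqrt (real n))"
    define R where "R = z ^ (2 * ?a + 1)"
    have z: "z > 0" using n by (simp add: z_def)
    have R: "R > 0" using z by (simp add: R_def)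
    have zz: "sqrt (real n) = z ^ 2" by (simp add: z_def)
    \<comment> \<open>Above the level R, |h| is at most |h|^(2 a + 2) / R^(2 a + 1). This power fits
      because (2 a + 1)^2 = 2 a (2 a + 2) + 1, so that exactly one factor 1 / z survives in the
      error.\<close>
    have pt: "\<bar>of_bool (alive N l) * ?V (last l)\<bar> \<le>
        R * of_bool (alive N l) + 1 / R ^ (2 * ?a + 1) * \<bar>?V (last l)\<bar> ^ (2 * ?a + 2)" for l
    proof (cases "\<bar>?V (last l)\<bar> \<le> R")
      case True
      then show ?thesis using R by (cases "alive N l") (auto intro: add_increasing2)
    next
      case False
      have "\<bar>?V (last l)\<bar> * R ^ (2 * ?a + 1) \<le> \<bar>?V (last l)\<bar> * \<bar>?V (last l)\<bar> ^ (2 * ?a + 1)"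
        using False R by (intro mult_left_mono power_mono) auto
      then have "\<bar>?V (last l)\<bar> \<le> 1 / R ^ (2 * ?a + 1) * \<bar>?V (last l)\<bar> ^ (2 * ?a + 2)"
        using R by (simp add: field_simps)
      then show ?thesis using R by (cases "alive N l") (auto intro: add_increasing)
    qed
    have "future_antisymmetric N (\<lambda>l. ?V (last l))"
      using future_antisymmetric_vandermonde[of N "\<lambda>_. 1"] by simp
    then have "?V k = walk_mean N n (\<lambda>l. of_bool (alive N l) * ?V (last l)) k"
      using assms by (subst walk_mean_alive) (auto simp: vandermonde_martingale chamber_def less_imp_le)
    then have "\<bar>?V k\<bar> \<le> walk_mean N n (\<lambda>l. \<bar>of_bool (alive N l) * ?V (last l)\<bar>) k"
      using walk_mean_abs by metis
    also have "\<dots> \<le> walk_mean N n (\<lambda>l. R * of_bool (alive N l) + 1 / R ^ (2 * ?a + 1) * \<bar>?V (last l)\<bar> ^ (2 * ?a + 2)) k"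
      by (intro walk_mean_mono pt)
    also have "\<dots> = R * survival N n k + 1 / R ^ (2 * ?a + 1) * walk_mean N n (\<lambda>l. \<bar>?V (last l)\<bar> ^ (2 * ?a + 2)) k"
      by (simp only: walk_mean_add walk_mean_cmult survival_def)
    also have "\<dots> \<le> R * survival N n k + 1 / R ^ (2 * ?a + 1) * (G * sqrt (real n) ^ (?a * (2 * ?a + 2)))"
      using R by (intro add_left_mono mult_left_mono G n) auto
    also have "1 / R ^ (2 * ?a + 1) * (G * sqrt (real n) ^ (?a * (2 * ?a + 2))) = G / z"
    proof -
      have "R ^ (2 * ?a + 1) = z ^ ((2 * ?a + 1) * (2 * ?a + 1))"
        unfolding R_def by (rule power_mult[symmetric])
      also have "(2 * ?a + 1) * (2 * ?a + 1) = Suc (2 * (?a * (2 * ?a + 2)))"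
        by (simp add: algebra_simps)
      finally have "R ^ (2 * ?a + 1) = z * sqrt (real n) ^ (?a * (2 * ?a + 2))"
        unfolding zz by (simp only: power_Suc power_mult)
      moreover have "sqrt (real n) ^ (?a * (2 * ?a + 2)) \<noteq> 0" using n by simp
      moreover have "1 / (z * w) * (G * w) = G / z" if "w \<noteq> 0" for w
        using that by simp
      ultimately show ?thesis by (simp only:)
    qed
    finally show ?thesis unfolding R_def z_def .
  qed
  then show ?thesis by blast
qed

text \<open>The start 0, ..., N - 1 calibrates \<open>\<beta>\<close>: its h is nonzero, so its
  lower bound for survival becomes one for |\<open>\<beta> n\<close>|. All other starting points are
  then compared with the same sequence.\<close>

lemma survival_asymptotics:
  assumes "N \<le> K"
  shows "\<exists>\<beta>. eventually (\<lambda>n. \<beta> n \<noteq> 0) sequentially \<and>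
    (\<forall>k. chamber N k \<longrightarrow> (\<forall>j<N. k j \<le> K) \<longrightarrow> (\<lambda>n. survival N n k / \<beta> n) \<longlonglongrightarrow> vandermonde_nat N k)"
proof -
  let ?a = "\<Sum>{..<N}" and ?V = "vandermonde_nat N"
  define z where "z n = sqrt (sqrt (real n))" for n
  have z_pos: "z n > 0" if "n > 0" for n using that by (simp add: z_def)
  have z_lim: "filterlim z at_top sequentially"
    unfolding z_def by (intro filterlim_compose[OF sqrt_at_top] filterlim_real_sequentially)
  have zinv: "(1 / sqrt (real n)) ^ Suc ?a = 1 / (z n ^ (2 * ?a + 1) * z n)" for n
  proof -
    have "sqrt (real n) = z n ^ 2" by (simp add: z_def)
    then have "(1 / sqrt (real n)) ^ Suc ?a = 1 / z n ^ (2 * Suc ?a)"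
      by (simp only: power_mult power_one_over)
    then show ?thesis by (simp add: mult_ac)
  qed
  obtain \<beta> where \<beta>: "\<And>k. chamber N k \<Longrightarrow> (\<forall>j<N. k j \<le> K) \<Longrightarrow> \<exists>C. \<forall>n>0.
     \<bar>survival N n k - \<beta> n * ?V k\<bar> \<le> C * (1 / (z n ^ (2 * ?a + 1) * z n))"
    using survival_expansion[OF assms] unfolding zinv by blast
  have id: "chamber N id" "\<forall>j<N. id j \<le> K" using assms by (auto simp: chamber_def)
  have V: "?V id \<noteq> 0" by (rule vandermonde_det_nonzero) (auto simp: inj_on_def)
  obtain C where C: "\<And>n. n > 0 \<Longrightarrow> \<bar>survival N n id - \<beta> n * ?V id\<bar> \<le> C * (1 / (z n ^ (2 * ?a + 1) * z n))"
    using \<beta>[OF id] by blast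
  obtain G where G: "\<And>n. n > 0 \<Longrightarrow> \<bar>?V id\<bar> \<le> z n ^ (2 * ?a + 1) * survival N n id + G / z n"
    using survival_lower_bound[OF id(1)] unfolding z_def by blast
  have "((\<lambda>n. (G + C) / z n) \<longlongrightarrow> 0) sequentially"
    using z_lim by (intro real_tendsto_divide_at_top[OF tendsto_const])
  then have "eventually (\<lambda>n. (G + C) / z n < \<bar>?V id\<bar> / 2) sequentially"
    using V by (intro order_tendstoD) auto
  \<comment> \<open>With R = z^(2 a + 1), expansion and lower bound combine to |h| \<le> R |\<beta>|
    |h| + (G + C) / z. Once the last term is below |h| / 2, the product R |\<beta>| is at least 1 /
    2.\<close>
  then have ev: "eventually (\<lambda>n. n > 0 \<and> 1 / 2 \<le> z n ^ (2 * ?a + 1) * \<bar>\<beta> n\<bar>) sequentially"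
    using eventually_gt_at_top[of 0]
  proof eventually_elim
    case (elim n)
    let ?R = "z n ^ (2 * ?a + 1)"
    have R: "?R > 0" using z_pos[OF elim(2)] by simp
    have "\<bar>?V id\<bar> \<le> ?R * (\<bar>\<beta> n * ?V id\<bar> + C * (1 / (?R * z n))) + G / z n"
    proof -
      have "survival N n id \<le> \<bar>\<beta> n * ?V id\<bar> + C * (1 / (?R * z n))"
        using C[OF elim(2)] by linarith
      then have "?R * survival N n id \<le> ?R * (\<bar>\<beta> n * ?V id\<bar> + C * (1 / (?R * z n)))"
        using R by (intro mult_left_mono) auto
      with G[OF elim(2)] show ?thesis by linarith
    qed
    also have "\<dots> = ?R * \<bar>\<beta> n\<bar> * \<bar>?V id\<bar> + (G + C) / z n"
      using R z_pos[OF elim(2)] by (simp add: abs_mult field_simps)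
    finally have "\<bar>?V id\<bar> * (1 / 2) \<le> ?R * \<bar>\<beta> n\<bar> * \<bar>?V id\<bar>"
      using elim(1) by linarith
    then have "\<bar>?V id\<bar> * (1 / 2) \<le> \<bar>?V id\<bar> * (?R * \<bar>\<beta> n\<bar>)"
      by (simp only: mult.commute)
    then show ?case using V elim(2) by (subst (asm) mult_le_cancel_left_pos) simp_all
  qed
  have "(\<lambda>n. survival N n k / \<beta> n) \<longlonglongrightarrow> ?V k" if k: "chamber N k" "\<forall>j<N. k j \<le> K" for k
  proof -
    obtain C' where C': "\<And>n. n > 0 \<Longrightarrow> \<bar>survival N n k - \<beta> n * ?V k\<bar> \<le> C' * (1 / (z n ^ (2 * ?a + 1) * z n))"
      using \<beta>[OF k] by blast
    have "(\<lambda>n. survival N n k / \<beta> n - ?V k) \<longlonglongrightarrow> 0"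
    proof (rule Lim_null_comparison)
      show "eventually (\<lambda>n. norm (survival N n k / \<beta> n - ?V k) \<le> 2 * \<bar>C'\<bar> / z n) sequentially"
        using ev
      proof eventually_elim
        case (elim n)
        let ?R = "z n ^ (2 * ?a + 1)"
        have R: "?R > 0" using z_pos elim by simp
        have zn: "z n > 0" using z_pos elim by simp
        have b: "\<beta> n \<noteq> 0" using elim by auto
        have "survival N n k / \<beta> n - ?V k = (survival N n k - \<beta> n * ?V k) / \<beta> n"
          using b by (simp add: field_simps)
        then have "norm (survival N n k / \<beta> n - ?V k) = \<bar>survival N n k - \<beta> n * ?V k\<bar> / \<bar>\<beta> n\<bar>"
          by simp
        also have "\<dots> \<le> C' * (1 / (?R * z n)) / \<bar>\<beta> n\<bar>"
          using C' elim by (intro divide_right_mono) auto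
        also have "\<dots> \<le> \<bar>C'\<bar> * (1 / (?R * z n)) / \<bar>\<beta> n\<bar>"
          using R zn by (intro divide_right_mono mult_right_mono) auto
        also have "\<dots> = \<bar>C'\<bar> / z n * (1 / (?R * \<bar>\<beta> n\<bar>))"
          by (simp add: field_simps)
        also have "\<dots> \<le> \<bar>C'\<bar> / z n * 2"
        proof (rule mult_left_mono)
          have "0 < ?R * \<bar>\<beta> n\<bar>" using R b by simp
          then show "1 / (?R * \<bar>\<beta> n\<bar>) \<le> 2" using elim by (simp add: divide_le_eq)
        qed (use zn in auto)
        finally show ?case by (simp add: mult.commute)
      qed
      show "(\<lambda>n. 2 * \<bar>C'\<bar> / z n) \<longlonglongrightarrow> 0"
        using z_lim by (intro real_tendsto_divide_at_top[OF tendsto_const])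
    qed
    then show ?thesis using Lim_null by blast
  qed
  moreover have "eventually (\<lambda>n. \<beta> n \<noteq> 0) sequentially"
    using ev by eventually_elim auto
  ultimately show ?thesis by blast
qed

section \<open>Passage to the limit in the conditioned mean\<close>

lemma alive_take_drop:
  assumes "length l = Suc (t + n)"
  shows "alive N l \<longleftrightarrow> alive N (take (Suc t) l) \<and> alive N (drop t l)"
proof -
  have "t < length l" using assms by simp
  then have "set (take (Suc t) l) = insert (l ! t) (set (take t l))" "set (drop t l) = insert (l ! t) (set (drop (Suc t) l))"
    by (simp_all add: take_Suc_conv_app_nth Cons_nth_drop_Suc[symmetric])
  moreover have "set l = set (take (Suc t) l) \<union> set (drop (Suc t) l)"
    by (metis append_take_drop_id set_append)
  ultimately have "set l = set (take (Suc t) l) \<union> set (drop t l)" by auto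
  then show ?thesis by (auto simp: alive_def)
qed

lemma chamber_inj_on:
  assumes "chamber N k" shows "inj_on k {..<N}"
proof (rule inj_onI, rule ccontr)
  fix i j assume "i \<in> {..<N}" "j \<in> {..<N}" "k i = k j" "i \<noteq> j"
  with assms show False
    unfolding chamber_def by (cases i j rule: linorder_cases) fastforce+
qed

text \<open>By the Markov property the numerator averages the probability of surviving n more steps
  from the position at time t. Dividing by \<open>\<beta> n\<close> lets each of the finitely many
  terms converge; the denominator is the case g = 1, where the limit is h(k) since h is a
  martingale.\<close>

lemma conditioned_walk_limit:
  assumes "chamber N k"
  shows "(\<lambda>n. walk_mean N (t + n) (\<lambda>l. of_bool (alive N l) * g (take (Suc t) l)) k / survival N (t + n) k)
    \<longlonglongrightarrow> walk_mean N t (\<lambda>l. of_bool (alive N l) * (g l * vandermonde_nat N (last l))) k / vandermonde_nat N k"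
proof -
  let ?V = "vandermonde_nat N"
  \<comment> \<open>At least N, as the asymptotics demand, and beyond every coordinate that can be
    reached within t steps.\<close>
  define K where "K = Max (insert N (k ` {..<N})) + t"
  have K: "N \<le> K" by (simp add: K_def trans_le_add1)
  have kK: "k j + t \<le> K" if "j < N" for j using that by (simp add: K_def)
  obtain \<beta> where \<beta>0: "eventually (\<lambda>n. \<beta> n \<noteq> 0) sequentially"
    and \<beta>: "\<And>k. chamber N k \<Longrightarrow> (\<forall>j<N. k j \<le> K) \<Longrightarrow> (\<lambda>n. survival N n k / \<beta> n) \<longlonglongrightarrow> ?V k"
    using survival_asymptotics[OF K] by blast
  have lim: "(\<lambda>n. walk_mean N (t + n) (\<lambda>l. of_bool (alive N l) * g (take (Suc t) l)) k / \<beta> n)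
      \<longlonglongrightarrow> walk_mean N t (\<lambda>l. of_bool (alive N l) * (g l * ?V (last l))) k" for g
  proof -
    \<comment> \<open>Convergence under the mean is required for every list, also for those no path
      produces; this factor removes lists that are empty or exceed K, without changing the
      mean.\<close>
    let ?b = "\<lambda>l. l \<noteq> [] \<and> (\<forall>j<N. last l j \<le> K)"
    have b: "walk_mean N t (\<lambda>l. of_bool (?b l) * f l) k = walk_mean N t f k" for f
    proof (rule walk_mean_cong_bounded)
      fix l :: "(nat \<Rightarrow> nat) list" assume l: "length l = Suc t" "\<And>j. last l j \<le> k j + t"
      have "?b l" using l kK by (auto intro: order.trans)
      then show "of_bool (?b l) * f l = f l" by simp
    qed
    have eq: "walk_mean N (t + n) (\<lambda>l. of_bool (alive N l) * g (take (Suc t) l)) k =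
        walk_mean N t (\<lambda>l. (of_bool (alive N l) * g l) * survival N n (last l)) k" for n
    proof -
      have "walk_mean N (t + n) (\<lambda>l. of_bool (alive N l) * g (take (Suc t) l)) k =
          walk_mean N (t + n) (\<lambda>l. (of_bool (alive N (take (Suc t) l)) * g (take (Suc t) l)) * of_bool (alive N (drop t l))) k"
        by (rule walk_mean_cong) (simp add: alive_take_drop)
      also have "\<dots> = walk_mean N t (\<lambda>l. (of_bool (alive N l) * g l) * survival N n (last l)) k"
        unfolding survival_def by (rule walk_mean_markov)
      finally show ?thesis .
    qed
    have "(\<lambda>n. walk_mean N t (\<lambda>l. of_bool (?b l) * (of_bool (alive N l) * g l * (survival N n (last l) / \<beta> n))) k)
        \<longlonglongrightarrow> walk_mean N t (\<lambda>l. of_bool (?b l) * (of_bool (alive N l) * (g l * ?V (last l)))) k"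
    proof (rule walk_mean_tendsto)
      fix l
      show "(\<lambda>n. of_bool (?b l) * (of_bool (alive N l) * g l * (survival N n (last l) / \<beta> n)))
          \<longlonglongrightarrow> of_bool (?b l) * (of_bool (alive N l) * (g l * ?V (last l)))"
      proof (cases "?b l \<and> alive N l")
        case True
        then have "chamber N (last l)" by (auto simp: alive_def)
        with True have "(\<lambda>n. g l * (survival N n (last l) / \<beta> n)) \<longlonglongrightarrow> g l * ?V (last l)"
          by (intro tendsto_mult tendsto_const \<beta>) auto
        with True show ?thesis by simp
      qed auto
    qed
    moreover have "walk_mean N t (\<lambda>l. of_bool (?b l) * (of_bool (alive N l) * g l * (survival N n (last l) / \<beta> n))) k =
        walk_mean N (t + n) (\<lambda>l. of_bool (alive N l) * g (take (Suc t) l)) k / \<beta> n" for n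
      unfolding b eq
      using walk_mean_cmult[of N t "1 / \<beta> n" "\<lambda>l. of_bool (alive N l) * g l * survival N n (last l)" k]
      by (simp add: mult_ac)
    ultimately show ?thesis unfolding b by simp
  qed
  have "future_antisymmetric N (\<lambda>l. ?V (last l))"
    using future_antisymmetric_vandermonde[of N "\<lambda>_. 1"] by simp
  then have V: "walk_mean N t (\<lambda>l. of_bool (alive N l) * ?V (last l)) k = ?V k"
    using assms by (subst walk_mean_alive) (auto simp: vandermonde_martingale chamber_def less_imp_le)
  have "?V k \<noteq> 0"
    using assms by (intro vandermonde_det_nonzero) (auto simp: inj_on_def dest: inj_onD[OF chamber_inj_on])
  moreover have "(\<lambda>n. survival N (t + n) k / \<beta> n) \<longlonglongrightarrow> ?V k"
    using lim[of "\<lambda>_. 1"] by (simp add: V survival_def)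
  ultimately have "(\<lambda>n. (walk_mean N (t + n) (\<lambda>l. of_bool (alive N l) * g (take (Suc t) l)) k / \<beta> n) /
      (survival N (t + n) k / \<beta> n))
    \<longlonglongrightarrow> walk_mean N t (\<lambda>l. of_bool (alive N l) * (g l * ?V (last l))) k / ?V k"
    by (intro tendsto_divide lim)
  then show ?thesis
  proof (rule Lim_transform_eventually)
    show "eventually (\<lambda>n. (walk_mean N (t + n) (\<lambda>l. of_bool (alive N l) * g (take (Suc t) l)) k / \<beta> n) /
      (survival N (t + n) k / \<beta> n) =
      walk_mean N (t + n) (\<lambda>l. of_bool (alive N l) * g (take (Suc t) l)) k / survival N (t + n) k) sequentially"
      using \<beta>0 by eventually_elim simp
  qed
qed

text \<open>As g reads only times up to t, the martingale property replaces h at time T by h at time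
  t; only then is survival dropped.\<close>

lemma doob_transform_limit:
  assumes k: "chamber N k" and tT: "t \<le> T"
    and g: "\<And>a l i j. i < N \<Longrightarrow> j < N \<Longrightarrow> i \<noteq> j \<Longrightarrow> l \<noteq> [] \<Longrightarrow>
     g (a @ map (\<lambda>k. k \<circ> Transposition.transpose i j) l) = g (a @ l)"
  shows "(\<lambda>n. walk_mean N n (\<lambda>l. of_bool (alive N l) * g (take (Suc t) l)) k / survival N n k)
    \<longlonglongrightarrow> walk_mean N T (\<lambda>l. g (take (Suc t) l) * vandermonde_nat N (last l)) k / vandermonde_nat N k"
proof -
  let ?V = "vandermonde_nat N"
  have "walk_mean N T (\<lambda>l. g (take (Suc t) l) * ?V (last l)) k =
      walk_mean N (t + (T - t)) (\<lambda>l. g (take (Suc t) l) * ?V (last (drop t l))) k"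
    using tT by (simp, intro walk_mean_cong) auto
  also have "\<dots> = walk_mean N t (\<lambda>l. g l * ?V (last l)) k"
    using walk_mean_markov[of N t "T - t" g "\<lambda>l. ?V (last l)" k] by (simp add: vandermonde_martingale)
  also have "\<dots> = walk_mean N t (\<lambda>l. of_bool (alive N l) * (g l * ?V (last l))) k"
    using k by (intro walk_mean_alive[symmetric] future_antisymmetric_vandermonde g)
      (auto simp: chamber_def less_imp_le)
  finally have eq: "walk_mean N T (\<lambda>l. g (take (Suc t) l) * ?V (last l)) k =
      walk_mean N t (\<lambda>l. of_bool (alive N l) * (g l * ?V (last l))) k" .
  show ?thesis
    unfolding eq
    using LIMSEQ_offset[of "\<lambda>n. walk_mean N n (\<lambda>l. of_bool (alive N l) * g (take (Suc t) l)) k / survival N n k" t]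
      conditioned_walk_limit[OF k, of t g]
    by (simp add: add.commute)
qed

subsection \<open>Independence\<close>

text \<open>The sigma-algebra of \<open>sigma_gen\<close> as a measurable space, so that measurability rules apply to it.\<close>

definition gen_space :: "'a measure \<Rightarrow> 'i set \<Rightarrow> ('i \<Rightarrow> 'a \<Rightarrow> real) \<Rightarrow> 'a measure" where
  "gen_space M I X = sigma (space M) {X i -` A \<inter> space M | i A. i \<in> I \<and> A \<in> sets borel}"

lemma space_gen_space [simp]: "space (gen_space M I X) = space M"
  unfolding gen_space_def by (rule space_measure_of) auto

lemma sets_gen_space [simp]: "sets (gen_space M I X) = sigma_gen M I X"
  unfolding gen_space_def sigma_gen_def by (rule sets_measure_of) auto

lemma measurable_gen_space: "i \<in> I \<Longrightarrow> X i \<in> borel_measurable (gen_space M I X)"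
  by (rule measurableI) (auto simp: sigma_gen_def intro!: sigma_sets.Basic)

context prob_space begin

lemma indep_set_imp_indep_var:
  assumes ind: "indep_set \<A> \<B>"
    and X: "X \<in> measurable N S" "space N = space M" "sets N \<subseteq> \<A>"
    and Y: "Y \<in> measurable N' T" "space N' = space M" "sets N' \<subseteq> \<B>"
  shows "indep_var S X T Y"
proof -
  have ev: "\<A> \<subseteq> events" "\<B> \<subseteq> events"
    using ind unfolding indep_set_def indep_sets_def by (auto simp: UNIV_bool)
  have rv: "random_variable S X" "random_variable T Y"
    using ev X Y by (auto simp: measurable_def)
  have sub: "{X -` A \<inter> space M | A. A \<in> sets S} \<subseteq> \<A>" "{Y -` A \<inter> space M | A. A \<in> sets T} \<subseteq> \<B>"
    using measurable_sets[OF X(1)] measurable_sets[OF Y(1)] X Y by auto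
  show ?thesis
    unfolding indep_var_def indep_vars_def2
  proof (intro conjI)
    show "indep_sets (\<lambda>i. {case_bool X Y i -` A \<inter> space M |A. A \<in> sets (case_bool S T i)}) UNIV"
      using ind unfolding indep_set_def
      by (rule indep_sets_mono_sets) (use sub in \<open>auto split: bool.split\<close>)
  qed (use rv in \<open>auto split: bool.split\<close>)
qed

lemma indep_var_nn_integral:
  fixes X Y :: "'a \<Rightarrow> ennreal"
  assumes "indep_var borel X borel Y"
  shows "(\<integral>\<^sup>+\<omega>. X \<omega> * Y \<omega> \<partial>M) = (\<integral>\<^sup>+\<omega>. X \<omega> \<partial>M) * (\<integral>\<^sup>+\<omega>. Y \<omega> \<partial>M)"
proof -
  have "indep_vars (\<lambda>_. borel) (case_bool X Y) UNIV"
    using assms unfolding indep_var_def by (rule indep_vars_cong[THEN iffD1, rotated -1]) (auto split: bool.split)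
  from indep_vars_nn_integral[OF _ this] show ?thesis
    by (simp add: UNIV_bool mult.commute)
qed

end

subsection \<open>Moments of the clock\<close>

text \<open>Gamma integral. The positive part mirrors \<open>ennreal\<close> in the clock, which
  sends negative summands to 0.\<close>

lemma nn_integral_gamma_power:
  assumes "iid_gamma Q t \<eta>" "1 \<le> t" "1 \<le> l" and Q: "prob_space Q"
  shows "(\<integral>\<^sup>+\<omega>. ennreal (max 0 (\<eta> l \<omega>) ^ p) \<partial>Q) = ennreal (fact (t - 1 + p) / fact (t - 1))"
proof -
  let ?f = "\<lambda>x::real. if x > 0 then x ^ (t - 1) * exp (- x) / Gamma (real t) else 0"
  have G: "Gamma (real t) = fact (t - 1)"
    using Gamma_fact[of "t - 1"] assms(2) by (simp add: of_nat_diff)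
  have D: "distributed Q lborel (\<eta> l) ?f"
    using assms unfolding iid_gamma_def by auto
  have "(\<integral>\<^sup>+\<omega>. ennreal (max 0 (\<eta> l \<omega>) ^ p) \<partial>Q) = (\<integral>\<^sup>+x. ennreal (?f x) * ennreal (max 0 x ^ p) \<partial>lborel)"
    by (rule distributed_nn_integral[OF D, symmetric]) auto
  also have "\<dots> = (\<integral>\<^sup>+x. ennreal (1 / fact (t - 1)) * (ennreal (x ^ (t - 1 + p) * exp (- x)) * indicator {0 ..} x) \<partial>lborel)"
  proof (rule nn_integral_cong_AE)
    show "AE x in lborel. ennreal (?f x) * ennreal (max 0 x ^ p) =
        ennreal (1 / fact (t - 1)) * (ennreal (x ^ (t - 1 + p) * exp (- x)) * indicator {0 ..} x)"
      \<comment> \<open>At x = 0 the integrands differ if t = 1 and p = 0.\<close>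
      using AE_lborel_singleton[of 0]
    proof eventually_elim
      case (elim x)
      then show ?case
        by (cases "x > 0") (auto simp: G power_add max_def field_simps simp flip: ennreal_mult split: split_indicator)
    qed
  qed
  also have "\<dots> = ennreal (1 / fact (t - 1)) * ennreal (fact (t - 1 + p))"
    by (subst nn_integral_cmult) (auto simp: nn_intergal_power_times_exp_Ici)
  finally show ?thesis
    by (simp flip: ennreal_mult)
qed

text \<open>Jensen's inequality for x^p with the weights a l divided by their sum.\<close>

lemma weighted_power_mean:
  fixes a x :: "nat \<Rightarrow> real"
  assumes "\<And>l. 0 < a l" "\<And>l. 0 \<le> x l" "1 \<le> p"
  shows "(\<Sum>l<n. a l * x l) ^ p \<le> (\<Sum>l<n. a l) ^ (p - 1) * (\<Sum>l<n. a l * x l ^ p)"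
proof (cases "n = 0")
  case False
  define A where "A = (\<Sum>l<n. a l)"
  have A: "A > 0" using False assms(1) by (auto simp: A_def intro!: sum_pos)
  have "convex_on {0::real..} (\<lambda>x. x ^ p)"
  proof (cases "even p")
    case True
    then show ?thesis using convex_power_even convex_on_subset by blast
  qed (rule convex_power_odd)
  then have "(\<Sum>l<n. (a l / A) *\<^sub>R x l) ^ p \<le> (\<Sum>l<n. (a l / A) * x l ^ p)"
    using assms False A
    by (intro convex_on_sum[where C = "{0..}" and f = "\<lambda>x. x ^ p"])
      (auto simp: less_imp_le sum_divide_distrib[symmetric] A_def[symmetric])
  moreover have "(\<Sum>l<n. (a l / A) *\<^sub>R x l) = (\<Sum>l<n. a l * x l) / A"
    by (simp add: sum_divide_distrib)
  moreover have "(\<Sum>l<n. (a l / A) * x l ^ p) = (\<Sum>l<n. a l * x l ^ p) / A"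
    by (simp add: sum_divide_distrib)
  ultimately have le: "((\<Sum>l<n. a l * x l) / A) ^ p \<le> (\<Sum>l<n. a l * x l ^ p) / A"
    by simp
  have "(\<Sum>l<n. a l * x l) ^ p = A ^ p * ((\<Sum>l<n. a l * x l) / A) ^ p"
    using A by (simp add: power_divide)
  also have "\<dots> \<le> A ^ p * ((\<Sum>l<n. a l * x l ^ p) / A)"
    using A by (intro mult_left_mono le) auto
  also have "\<dots> = A ^ p / A * (\<Sum>l<n. a l * x l ^ p)"
    by simp
  also have "A ^ p / A = A ^ (p - 1)"
    using A assms(3) by (simp add: power_diff)
  finally show ?thesis by (simp only: A_def)
qed (use assms in \<open>simp add: zero_power\<close>)

definition clock_term :: "(nat \<Rightarrow> nat \<Rightarrow> 'q \<Rightarrow> real) \<Rightarrow> nat \<Rightarrow> 'q \<Rightarrow> nat \<Rightarrow> real" where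
  "clock_term \<eta> t \<omega> l = 1 / (real (Suc l) - 1 / 2)\<^sup>2 * max 0 (\<eta> (Suc l) t \<omega>)"

lemma clock_term_nonneg: "0 \<le> clock_term \<eta> t \<omega> l"
  by (simp add: clock_term_def)

text \<open>A divergent series has the value infinity, which \<open>enn2real\<close> turns into
  0.\<close>

lemma random_clock_eq:
  "random_clock \<eta> t \<omega> =
     (if summable (clock_term \<eta> t \<omega>) then 2 / pi\<^sup>2 * suminf (clock_term \<eta> t \<omega>) else 0)"
proof -
  have "ennreal (\<eta> (Suc l) t \<omega> / (real (Suc l) - 1 / 2)\<^sup>2) = ennreal (clock_term \<eta> t \<omega> l)" for l
    by (cases "\<eta> (Suc l) t \<omega> \<ge> 0")
      (auto simp: clock_term_def max_def ennreal_neg divide_nonpos_nonneg)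
  then have eq: "random_clock \<eta> t \<omega> = 2 / pi\<^sup>2 * enn2real (\<Sum>l. ennreal (clock_term \<eta> t \<omega> l))"
    by (simp add: random_clock_def)
  show ?thesis
  proof (cases "summable (clock_term \<eta> t \<omega>)")
    case True
    then show ?thesis
      unfolding eq by (simp add: suminf_ennreal2 clock_term_nonneg suminf_nonneg)
  next
    case False
    then have "(\<Sum>l. ennreal (clock_term \<eta> t \<omega> l)) = \<infinity>"
      using summable_suminf_not_top[of "clock_term \<eta> t \<omega>", OF clock_term_nonneg]
      by (auto simp: infinity_ennreal_def)
    then show ?thesis unfolding eq using False by simp
  qed
qed

lemma random_clock_nonneg: "0 \<le> random_clock \<eta> t \<omega>"
  by (simp add: random_clock_def)

lemma random_clock_measurable:
  assumes "\<And>l. 1 \<le> l \<Longrightarrow> (\<lambda>\<omega>. \<eta> l t \<omega>) \<in> borel_measurable N"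
  shows "random_clock \<eta> t \<in> borel_measurable N"
proof -
  have [measurable]: "(\<lambda>\<omega>. \<eta> (Suc l) t \<omega>) \<in> borel_measurable N" for l
    by (rule assms) simp
  show ?thesis unfolding random_clock_def[abs_def] by measurable
qed

text \<open>The weights 1 / (l - 1/2)^2 are summable, so Jensen bounds the p-th moments of the
  partial sums uniformly, and Fatou's lemma reaches the series. Where it diverges the clock is 0 and
  the bound is trivial.\<close>

lemma clock_moment:
  assumes iid: "iid_gamma Q t (\<lambda>l. \<eta> l t)" and t: "1 \<le> t" and Q: "prob_space Q" and p: "1 \<le> p"
  shows "(\<integral>\<^sup>+\<omega>. ennreal (random_clock \<eta> t \<omega> ^ p) \<partial>Q) < \<infinity>"
proof -
  interpret prob_space Q by (rule Q)
  have [measurable]: "\<eta> (Suc l) t \<in> borel_measurable Q" for l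
    using iid unfolding iid_gamma_def indep_vars_def by auto
  define a :: "nat \<Rightarrow> real" where "a l = 1 / (real (Suc l) - 1 / 2)\<^sup>2" for l
  have a_pos: "a l > 0" for l
  proof -
    have "real (Suc l) - 1 / 2 > 0" by simp
    then show ?thesis unfolding a_def by (intro divide_pos_pos zero_less_power) auto
  qed
  \<comment> \<open>From l + 1 - 1/2 \<ge> (l + 1) / 2.\<close>
  have "a l \<le> 4 * (1 / real (Suc l) ^ 2)" for l
  proof -
    have "(real (Suc l) / 2)\<^sup>2 \<le> (real (Suc l) - 1 / 2)\<^sup>2"
      by (rule power_mono) simp_all
    moreover have "0 < (real (Suc l) / 2)\<^sup>2" by simp
    ultimately have "1 / (real (Suc l) - 1 / 2)\<^sup>2 \<le> 1 / (real (Suc l) / 2)\<^sup>2"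
      by (intro frac_le) simp_all
    then show ?thesis by (simp add: a_def power_divide)
  qed
  moreover have "summable (\<lambda>l. 4 * (1 / real (Suc l) ^ 2))"
    using sums_summable[OF inverse_squares_sums] by (intro summable_mult) simp
  ultimately have sum_a: "summable a"
    by (intro summable_comparison_test'[of "\<lambda>l. 4 * (1 / real (Suc l) ^ 2)" 0 a])
      (simp_all add: a_pos less_imp_le)
  define A where "A = suminf a"
  have A: "(\<Sum>l<n. a l) \<le> A" for n
    unfolding A_def using a_pos sum_a by (intro sum_le_suminf) (auto simp: less_imp_le)
  have A0: "0 \<le> A" using A[of 0] by simp
  define m where "m = (fact (t - 1 + p) / fact (t - 1) :: real)"
  have m0: "0 \<le> m" by (simp add: m_def)
  define S where "S n \<omega> = (\<Sum>l<n. clock_term \<eta> t \<omega> l)" for n \<omega>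
  have S_meas [measurable]: "S n \<in> borel_measurable Q" for n
    unfolding S_def[abs_def] clock_term_def by measurable
  have S0: "0 \<le> S n \<omega>" for n \<omega> by (simp add: S_def sum_nonneg clock_term_nonneg)
  have bound: "(\<integral>\<^sup>+\<omega>. ennreal ((2 / pi\<^sup>2 * S n \<omega>) ^ p) \<partial>Q) \<le> ennreal ((2 / pi\<^sup>2) ^ p * (A ^ (p - 1) * (A * m)))" for n
  proof -
    have "(\<integral>\<^sup>+\<omega>. ennreal ((2 / pi\<^sup>2 * S n \<omega>) ^ p) \<partial>Q) \<le>
        (\<integral>\<^sup>+\<omega>. (\<Sum>l<n. ennreal ((2 / pi\<^sup>2) ^ p * A ^ (p - 1) * a l) * ennreal (max 0 (\<eta> (Suc l) t \<omega>) ^ p)) \<partial>Q)"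
    proof (rule nn_integral_mono)
      fix \<omega>
      have "S n \<omega> ^ p = (\<Sum>l<n. a l * max 0 (\<eta> (Suc l) t \<omega>)) ^ p"
        by (simp add: S_def clock_term_def a_def)
      also have "\<dots> \<le> (\<Sum>l<n. a l) ^ (p - 1) * (\<Sum>l<n. a l * max 0 (\<eta> (Suc l) t \<omega>) ^ p)"
        by (rule weighted_power_mean) (use a_pos p in auto)
      also have "\<dots> \<le> A ^ (p - 1) * (\<Sum>l<n. a l * max 0 (\<eta> (Suc l) t \<omega>) ^ p)"
        using a_pos by (intro mult_right_mono power_mono A sum_nonneg) (auto simp: less_imp_le)
      finally have "(2 / pi\<^sup>2 * S n \<omega>) ^ p \<le> (2 / pi\<^sup>2) ^ p * (A ^ (p - 1) * (\<Sum>l<n. a l * max 0 (\<eta> (Suc l) t \<omega>) ^ p))"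
        unfolding power_mult_distrib by (intro mult_left_mono) auto
      also have "\<dots> = (\<Sum>l<n. ((2 / pi\<^sup>2) ^ p * A ^ (p - 1) * a l) * max 0 (\<eta> (Suc l) t \<omega>) ^ p)"
        by (simp add: sum_distrib_left mult_ac)
      finally have "ennreal ((2 / pi\<^sup>2 * S n \<omega>) ^ p) \<le>
          ennreal (\<Sum>l<n. ((2 / pi\<^sup>2) ^ p * A ^ (p - 1) * a l) * max 0 (\<eta> (Suc l) t \<omega>) ^ p)"
        by (rule ennreal_leI)
      also have "\<dots> = (\<Sum>l<n. ennreal ((2 / pi\<^sup>2) ^ p * A ^ (p - 1) * a l) * ennreal (max 0 (\<eta> (Suc l) t \<omega>) ^ p))"
      proof -
        have "ennreal (((2 / pi\<^sup>2) ^ p * A ^ (p - 1) * a l) * max 0 (\<eta> (Suc l) t \<omega>) ^ p) =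
            ennreal ((2 / pi\<^sup>2) ^ p * A ^ (p - 1) * a l) * ennreal (max 0 (\<eta> (Suc l) t \<omega>) ^ p)" for l
          by (rule ennreal_mult'') simp
        moreover have "(\<Sum>l<n. ennreal (((2 / pi\<^sup>2) ^ p * A ^ (p - 1) * a l) * max 0 (\<eta> (Suc l) t \<omega>) ^ p)) =
            ennreal (\<Sum>l<n. ((2 / pi\<^sup>2) ^ p * A ^ (p - 1) * a l) * max 0 (\<eta> (Suc l) t \<omega>) ^ p)"
          using a_pos A0 by (intro sum_ennreal mult_nonneg_nonneg) (simp_all add: less_imp_le)
        ultimately show ?thesis by simp
      qed
      finally show "ennreal ((2 / pi\<^sup>2 * S n \<omega>) ^ p) \<le>
        (\<Sum>l<n. ennreal ((2 / pi\<^sup>2) ^ p * A ^ (p - 1) * a l) * ennreal (max 0 (\<eta> (Suc l) t \<omega>) ^ p))" .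
    qed
    also have "\<dots> = (\<Sum>l<n. ennreal ((2 / pi\<^sup>2) ^ p * A ^ (p - 1) * a l) * ennreal m)"
    proof -
      have "(\<integral>\<^sup>+\<omega>. ennreal (max 0 (\<eta> (Suc l) t \<omega>) ^ p) \<partial>Q) = ennreal m" for l
        unfolding m_def by (rule nn_integral_gamma_power[OF iid t _ Q]) simp
      then show ?thesis
        by (subst nn_integral_sum) (simp_all add: nn_integral_cmult)
    qed
    also have "\<dots> = (\<Sum>l<n. ennreal (((2 / pi\<^sup>2) ^ p * A ^ (p - 1) * a l) * m))"
      by (simp only: ennreal_mult''[OF m0])
    also have "\<dots> = ennreal (\<Sum>l<n. ((2 / pi\<^sup>2) ^ p * A ^ (p - 1) * a l) * m)"
      using a_pos A0 m0 by (intro sum_ennreal mult_nonneg_nonneg) (simp_all add: less_imp_le)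
    also have "(\<Sum>l<n. ((2 / pi\<^sup>2) ^ p * A ^ (p - 1) * a l) * m) = (2 / pi\<^sup>2) ^ p * (A ^ (p - 1) * ((\<Sum>l<n. a l) * m))"
      by (simp add: sum_distrib_left sum_distrib_right mult_ac)
    also have "ennreal \<dots> \<le> ennreal ((2 / pi\<^sup>2) ^ p * (A ^ (p - 1) * (A * m)))"
      using A A0 m0 by (intro ennreal_leI mult_left_mono mult_right_mono) auto
    finally show ?thesis .
  qed
  have "(\<integral>\<^sup>+\<omega>. ennreal (random_clock \<eta> t \<omega> ^ p) \<partial>Q) \<le>
      (\<integral>\<^sup>+\<omega>. liminf (\<lambda>n. ennreal ((2 / pi\<^sup>2 * S n \<omega>) ^ p)) \<partial>Q)"
  proof (rule nn_integral_mono)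
    fix \<omega>
    show "ennreal (random_clock \<eta> t \<omega> ^ p) \<le> liminf (\<lambda>n. ennreal ((2 / pi\<^sup>2 * S n \<omega>) ^ p))"
    proof (cases "summable (clock_term \<eta> t \<omega>)")
      case True
      then have "(\<lambda>n. S n \<omega>) \<longlonglongrightarrow> suminf (clock_term \<eta> t \<omega>)"
        unfolding S_def by (rule summable_LIMSEQ)
      then have "(\<lambda>n. ennreal ((2 / pi\<^sup>2 * S n \<omega>) ^ p)) \<longlonglongrightarrow> ennreal (random_clock \<eta> t \<omega> ^ p)"
        unfolding random_clock_eq using True by (auto intro!: tendsto_intros)
      then show ?thesis by (simp add: lim_imp_Liminf)
    qed (use p in \<open>simp add: random_clock_eq zero_power\<close>)
  qed
  also have "\<dots> \<le> liminf (\<lambda>n. \<integral>\<^sup>+\<omega>. ennreal ((2 / pi\<^sup>2 * S n \<omega>) ^ p) \<partial>Q)"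
    by (rule nn_integral_liminf) measurable
  also have "\<dots> \<le> ennreal ((2 / pi\<^sup>2) ^ p * (A ^ (p - 1) * (A * m)))"
  proof (rule Liminf_le)
    show "eventually (\<lambda>n. (\<integral>\<^sup>+\<omega>. ennreal ((2 / pi\<^sup>2 * S n \<omega>) ^ p) \<partial>Q) \<le> ennreal ((2 / pi\<^sup>2) ^ p * (A ^ (p - 1) * (A * m)))) sequentially"
      by (intro always_eventually allI bound)
  qed auto
  finally show ?thesis by (simp add: le_less_trans)
qed

subsection \<open>Moments of the time-changed Brownian motion\<close>

text \<open>The even moments of a normal law of variance s. Time 0 is separate because the law there
  is degenerate and has no density.\<close>

lemma brownian_moment:
  assumes B: "brownian_motion Q B" and s: "0 \<le> s" and p: "1 \<le> p"
  shows "(\<integral>\<^sup>+\<omega>. ennreal (B s \<omega> ^ (2 * p)) \<partial>Q) = ennreal (fact (2 * p) / (2 ^ p * fact p) * s ^ p)"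
proof (cases "s = 0")
  case True
  have "(\<integral>\<^sup>+\<omega>. ennreal (B s \<omega> ^ (2 * p)) \<partial>Q) = (\<integral>\<^sup>+\<omega>. 0 \<partial>Q)"
    using B True p by (intro nn_integral_cong) (auto simp: brownian_motion_def zero_power)
  with True p show ?thesis by (simp add: zero_power)
next
  case False
  let ?f = "\<lambda>x. normal_density 0 (sqrt s) x * (x - 0) ^ (2 * p)"
  have s: "s > 0" using s False by simp
  have D: "distributed Q lborel (\<lambda>\<omega>. B s \<omega> - B 0 \<omega>) (normal_density 0 (sqrt (s - 0)))"
    using B s unfolding brownian_motion_def by blast
  have nn: "0 \<le> ?f x" for x by (simp add: zero_le_even_power)
  have "(\<integral>\<^sup>+\<omega>. ennreal (B s \<omega> ^ (2 * p)) \<partial>Q) = (\<integral>\<^sup>+\<omega>. ennreal ((B s \<omega> - B 0 \<omega>) ^ (2 * p)) \<partial>Q)"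
    using B by (intro nn_integral_cong) (auto simp: brownian_motion_def)
  also have "\<dots> = (\<integral>\<^sup>+x. ennreal (normal_density 0 (sqrt s) x) * ennreal (x ^ (2 * p)) \<partial>lborel)"
    using D by (subst distributed_nn_integral[where N = lborel and f = "normal_density 0 (sqrt s)"]) auto
  also have "\<dots> = (\<integral>\<^sup>+x. ennreal (?f x) \<partial>lborel)"
    by (intro nn_integral_cong) (simp add: ennreal_mult' zero_le_even_power)
  also have "\<dots> = ennreal (fact (2 * p) / ((2 / (sqrt s)\<^sup>2) ^ p * fact p))"
    using normal_moment_even[of "sqrt s" 0 p] s nn
    by (subst nn_integral_eq_integral) (auto simp: has_bochner_integral_iff)
  also have "fact (2 * p) / ((2 / (sqrt s)\<^sup>2) ^ p * fact p) = fact (2 * p) / (2 ^ p * fact p) * s ^ p"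
    using s by (simp add: power_divide)
  finally show ?thesis .
qed

text \<open>Index of the last multiple of 1 / m before the clock. Rounding down makes powers of the
  clock dominate those of its approximation.\<close>

definition clock_grid :: "(nat \<Rightarrow> nat \<Rightarrow> 'q \<Rightarrow> real) \<Rightarrow> nat \<Rightarrow> nat \<Rightarrow> 'q \<Rightarrow> nat" where
  "clock_grid \<eta> t m \<omega> = nat \<lfloor>real m * random_clock \<eta> t \<omega>\<rfloor>"

context
  fixes Q :: "'q measure" and B :: "real \<Rightarrow> 'q \<Rightarrow> real" and \<eta> :: "nat \<Rightarrow> nat \<Rightarrow> 'q \<Rightarrow> real" and t :: nat
  assumes clk: "clock_setup Q B \<eta>" and t: "1 \<le> t"
begin

interpretation prob_space Q
  using clk by (simp add: clock_setup_def brownian_motion_def)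

lemma eta_measurable: "1 \<le> l \<Longrightarrow> (\<lambda>\<omega>. \<eta> l t \<omega>) \<in> borel_measurable (gen_space Q {1..} (\<lambda>l. \<eta> l t))"
  by (rule measurable_gen_space[of l "{1..}" "\<lambda>l. \<eta> l t" Q]) simp

lemma eta_rv: "1 \<le> l \<Longrightarrow> (\<lambda>\<omega>. \<eta> l t \<omega>) \<in> borel_measurable Q"
  using clk t unfolding clock_setup_def iid_gamma_def indep_vars_def by auto

lemma clock_grid_measurable:
  assumes "random_clock \<eta> t \<in> borel_measurable N"
  shows "clock_grid \<eta> t m \<in> measurable N (count_space UNIV)"
proof -
  note assms [measurable]
  show ?thesis unfolding clock_grid_def[abs_def] by measurable
qed

lemma B_rv: "0 \<le> s \<Longrightarrow> B s \<in> borel_measurable Q"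
  using clk by (simp add: clock_setup_def brownian_motion_def)

text \<open>Continuity of the paths. This limit gives the time-changed motion its measurability as
  well as its moments.\<close>

lemma clock_grid_tendsto:
  assumes "\<omega> \<in> space Q"
  shows "(\<lambda>m. B (real (clock_grid \<eta> t m \<omega>) / real m) \<omega>) \<longlonglongrightarrow> B (random_clock \<eta> t \<omega>) \<omega>"
proof -
  let ?C = "random_clock \<eta> t \<omega>"
  have C: "0 \<le> ?C" by (rule random_clock_nonneg)
  have eq: "real (clock_grid \<eta> t m \<omega>) = of_int \<lfloor>real m * ?C\<rfloor>" for m
    using C by (simp add: clock_grid_def)
  have lim: "(\<lambda>m. real (clock_grid \<eta> t m \<omega>) / real m) \<longlonglongrightarrow> ?C"
  proof (rule tendsto_sandwich)
    show "(\<lambda>m. ?C - 1 / real m) \<longlonglongrightarrow> ?C" "(\<lambda>m. ?C) \<longlonglongrightarrow> ?C"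
      using tendsto_diff[OF tendsto_const lim_1_over_n, of ?C] by auto
    show "eventually (\<lambda>m. ?C - 1 / real m \<le> real (clock_grid \<eta> t m \<omega>) / real m) sequentially"
      using eventually_gt_at_top[of 0]
    proof eventually_elim
      case (elim m)
      have "real m * ?C - 1 \<le> of_int \<lfloor>real m * ?C\<rfloor>" by linarith
      then have "(real m * ?C - 1) / real m \<le> of_int \<lfloor>real m * ?C\<rfloor> / real m"
        by (rule divide_right_mono) simp
      then show ?case using elim by (simp add: eq diff_divide_distrib)
    qed
    show "eventually (\<lambda>m. real (clock_grid \<eta> t m \<omega>) / real m \<le> ?C) sequentially"
      using eventually_gt_at_top[of 0]
    proof eventually_elim
      case (elim m)
      have "of_int \<lfloor>real m * ?C\<rfloor> \<le> real m * ?C" by linarith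
      then show ?case using elim by (simp add: eq field_simps)
    qed
  qed
  have "continuous_on {0..} (\<lambda>s. B s \<omega>)"
    using clk assms by (auto simp: clock_setup_def brownian_motion_def)
  from continuous_on_tendsto_compose[OF this lim] C show ?thesis by simp
qed

lemma time_changed_grid_rv: "(\<lambda>\<omega>. B (real (clock_grid \<eta> t m \<omega>) / real m) \<omega>) \<in> borel_measurable Q"
proof (rule measurable_compose_countable[where f = "\<lambda>k \<omega>. B (real k / real m) \<omega>" and g = "clock_grid \<eta> t m"])
  show "clock_grid \<eta> t m \<in> measurable Q (count_space UNIV)"
    by (intro clock_grid_measurable random_clock_measurable eta_rv)
qed (auto intro!: B_rv)

lemma time_changed_rv: "(\<lambda>\<omega>. B (random_clock \<eta> t \<omega>) \<omega>) \<in> borel_measurable Q"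
  by (rule borel_measurable_LIMSEQ_real[OF clock_grid_tendsto time_changed_grid_rv])

text \<open>Conditioning on the clock, restricted to a grid so that only countably many values occur.\<close>

lemma time_changed_grid_moment:
  assumes m: "0 < m" and p: "1 \<le> p"
  shows "(\<integral>\<^sup>+\<omega>. ennreal (B (real (clock_grid \<eta> t m \<omega>) / real m) \<omega> ^ (2 * p)) \<partial>Q) \<le>
    ennreal (fact (2 * p) / (2 ^ p * fact p)) * (\<integral>\<^sup>+\<omega>. ennreal (random_clock \<eta> t \<omega> ^ p) \<partial>Q)"
proof -
  let ?g = "fact (2 * p) / (2 ^ p * fact p) :: real"
  let ?s = "\<lambda>k. real k / real m"
  have [measurable]: "clock_grid \<eta> t m \<in> measurable Q (count_space UNIV)"
    by (intro clock_grid_measurable random_clock_measurable eta_rv)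
  have [measurable]: "random_clock \<eta> t \<in> borel_measurable Q"
    by (intro random_clock_measurable eta_rv)
  let ?I = "\<lambda>k \<omega>. indicator {k} (clock_grid \<eta> t m \<omega>) :: ennreal"
  \<comment> \<open>Stated for an arbitrary space N, since measurability is needed both for Q and
    for the generated sigma-algebras that are independent.\<close>
  have I_meas: "?I k \<in> borel_measurable N" if "clock_grid \<eta> t m \<in> measurable N (count_space UNIV)" for k N
    using measurable_compose[OF that, of "indicator {k}" borel] by simp
  have B_meas: "(\<lambda>\<omega>. ennreal (B (?s k) \<omega> ^ (2 * p))) \<in> borel_measurable N" if "B (?s k) \<in> borel_measurable N" for k N
    by (rule measurable_compose[OF that]) measurable
  have I_Q: "?I k \<in> borel_measurable Q" for k by (rule I_meas) measurable
  have B_Q: "(\<lambda>\<omega>. ennreal (B (?s k) \<omega> ^ (2 * p))) \<in> borel_measurable Q" for k by (intro B_meas B_rv) simp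
  have single: "(\<Sum>k. ?I k \<omega> * f k) = f (clock_grid \<eta> t m \<omega>)" for f :: "nat \<Rightarrow> ennreal" and \<omega>
    by (subst suminf_finite[of "{clock_grid \<eta> t m \<omega>}"]) (auto simp: indicator_def)
  have "(\<integral>\<^sup>+\<omega>. ennreal (B (?s (clock_grid \<eta> t m \<omega>)) \<omega> ^ (2 * p)) \<partial>Q) =
      (\<integral>\<^sup>+\<omega>. (\<Sum>k. ?I k \<omega> * ennreal (B (?s k) \<omega> ^ (2 * p))) \<partial>Q)"
    by (subst single) simp
  also have "\<dots> = (\<Sum>k. \<integral>\<^sup>+\<omega>. ?I k \<omega> * ennreal (B (?s k) \<omega> ^ (2 * p)) \<partial>Q)"
    by (intro nn_integral_suminf borel_measurable_times_ennreal I_Q B_Q)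
  also have "\<dots> = (\<Sum>k. (\<integral>\<^sup>+\<omega>. ?I k \<omega> \<partial>Q) * ennreal (?g * ?s k ^ p))"
  proof (rule suminf_cong)
    fix k
    have "indep_set (sigma_gen Q {1..} (\<lambda>l. \<eta> l t)) (sigma_gen Q {0..} B)"
    proof -
      have ind: "indep_set (sigma_gen Q {0..} B) (sigma_gen Q {1..} (\<lambda>l. \<eta> l t))"
        using clk t by (simp add: clock_setup_def)
      show ?thesis
      proof (rule indep_setI)
        show "sigma_gen Q {1..} (\<lambda>l. \<eta> l t) \<subseteq> events" "sigma_gen Q {0..} B \<subseteq> events"
          using ind unfolding indep_set_def indep_sets_def by (auto simp: UNIV_bool)
      qed (metis indep_setD[OF ind] Int_commute mult.commute)
    qed
    then have "indep_var borel (?I k) borel (\<lambda>\<omega>. ennreal (B (?s k) \<omega> ^ (2 * p)))"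
    proof (rule indep_set_imp_indep_var[where N = "gen_space Q {1..} (\<lambda>l. \<eta> l t)" and N' = "gen_space Q {0..} B"])
      show "?I k \<in> borel_measurable (gen_space Q {1..} (\<lambda>l. \<eta> l t))"
        by (intro I_meas clock_grid_measurable random_clock_measurable eta_measurable)
      show "(\<lambda>\<omega>. ennreal (B (?s k) \<omega> ^ (2 * p))) \<in> borel_measurable (gen_space Q {0..} B)"
        by (intro B_meas measurable_gen_space) simp
    qed simp_all
    from indep_var_nn_integral[OF this] show "(\<integral>\<^sup>+\<omega>. ?I k \<omega> * ennreal (B (?s k) \<omega> ^ (2 * p)) \<partial>Q) =
        (\<integral>\<^sup>+\<omega>. ?I k \<omega> \<partial>Q) * ennreal (?g * ?s k ^ p)"
      using clk p by (simp add: brownian_moment clock_setup_def)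
  qed
  also have "\<dots> = (\<Sum>k. \<integral>\<^sup>+\<omega>. ?I k \<omega> * ennreal (?g * ?s k ^ p) \<partial>Q)"
    by (intro suminf_cong nn_integral_multc[symmetric] I_Q)
  also have "\<dots> = (\<integral>\<^sup>+\<omega>. (\<Sum>k. ?I k \<omega> * ennreal (?g * ?s k ^ p)) \<partial>Q)"
    by (intro nn_integral_suminf[symmetric] borel_measurable_times_ennreal I_Q) simp
  also have "\<dots> = (\<integral>\<^sup>+\<omega>. ennreal (?g * ?s (clock_grid \<eta> t m \<omega>) ^ p) \<partial>Q)"
    by (subst single) simp
  also have "\<dots> \<le> (\<integral>\<^sup>+\<omega>. ennreal ?g * ennreal (random_clock \<eta> t \<omega> ^ p) \<partial>Q)"
  proof (rule nn_integral_mono)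
    fix \<omega>
    have "real (clock_grid \<eta> t m \<omega>) = of_int \<lfloor>real m * random_clock \<eta> t \<omega>\<rfloor>"
      using random_clock_nonneg[of \<eta> t \<omega>] by (simp add: clock_grid_def)
    also have "\<dots> \<le> real m * random_clock \<eta> t \<omega>" by linarith
    finally have "?s (clock_grid \<eta> t m \<omega>) \<le> random_clock \<eta> t \<omega>"
      using m by (simp add: field_simps)
    then have "?g * ?s (clock_grid \<eta> t m \<omega>) ^ p \<le> ?g * random_clock \<eta> t \<omega> ^ p"
      by (intro mult_left_mono power_mono) auto
    then show "ennreal (?g * ?s (clock_grid \<eta> t m \<omega>) ^ p) \<le> ennreal ?g * ennreal (random_clock \<eta> t \<omega> ^ p)"
      by (simp add: random_clock_nonneg ennreal_leI flip: ennreal_mult)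
  qed
  also have "\<dots> = ennreal ?g * (\<integral>\<^sup>+\<omega>. ennreal (random_clock \<eta> t \<omega> ^ p) \<partial>Q)"
    by (rule nn_integral_cmult) measurable
  finally show ?thesis .
qed

text \<open>Fatou's lemma along the grids; the bound for a grid does not involve m.\<close>

lemma time_changed_moment:
  assumes p: "1 \<le> p"
  shows "(\<integral>\<^sup>+\<omega>. ennreal (B (random_clock \<eta> t \<omega>) \<omega> ^ (2 * p)) \<partial>Q) < \<infinity>"
proof -
  let ?R = "ennreal (fact (2 * p) / (2 ^ p * fact p)) * (\<integral>\<^sup>+\<omega>. ennreal (random_clock \<eta> t \<omega> ^ p) \<partial>Q)"
  have "(\<integral>\<^sup>+\<omega>. ennreal (B (random_clock \<eta> t \<omega>) \<omega> ^ (2 * p)) \<partial>Q) =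
      (\<integral>\<^sup>+\<omega>. liminf (\<lambda>m. ennreal (B (real (clock_grid \<eta> t m \<omega>) / real m) \<omega> ^ (2 * p))) \<partial>Q)"
  proof (rule nn_integral_cong)
    fix \<omega> assume "\<omega> \<in> space Q"
    then have "(\<lambda>m. ennreal (B (real (clock_grid \<eta> t m \<omega>) / real m) \<omega> ^ (2 * p))) \<longlonglongrightarrow>
        ennreal (B (random_clock \<eta> t \<omega>) \<omega> ^ (2 * p))"
      by (intro tendsto_intros clock_grid_tendsto)
    then show "ennreal (B (random_clock \<eta> t \<omega>) \<omega> ^ (2 * p)) =
        liminf (\<lambda>m. ennreal (B (real (clock_grid \<eta> t m \<omega>) / real m) \<omega> ^ (2 * p)))"
      by (rule lim_imp_Liminf[OF sequentially_bot, symmetric])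
  qed
  also have "\<dots> \<le> liminf (\<lambda>m. \<integral>\<^sup>+\<omega>. ennreal (B (real (clock_grid \<eta> t m \<omega>) / real m) \<omega> ^ (2 * p)) \<partial>Q)"
    by (rule nn_integral_liminf)
      (rule measurable_compose[OF time_changed_grid_rv, where g = "\<lambda>x. ennreal (x ^ (2 * p))"], measurable)
  also have "\<dots> \<le> liminf (\<lambda>m. ?R)"
    by (intro Liminf_mono eventually_mono[OF eventually_gt_at_top[of 0]] time_changed_grid_moment p)
  also have "\<dots> = ?R" by (simp add: Liminf_const)
  also have "\<dots> < \<infinity>"
    using clock_moment[of Q t \<eta> p] clk t p prob_space_axioms
    by (auto simp: clock_setup_def ennreal_mult_less_top)
  finally show ?thesis .
qed

lemma prob_space_tilde_law: "prob_space (tilde_law Q B \<eta> t)"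
  using t by (simp add: tilde_law_def prob_space_distr time_changed_rv)

text \<open>Odd powers are dominated through |x^n| \<le> 1 + x^(2 n).\<close>

lemma integrable_tilde_law_power: "integrable (tilde_law Q B \<eta> t) (\<lambda>w. w ^ n)"
proof (cases "n = 0")
  case True
  interpret L: prob_space "tilde_law Q B \<eta> t" by (rule prob_space_tilde_law)
  show ?thesis using True by simp
next
  case False
  have even: "integrable Q (\<lambda>\<omega>. B (random_clock \<eta> t \<omega>) \<omega> ^ (2 * n))"
    using time_changed_moment[of n] False time_changed_rv
    by (intro integrableI_nonneg) (auto simp: zero_le_even_power)
  have "integrable Q (\<lambda>\<omega>. B (random_clock \<eta> t \<omega>) \<omega> ^ n)"
  proof (rule Bochner_Integration.integrable_bound)
    show "integrable Q (\<lambda>\<omega>. 1 + B (random_clock \<eta> t \<omega>) \<omega> ^ (2 * n))"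
      using even by simp
    show "(\<lambda>\<omega>. B (random_clock \<eta> t \<omega>) \<omega> ^ n) \<in> borel_measurable Q"
      using time_changed_rv by measurable
    have "\<bar>x ^ n\<bar> \<le> 1 + x ^ (2 * n)" for x :: real
    proof -
      have "0 \<le> (\<bar>x ^ n\<bar> - 1)\<^sup>2" by simp
      moreover have "x ^ (2 * n) = \<bar>x ^ n\<bar>\<^sup>2" by (simp add: power_even_eq)
      ultimately show ?thesis by (simp add: power2_diff)
    qed
    then show "AE \<omega> in Q. norm (B (random_clock \<eta> t \<omega>) \<omega> ^ n) \<le> norm (1 + B (random_clock \<eta> t \<omega>) \<omega> ^ (2 * n))"
      by (intro always_eventually) (auto simp: zero_le_even_power intro: order.trans[OF _ abs_ge_self])
  qed
  then show ?thesis
    using t by (simp add: tilde_law_def integrable_distr_eq time_changed_rv)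
qed

end

subsection \<open>The walks as Bernoulli walks\<close>

text \<open>The sets that do not separate two paths agreeing up to t form a sigma-algebra containing
  the generators, and the level sets of F belong to it.\<close>

lemma path_filtration_determined:
  assumes F: "F \<in> borel_measurable (path_filtration t)" and eq: "\<And>s. s \<le> t \<Longrightarrow> \<Xi> s = \<Xi>' s"
  shows "F \<Xi> = (F \<Xi>' :: real)"
proof -
  let ?G = "{{\<Xi>. \<Xi> s \<in> B} | s B. s \<le> t \<and> B \<in> sets config_space}"
  have sets: "sets (path_filtration t) = sigma_sets UNIV ?G" and sp: "space (path_filtration t) = UNIV"
    unfolding path_filtration_def by (auto intro!: sets_measure_of space_measure_of)
  have "\<Xi> \<in> A \<longleftrightarrow> \<Xi>' \<in> A" if "A \<in> sigma_sets UNIV ?G" for A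
    using that by induction (auto simp: eq)
  moreover have "F -` {F \<Xi>'} \<in> sigma_sets UNIV ?G"
    using measurable_sets[OF F, of "{F \<Xi>'}"] unfolding sets sp by simp
  ultimately show ?thesis by blast
qed

lemma config_permute:
  assumes "p permutes {..<N}"
  shows "config N (x \<circ> p) = config N x"
proof -
  have "image_mset p (mset_set {..<N}) = mset_set {..<N}"
    using image_mset_mset_set[of p "{..<N}"] permutes_inj_on[OF assms] permutes_image[OF assms] by simp
  then show ?thesis
    unfolding config_def by (metis image_mset.compositionality)
qed

lemma config_cong: "(\<And>j. j < N \<Longrightarrow> x j = y j) \<Longrightarrow> config N x = config N y"
  unfolding config_def by (intro image_mset_cong) auto

lemma exit_time_gt_iff:
  "enat n < exit_time N V \<omega> \<longleftrightarrow> (\<forall>s. 1 \<le> s \<and> s \<le> n \<longrightarrow> (\<lambda>j. real_of_int (V j s \<omega>)) \<in> weyl N)"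
proof
  assume L: "enat n < exit_time N V \<omega>"
  show "\<forall>s. 1 \<le> s \<and> s \<le> n \<longrightarrow> (\<lambda>j. real_of_int (V j s \<omega>)) \<in> weyl N"
  proof (intro allI impI, rule ccontr)
    fix s assume "1 \<le> s \<and> s \<le> n" "(\<lambda>j. real_of_int (V j s \<omega>)) \<notin> weyl N"
    then have "exit_time N V \<omega> \<le> enat s" unfolding exit_time_def by (intro Inf_lower) auto
    also have "\<dots> \<le> enat n" using \<open>1 \<le> s \<and> s \<le> n\<close> by simp
    finally show False using L by simp
  qed
next
  assume R: "\<forall>s. 1 \<le> s \<and> s \<le> n \<longrightarrow> (\<lambda>j. real_of_int (V j s \<omega>)) \<in> weyl N"
  have "enat (Suc n) \<le> exit_time N V \<omega>"
    unfolding exit_time_def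
  proof (rule Inf_greatest)
    fix x assume "x \<in> enat ` {t. 1 \<le> t \<and> (\<lambda>j. real_of_int (V j t \<omega>)) \<notin> weyl N}"
    then obtain s where "x = enat s" "1 \<le> s" "(\<lambda>j. real_of_int (V j s \<omega>)) \<notin> weyl N" by auto
    with R show "enat (Suc n) \<le> x" by (metis enat_ord_simps(1) not_less_eq_eq)
  qed
  then show "enat n < exit_time N V \<omega>" by (metis Suc_ile_eq)
qed

section \<open>Paths as lists of sets of rising coordinates\<close>

fun walk_positions :: "(nat \<Rightarrow> nat) \<Rightarrow> nat set list \<Rightarrow> (nat \<Rightarrow> nat) list" where
  "walk_positions k [] = [k]"
| "walk_positions k (S # xs) = k # walk_positions (advance S k) xs"

lemma length_walk_positions [simp]: "length (walk_positions k xs) = Suc (length xs)"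
  by (induction k xs rule: walk_positions.induct) auto

lemma walk_positions_nth_0 [simp]: "walk_positions k xs ! 0 = k"
  by (cases xs) auto

lemma walk_positions_nth_Suc:
  "s < length xs \<Longrightarrow> walk_positions k xs ! Suc s = advance (xs ! s) (walk_positions k xs ! s)"
proof (induction k xs arbitrary: s rule: walk_positions.induct)
  case (2 k S xs)
  then show ?case by (cases s) auto
qed simp

definition step_lists :: "nat \<Rightarrow> nat \<Rightarrow> nat set list set" where
  "step_lists N n = {xs. set xs \<subseteq> Pow {..<N} \<and> length xs = n}"

lemma finite_step_lists [simp]: "finite (step_lists N n)"
  unfolding step_lists_def by (rule finite_lists_length_eq) simp

lemma walk_mean_eq_sum:
  "walk_mean N n g k = (\<Sum>xs\<in>step_lists N n. (1 / 2) ^ (N * n) * g (walk_positions k xs))"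
proof (induction n arbitrary: g k)
  case 0
  have "step_lists N 0 = {[]}" by (auto simp: step_lists_def)
  then show ?case by simp
next
  case (Suc n)
  have eq: "step_lists N (Suc n) = (\<lambda>(S, xs). S # xs) ` (Pow {..<N} \<times> step_lists N n)"
    by (auto simp: step_lists_def length_Suc_conv image_iff subset_iff)
  have "(\<Sum>xs\<in>step_lists N (Suc n). (1 / 2) ^ (N * Suc n) * g (walk_positions k xs)) =
      (\<Sum>(S, xs)\<in>Pow {..<N} \<times> step_lists N n. (1 / 2) ^ (N * Suc n) * g (k # walk_positions (advance S k) xs))"
    unfolding eq by (subst sum.reindex) (auto simp: inj_on_def case_prod_unfold)
  also have "\<dots> = (\<Sum>S\<in>Pow {..<N}. \<Sum>xs\<in>step_lists N n. (1 / 2) ^ (N * Suc n) * g (k # walk_positions (advance S k) xs))"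
    by (rule sum.cartesian_product[symmetric])
  also have "\<dots> = (\<Sum>S\<in>Pow {..<N}. (\<Sum>xs\<in>step_lists N n. (1 / 2) ^ (N * n) * g (k # walk_positions (advance S k) xs))) / 2 ^ N"
    by (simp add: sum_divide_distrib power_add power_one_over field_simps)
  finally show ?case by (simp add: Suc.IH)
qed

text \<open>A record in a countable type of everything observed up to time n. Functionals, survival
  and determinants become functions of it, so their measurability is automatic.\<close>

definition walk_values :: "nat \<Rightarrow> (nat \<Rightarrow> nat \<Rightarrow> 'a \<Rightarrow> int) \<Rightarrow> nat \<Rightarrow> 'a \<Rightarrow> int list list" where
  "walk_values N V n \<omega> = map (\<lambda>s. map (\<lambda>j. V j s \<omega>) [0..<N]) [0..<Suc n]"

lemma walk_values_nth: "s \<le> n \<Longrightarrow> j < N \<Longrightarrow> walk_values N V n \<omega> ! s ! j = V j s \<omega>"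
  by (simp add: walk_values_def del: upt_Suc)

lemma measurable_walk_values:
  assumes [measurable]: "\<And>j s. j < N \<Longrightarrow> (\<lambda>\<omega>. real_of_int (V j s \<omega>)) \<in> borel_measurable S"
  shows "walk_values N V n \<in> measurable S (count_space UNIV)"
proof -
  have "walk_values N V n -` {L} \<inter> space S \<in> sets S" for L
  proof (cases "length L = Suc n \<and> (\<forall>s\<le>n. length (L ! s) = N)")
    case True
    then have "walk_values N V n -` {L} \<inter> space S =
        {\<omega> \<in> space S. \<forall>s\<in>{..n}. \<forall>j\<in>{..<N}. real_of_int (V j s \<omega>) = real_of_int (L ! s ! j)}"
      by (auto simp: walk_values_def list_eq_iff_nth_eq less_Suc_eq_le simp del: upt_Suc)
    also have "\<dots> \<in> sets S"
      by (intro sets.sets_Collect_finite_All' sets.sets_Collect_finite_All borel_measurable_eq) auto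
    finally show ?thesis .
  next
    case False
    then have "walk_values N V n -` {L} \<inter> space S = {}"
      by (auto simp: walk_values_def simp del: upt_Suc)
    then show ?thesis by simp
  qed
  then show ?thesis by (subst measurable_count_space_eq2_countable) auto
qed

text \<open>Walks of even starting points never jump over each other: in the coordinates
  \<open>(V + s - u 0) / 2\<close> at time \<open>s\<close>, each of them moves by 0 or 1.\<close>

definition start_index :: "(nat \<Rightarrow> int) \<Rightarrow> nat \<Rightarrow> nat" where
  "start_index u j = nat ((u j - u 0) div 2)"

definition position_values :: "nat \<Rightarrow> (nat \<Rightarrow> int) \<Rightarrow> nat \<Rightarrow> (nat \<Rightarrow> nat) list \<Rightarrow> int list list" where
  "position_values N u n l =
     map (\<lambda>s. map (\<lambda>j. u 0 + 2 * int ((l ! s) j) - int s) [0..<N]) [0..<Suc n]"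

lemma length_position_values [simp]: "length (position_values N u n l) = Suc n"
  by (simp add: position_values_def)

lemma position_values_nth:
  "s \<le> n \<Longrightarrow> j < N \<Longrightarrow> position_values N u n l ! s ! j = u 0 + 2 * int ((l ! s) j) - int s"
  by (simp add: position_values_def del: upt_Suc)

definition up_sets :: "nat \<Rightarrow> (nat \<Rightarrow> nat \<Rightarrow> 'a \<Rightarrow> int) \<Rightarrow> nat \<Rightarrow> 'a \<Rightarrow> nat set list" where
  "up_sets N V n \<omega> = map (\<lambda>s. {j \<in> {..<N}. V j (Suc s) \<omega> - V j s \<omega> = 1}) [0..<n]"

context
  fixes M :: "'a measure" and N :: nat and u :: "nat \<Rightarrow> int" and V :: "nat \<Rightarrow> nat \<Rightarrow> 'a \<Rightarrow> int"
  assumes N: "1 \<le> N" and u_less: "\<And>j k. j < k \<Longrightarrow> k < N \<Longrightarrow> u j < u k" and u_even: "\<And>j. j < N \<Longrightarrow> even (u j)"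
    and walks: "simple_random_walks M N u V"
begin

interpretation prob_space M
  using walks by (simp add: simple_random_walks_def)

text \<open>Halving is exact because all starting points are even, and \<open>nat\<close> truncates
  nothing because \<open>u 0\<close> is the smallest.\<close>

lemma start_index: "j < N \<Longrightarrow> u j = u 0 + 2 * int (start_index u j)"
proof -
  assume j: "j < N"
  have "u 0 \<le> u j" using u_less[of 0 j] j by (cases "j = 0") auto
  moreover have "even (u j - u 0)" using u_even[of j] u_even[of 0] j N by auto
  ultimately show ?thesis by (simp add: start_index_def)
qed

lemma chamber_start_index: "chamber N (start_index u)"
  unfolding chamber_def
proof (intro allI impI)
  fix i j assume "i < j \<and> j < N"
  then show "start_index u i < start_index u j"
    using u_less[of i j] start_index[of i] start_index[of j] by simp
qed

lemma up_sets_step_lists: "up_sets N V n \<omega> \<in> step_lists N n"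
  by (auto simp: up_sets_def step_lists_def)

lemma increment_rv: "j < N \<Longrightarrow> (\<lambda>\<omega>. V j (Suc s) \<omega> - V j s \<omega>) \<in> measurable M (count_space UNIV)"
proof -
  assume "j < N"
  then have "(\<lambda>(j, s) \<omega>. V j (Suc s) \<omega> - V j s \<omega>) (j, s) \<in> measurable M (count_space UNIV)"
    using walks unfolding simple_random_walks_def indep_vars_def by blast
  then show ?thesis by simp
qed

lemma walk_rv: "j < N \<Longrightarrow> V j s \<in> measurable M (count_space UNIV)"
proof (induction s)
  case 0
  then have "V j 0 \<in> measurable M (count_space UNIV) \<longleftrightarrow> (\<lambda>_. u j) \<in> measurable M (count_space UNIV)"
    using walks by (intro measurable_cong) (auto simp: simple_random_walks_def)
  then show ?case by simp
next
  case (Suc s)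
  note [measurable] = Suc.IH[OF Suc.prems] increment_rv[OF Suc.prems, of s]
  have "(\<lambda>\<omega>. V j s \<omega> + (V j (Suc s) \<omega> - V j s \<omega>)) \<in> measurable M (count_space UNIV)"
    by measurable
  then show ?case by simp
qed

lemma walk_rv_real: "j < N \<Longrightarrow> (\<lambda>\<omega>. real_of_int (V j s \<omega>)) \<in> borel_measurable M"
  using measurable_compose[OF walk_rv, of j "\<lambda>x. real_of_int x" borel] by simp

lemma AE_increments: "AE \<omega> in M. \<forall>j<N. \<forall>s. V j (Suc s) \<omega> - V j s \<omega> \<in> {1, -1}"
proof -
  have "AE \<omega> in M. V j (Suc s) \<omega> - V j s \<omega> \<in> {1, -1}" if j: "j < N" for j s
  proof -
    note [measurable] = increment_rv[OF j, of s]
    have "prob ({\<omega> \<in> space M. V j (Suc s) \<omega> - V j s \<omega> = 1} \<union> {\<omega> \<in> space M. V j (Suc s) \<omega> - V j s \<omega> = -1}) =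
        prob {\<omega> \<in> space M. V j (Suc s) \<omega> - V j s \<omega> = 1} + prob {\<omega> \<in> space M. V j (Suc s) \<omega> - V j s \<omega> = -1}"
      by (intro finite_measure_Union) auto
    also have "\<dots> = 1 / 2 + 1 / 2"
      using walks j unfolding simple_random_walks_def by (intro arg_cong2[where f = "(+)"]) blast+
    also have "{\<omega> \<in> space M. V j (Suc s) \<omega> - V j s \<omega> = 1} \<union> {\<omega> \<in> space M. V j (Suc s) \<omega> - V j s \<omega> = -1} =
        {\<omega> \<in> space M. V j (Suc s) \<omega> - V j s \<omega> \<in> {1, -1}}"
      by auto
    finally show ?thesis by (simp add: prob_Collect_eq_1)
  qed
  then have "\<forall>j\<in>{..<N}. AE \<omega> in M. \<forall>s. V j (Suc s) \<omega> - V j s \<omega> \<in> {1, -1}"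
    by (auto simp: AE_all_countable)
  then have "AE \<omega> in M. \<forall>j\<in>{..<N}. \<forall>s. V j (Suc s) \<omega> - V j s \<omega> \<in> {1, -1}"
    by (subst AE_ball_countable) auto
  then show ?thesis by (simp only: Ball_def lessThan_iff)
qed

lemma walk_values_eq:
  assumes \<omega>: "\<omega> \<in> space M" and inc: "\<forall>j<N. \<forall>s. V j (Suc s) \<omega> - V j s \<omega> \<in> {1, -1}"
  shows "walk_values N V n \<omega> = position_values N u n (walk_positions (start_index u) (up_sets N V n \<omega>))"
proof -
  have "V j s \<omega> = u 0 + 2 * int ((walk_positions (start_index u) (up_sets N V n \<omega>) ! s) j) - int s"
    if "j < N" "s \<le> n" for j s
    using that(2)
  proof (induction s)
    case 0
    have "V j 0 \<omega> = u j" using walks \<omega> that(1) by (simp add: simple_random_walks_def)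
    then show ?case using start_index[OF that(1)] by simp
  next
    case (Suc s)
    have "walk_positions (start_index u) (up_sets N V n \<omega>) ! Suc s =
        advance {j \<in> {..<N}. V j (Suc s) \<omega> - V j s \<omega> = 1} (walk_positions (start_index u) (up_sets N V n \<omega>) ! s)"
      using Suc.prems by (subst walk_positions_nth_Suc) (auto simp: up_sets_def)
    moreover have "V j (Suc s) \<omega> - V j s \<omega> = 1 \<or> V j (Suc s) \<omega> - V j s \<omega> = -1"
      using inc that(1) by auto
    ultimately show ?case
      using Suc that(1) by (auto simp: advance_def)
  qed
  then show ?thesis
    unfolding walk_values_def position_values_def by (auto simp del: upt_Suc)
qed

lemma up_sets_event: "{\<omega> \<in> space M. up_sets N V n \<omega> = xs} \<in> events"
proof (cases "length xs = n")
  case True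
  note [measurable] = increment_rv
  have "{\<omega> \<in> space M. up_sets N V n \<omega> = xs} =
      {\<omega> \<in> space M. \<forall>s\<in>{..<n}. {j \<in> {..<N}. V j (Suc s) \<omega> - V j s \<omega> = 1} = xs ! s}"
    using True by (auto simp: up_sets_def list_eq_iff_nth_eq)
  also have "\<dots> = {\<omega> \<in> space M. \<forall>s\<in>{..<n}. (xs ! s \<subseteq> {..<N} \<and> (\<forall>j\<in>{..<N}. V j (Suc s) \<omega> - V j s \<omega> = 1 \<longleftrightarrow> j \<in> xs ! s))}"
    by (intro Collect_cong conj_cong ball_cong refl) (auto simp: set_eq_iff)
  also have "\<dots> \<in> events" by measurable
  finally show ?thesis .
next
  case False
  then have "{\<omega> \<in> space M. up_sets N V n \<omega> = xs} = {}" by (auto simp: up_sets_def)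
  then show ?thesis by (simp only: sets.empty_sets)
qed

lemma prob_up_sets:
  assumes xs: "xs \<in> step_lists N n"
  shows "prob {\<omega> \<in> space M. up_sets N V n \<omega> = xs} = (1 / 2) ^ (N * n)"
proof (cases "n = 0")
  case True
  then show ?thesis using xs by (simp add: step_lists_def up_sets_def prob_space)
next
  case False
  define X where "X = (\<lambda>(j, s) \<omega>. V j (Suc s) \<omega> - V j s \<omega>)"
  define e where "e = (\<lambda>(j, s). if j \<in> xs ! s then 1 else - 1 :: int)"
  define J where "J = {..<N} \<times> {..<n}"
  \<comment> \<open>The product rule for independent events is applied to a nonempty index set,
    hence the separate case n = 0.\<close>
  have "(0, 0) \<in> J" using False N by (simp add: J_def)
  then have J: "finite J" "J \<noteq> {}" "J \<subseteq> {..<N} \<times> UNIV" by (auto simp: J_def)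
  have ind: "indep_vars (\<lambda>_. count_space UNIV) X ({..<N} \<times> UNIV)"
    using walks by (simp add: simple_random_walks_def X_def)
  have half: "prob (X i -` {e i} \<inter> space M) = 1 / 2" if "i \<in> J" for i
  proof -
    obtain j s where i: "i = (j, s)" "j < N" using \<open>i \<in> J\<close> by (auto simp: J_def)
    have "X i -` {e i} \<inter> space M = {\<omega> \<in> space M. V j (Suc s) \<omega> - V j s \<omega> = e i}"
      by (auto simp: X_def i)
    then show ?thesis using walks i by (auto simp: simple_random_walks_def e_def)
  qed
  have ev: "(\<Inter>i\<in>J. X i -` {e i} \<inter> space M) \<in> events"
  proof (rule sets.finite_INT)
    fix i assume "i \<in> J"
    then have "X i \<in> measurable M (count_space UNIV)"
      using J ind unfolding indep_vars_def by blast
    then show "X i -` {e i} \<inter> space M \<in> events" by (rule measurable_sets) simp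
  qed (use J in auto)
  have "prob {\<omega> \<in> space M. up_sets N V n \<omega> = xs} = prob (\<Inter>i\<in>J. X i -` {e i} \<inter> space M)"
  proof (rule finite_measure_eq_AE)
    \<comment> \<open>The two events agree only almost surely: a coordinate outside the up-set need
      not move by -1 on the null event of other increments.\<close>
    show "AE \<omega> in M. \<omega> \<in> {\<omega> \<in> space M. up_sets N V n \<omega> = xs} \<longleftrightarrow> \<omega> \<in> (\<Inter>i\<in>J. X i -` {e i} \<inter> space M)"
      using AE_increments AE_space
    proof eventually_elim
      case (elim \<omega>)
      have "up_sets N V n \<omega> = xs \<longleftrightarrow> (\<forall>s<n. {j \<in> {..<N}. V j (Suc s) \<omega> - V j s \<omega> = 1} = xs ! s)"
        using xs by (auto simp: up_sets_def list_eq_iff_nth_eq step_lists_def)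
      also have "\<dots> \<longleftrightarrow> (\<forall>s<n. \<forall>j<N. V j (Suc s) \<omega> - V j s \<omega> = 1 \<longleftrightarrow> j \<in> xs ! s)"
      proof (intro all_cong1 imp_cong refl)
        fix s assume "s < n"
        then have "xs ! s \<in> set xs" using xs by (simp add: step_lists_def)
        then have "xs ! s \<subseteq> {..<N}" using xs by (auto simp: step_lists_def)
        then show "{j \<in> {..<N}. V j (Suc s) \<omega> - V j s \<omega> = 1} = xs ! s \<longleftrightarrow>
            (\<forall>j<N. V j (Suc s) \<omega> - V j s \<omega> = 1 \<longleftrightarrow> j \<in> xs ! s)" by auto
      qed
      also have "\<dots> \<longleftrightarrow> (\<forall>s<n. \<forall>j<N. V j (Suc s) \<omega> - V j s \<omega> = e (j, s))"
      proof (intro all_cong1 imp_cong refl)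
        fix s j assume "j < N"
        then have "V j (Suc s) \<omega> - V j s \<omega> = 1 \<or> V j (Suc s) \<omega> - V j s \<omega> = -1"
          using elim(1) by auto
        then show "(V j (Suc s) \<omega> - V j s \<omega> = 1 \<longleftrightarrow> j \<in> xs ! s) \<longleftrightarrow> V j (Suc s) \<omega> - V j s \<omega> = e (j, s)"
          by (auto simp: e_def)
      qed
      finally show ?case using elim(2) J(2) by (auto simp: J_def X_def)
    qed
  qed (use ev up_sets_event in auto)
  also have "\<dots> = (\<Prod>i\<in>J. prob (X i -` {e i} \<inter> space M))"
    by (rule indep_varsD[OF ind J(2,1,3)]) simp
  also have "\<dots> = (1 / 2) ^ (N * n)"
    by (simp add: half) (simp add: J_def)
  finally show ?thesis .
qed

lemma AE_walk_values: "AE \<omega> in M. walk_values N V n \<omega> = position_values N u n (walk_positions (start_index u) (up_sets N V n \<omega>))"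
  using AE_increments AE_space by eventually_elim (rule walk_values_eq)

lemma AE_walk_values_finite:
  "AE \<omega> in M. walk_values N V n \<omega> \<in> (\<lambda>xs. position_values N u n (walk_positions (start_index u) xs)) ` step_lists N n"
  using AE_walk_values[of n] by eventually_elim (auto simp: up_sets_step_lists)

lemma measurable_walk_values_M: "walk_values N V n \<in> measurable M (count_space UNIV)"
  by (rule measurable_walk_values) (rule walk_rv_real)

lemma walk_values_borel: "(\<lambda>\<omega>. H (walk_values N V n \<omega>)) \<in> borel_measurable M"
  using measurable_compose[OF measurable_walk_values_M, of H borel] by simp

lemma integrable_walk_values:
  fixes H :: "int list list \<Rightarrow> 'b::{banach, second_countable_topology}"
  shows "integrable M (\<lambda>\<omega>. H (walk_values N V n \<omega>))"
proof (rule integrable_const_bound)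
  let ?Y = "(\<lambda>xs. position_values N u n (walk_positions (start_index u) xs)) ` step_lists N n"
  show "AE \<omega> in M. norm (H (walk_values N V n \<omega>)) \<le> (\<Sum>y\<in>?Y. norm (H y))"
    using AE_walk_values_finite[of n]
    by eventually_elim (rule member_le_sum, auto)
qed (rule walk_values_borel)

text \<open>The bridge from the probability space to finite means: the lists of up-sets split the
  space into equally likely events, on which the record is almost surely constant.\<close>

lemma expectation_walk_values:
  fixes H :: "int list list \<Rightarrow> real"
  shows "(LINT \<omega>|M. H (walk_values N V n \<omega>)) = walk_mean N n (\<lambda>l. H (position_values N u n l)) (start_index u)"
proof -
  let ?h = "\<lambda>xs. H (position_values N u n (walk_positions (start_index u) xs))"
  let ?E = "\<lambda>xs. {\<omega> \<in> space M. up_sets N V n \<omega> = xs}"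
  have "(LINT \<omega>|M. H (walk_values N V n \<omega>)) = (LINT \<omega>|M. (\<Sum>xs\<in>step_lists N n. indicator (?E xs) \<omega> * ?h xs))"
  proof (rule integral_cong_AE)
    show "AE \<omega> in M. H (walk_values N V n \<omega>) = (\<Sum>xs\<in>step_lists N n. indicator (?E xs) \<omega> * ?h xs)"
      using AE_walk_values[of n] AE_space
    proof eventually_elim
      case (elim \<omega>)
      have "(\<Sum>xs\<in>step_lists N n. indicator (?E xs) \<omega> * ?h xs) = (\<Sum>xs\<in>{up_sets N V n \<omega>}. indicator (?E xs) \<omega> * ?h xs)"
        using up_sets_step_lists by (intro sum.mono_neutral_right) auto
      then show ?case using elim by simp
    qed
    show "(\<lambda>\<omega>. \<Sum>xs\<in>step_lists N n. indicator (?E xs) \<omega> * ?h xs) \<in> borel_measurable M"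
      by (intro borel_measurable_sum borel_measurable_times borel_measurable_indicator up_sets_event) simp
  qed (rule walk_values_borel)
  also have "\<dots> = (\<Sum>xs\<in>step_lists N n. LINT \<omega>|M. indicator (?E xs) \<omega> * ?h xs)"
    by (intro Bochner_Integration.integral_sum integrable_mult_left integrable_real_indicator up_sets_event)
      (simp add: emeasure_eq_measure)
  also have "\<dots> = (\<Sum>xs\<in>step_lists N n. (1 / 2) ^ (N * n) * ?h xs)"
    using up_sets_event by (intro sum.cong refl) (simp add: prob_up_sets)
  finally show ?thesis by (simp add: walk_mean_eq_sum)
qed

end

subsection \<open>The complex process\<close>

lemma poly_lagrange_sum:
  assumes "k < N"
  shows "poly (lagrange_poly N v k) z = (\<Sum>l<N. coeff (lagrange_poly N v k) l * z ^ l)"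
  unfolding poly_altdef using degree_lagrange_poly[OF assms, of v]
  by (intro sum.mono_neutral_left) (auto simp: coeff_eq_0)

lemma measurable_Phi: "(\<lambda>w. Phi N u k (Complex x w)) \<in> borel_measurable borel"
  unfolding Phi_eq_poly Complex_eq
  by (intro borel_measurable_continuous_onI continuous_intros)

text \<open>The expectation of \<open>(x + i w)\<^sup>l\<close> is a monic polynomial of degree \<open>l\<close> in \<open>x\<close>, whatever the law.\<close>

definition moment_poly :: "real measure \<Rightarrow> nat \<Rightarrow> complex poly" where
  "moment_poly L l =
     (\<Sum>i\<le>l. monom (of_nat (l choose i) * (LINT w|L. (\<i> * complex_of_real w) ^ (l - i))) i)"

context
  fixes L :: "real measure"
  assumes L: "prob_space L" and L_moments: "\<And>n. integrable L (\<lambda>w. w ^ n)"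
begin

lemma integrable_imaginary_power: "integrable L (\<lambda>w. (\<i> * complex_of_real w) ^ n)"
proof -
  have "(\<lambda>w. (\<i> * complex_of_real w) ^ n) = (\<lambda>w. \<i> ^ n * complex_of_real (w ^ n))"
    by (simp add: power_mult_distrib)
  then show ?thesis by (simp only:) (intro integrable_mult_right integrable_of_real L_moments)
qed

lemma complex_power_moment:
  "integrable L (\<lambda>w. Complex x w ^ l)" "(LINT w|L. Complex x w ^ l) = poly (moment_poly L l) (of_real x)"
proof -
  have eq: "Complex x w ^ l = (\<Sum>i\<le>l. of_nat (l choose i) * of_real x ^ i * (\<i> * of_real w) ^ (l - i))" for w
    unfolding Complex_eq by (rule binomial_ring)
  show "integrable L (\<lambda>w. Complex x w ^ l)"
    unfolding eq by (intro Bochner_Integration.integrable_sum integrable_mult_right integrable_imaginary_power)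
  show "(LINT w|L. Complex x w ^ l) = poly (moment_poly L l) (of_real x)"
    unfolding eq moment_poly_def
    by (subst Bochner_Integration.integral_sum)
      (auto simp: poly_sum poly_monom integrable_imaginary_power mult_ac intro!: sum.cong)
qed

lemma integrable_Phi:
  assumes "k < N"
  shows "integrable L (\<lambda>w. Phi N u k (Complex x w))"
  unfolding Phi_eq_poly poly_lagrange_sum[OF assms]
  by (intro Bochner_Integration.integrable_sum integrable_mult_right complex_power_moment)

text \<open>The matrix is the product of the evaluated moment polynomials, which are monic and give
  h(x), and the Lagrange coefficients, which give 1 / h(u).\<close>

lemma det_mart_eq:
  assumes inj: "inj_on u {..<N}"
  shows "det_mart N u (\<lambda>_. L) T x =
    of_real (vandermonde_det N x / vandermonde_det N (\<lambda>j. real_of_int (u j)))"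
proof -
  interpret prob_space L by (rule L)
  let ?u = "\<lambda>j. complex_of_int (u j)"
  let ?c = "Matrix.mat N N (\<lambda>(l, k). coeff (lagrange_poly N ?u k) l)"
  let ?m = "Matrix.mat N N (\<lambda>(j, l). poly (moment_poly L l) (of_real (x j)))"
  have "mart N u (\<lambda>_. L) k T y = (\<Sum>l\<in>{0..<N}. poly (moment_poly L l) (of_real y) * coeff (lagrange_poly N ?u k) l)"
    if "k < N" for k y
    unfolding mart_def Phi_eq_poly poly_lagrange_sum[OF that]
    by (subst Bochner_Integration.integral_sum)
      (auto simp: complex_power_moment atLeast0LessThan mult.commute)
  then have "Matrix.mat N N (\<lambda>(j, k). mart N u (\<lambda>_. L) k T (x j)) = ?m * ?c"
    by (intro eq_matI) (auto simp: scalar_prod_def)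
  then have "det_mart N u (\<lambda>_. L) T x = Determinant.det ?m * lagrange_coeff_det N ?u"
    unfolding det_mart_def lagrange_coeff_det_def by (simp add: det_mult[where n = N])
  also have "Determinant.det ?m = (\<Prod>l<N. coeff (moment_poly L l) l) * vandermonde_det N (\<lambda>j. complex_of_real (x j))"
  proof (rule det_poly_eval_triangular)
    show "degree (moment_poly L l) \<le> l" for l
      unfolding moment_poly_def
      by (intro degree_sum_le order.trans[OF degree_monom_le]) auto
  qed
  also have "(\<Prod>l<N. coeff (moment_poly L l) l) = 1"
  proof (rule prod.neutral, rule ballI)
    fix l
    have "coeff (moment_poly L l) l = (\<Sum>i\<in>{l}. of_nat (l choose i) * (LINT w|L. (\<i> * complex_of_real w) ^ (l - i)))"
      unfolding moment_poly_def coeff_sum by (intro sum.mono_neutral_cong_right) auto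
    then show "coeff (moment_poly L l) l = 1" by (simp add: prob_space)
  qed
  also have "vandermonde_det N ?u * lagrange_coeff_det N ?u = 1"
    using inj by (intro vandermonde_det_lagrange) (auto simp: inj_on_def)
  then have "lagrange_coeff_det N ?u = 1 / of_real (vandermonde_det N (\<lambda>j. real_of_int (u j)))"
    unfolding vandermonde_det_of_real[symmetric] by (auto simp: eq_divide_eq mult.commute)
  finally show ?thesis by (simp add: vandermonde_det_of_real)
qed

end

context prob_space begin

text \<open>On Y = y the family is frozen at \<open>X y\<close>, which is independent of the
  indicator of that event; the finitely many values are then summed.\<close>

lemma integral_finite_conditioning:
  fixes H :: "'c \<Rightarrow> complex" and X :: "'c \<Rightarrow> 'a \<Rightarrow> complex"
  assumes fin: "finite S" "AE \<omega> in M. Y \<omega> \<in> S"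
    and Y: "Y \<in> measurable M (count_space UNIV)"
    and mH: "(\<lambda>\<omega>. H (Y \<omega>) * X (Y \<omega>) \<omega>) \<in> borel_measurable M"
    and X: "\<And>y. integrable M (X y)"
    and ind: "\<And>y. indep_var borel (\<lambda>\<omega>. indicator {y} (Y \<omega>) :: complex) borel (X y)"
  shows "integrable M (\<lambda>\<omega>. H (Y \<omega>) * X (Y \<omega>) \<omega>)"
    and "(LINT \<omega>|M. H (Y \<omega>) * X (Y \<omega>) \<omega>) = (LINT \<omega>|M. H (Y \<omega>) * expectation (X (Y \<omega>)))"
proof -
  let ?I = "\<lambda>y \<omega>. indicator {y} (Y \<omega>) :: complex"
  have I_m: "?I y \<in> borel_measurable M" for y
    by (rule measurable_compose[OF Y, of "indicator {y}" borel]) simp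
  have I: "integrable M (?I y)" for y
  proof (rule integrable_const_bound[where B = 1])
    show "AE \<omega> in M. norm (?I y \<omega>) \<le> 1" by (intro AE_I2) (simp split: split_indicator)
  qed (rule I_m)
  have sum: "(\<Sum>y\<in>S. H y * (?I y \<omega> * G y)) = H (Y \<omega>) * G (Y \<omega>)" if "Y \<omega> \<in> S" for \<omega> and G :: "'c \<Rightarrow> complex"
  proof -
    have "H y * (?I y \<omega> * G y) = (if y = Y \<omega> then H (Y \<omega>) * G (Y \<omega>) else 0)" for y
      by (simp split: split_indicator)
    then show ?thesis using that fin(1) by (simp only: sum.delta) simp
  qed
  have int: "integrable M (\<lambda>\<omega>. \<Sum>y\<in>S. H y * (?I y \<omega> * X y \<omega>))"
    by (intro Bochner_Integration.integrable_sum integrable_mult_right indep_var_integrable[OF ind I X])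
  have ae: "AE \<omega> in M. (\<Sum>y\<in>S. H y * (?I y \<omega> * X y \<omega>)) = H (Y \<omega>) * X (Y \<omega>) \<omega>"
    using fin(2) by eventually_elim (rule sum)
  show "integrable M (\<lambda>\<omega>. H (Y \<omega>) * X (Y \<omega>) \<omega>)"
    by (rule integrable_cong_AE[THEN iffD1, OF borel_measurable_integrable[OF int] mH ae int])
  have "(LINT \<omega>|M. H (Y \<omega>) * X (Y \<omega>) \<omega>) = (LINT \<omega>|M. (\<Sum>y\<in>S. H y * (?I y \<omega> * X y \<omega>)))"
    by (rule integral_cong_AE[OF borel_measurable_integrable[OF int] mH ae, symmetric])
  also have "\<dots> = (\<Sum>y\<in>S. H y * (expectation (?I y) * expectation (X y)))"
    by (subst Bochner_Integration.integral_sum)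
      (simp_all add: indep_var_integrable[OF ind I X] indep_var_lebesgue_integral[OF ind I X])
  also have "\<dots> = (LINT \<omega>|M. (\<Sum>y\<in>S. H y * (?I y \<omega> * expectation (X y))))"
    by (subst Bochner_Integration.integral_sum) (simp_all add: I)
  also have "\<dots> = (LINT \<omega>|M. H (Y \<omega>) * expectation (X (Y \<omega>)))"
  proof (rule integral_cong_AE)
    show "AE \<omega> in M. (\<Sum>y\<in>S. H y * (?I y \<omega> * expectation (X y))) = H (Y \<omega>) * expectation (X (Y \<omega>))"
      using fin(2) by eventually_elim (rule sum)
    show "(\<lambda>\<omega>. H (Y \<omega>) * expectation (X (Y \<omega>))) \<in> borel_measurable M"
      by (rule measurable_compose[OF Y, of "\<lambda>y. H y * expectation (X y)" borel]) simp
    show "(\<lambda>\<omega>. \<Sum>y\<in>S. H y * (?I y \<omega> * expectation (X y))) \<in> borel_measurable M"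
      by (intro borel_measurable_sum borel_measurable_times borel_measurable_const I_m)
  qed
  finally show "(LINT \<omega>|M. H (Y \<omega>) * X (Y \<omega>) \<omega>) = (LINT \<omega>|M. H (Y \<omega>) * expectation (X (Y \<omega>)))" .
qed

end

text \<open>The positions x are kept apart from the sample point so that they can be frozen while W
  stays random.\<close>

definition Phi_det ::
    "nat \<Rightarrow> (nat \<Rightarrow> int) \<Rightarrow> (nat \<Rightarrow> nat \<Rightarrow> 'a \<Rightarrow> real) \<Rightarrow> nat \<Rightarrow> (nat \<Rightarrow> real) \<Rightarrow> 'a \<Rightarrow> complex" where
  "Phi_det N u W T x \<omega> =
     Determinant.det (Matrix.mat N N (\<lambda>(j, k). Phi N u k (Complex (x j) (W j T \<omega>))))"

context
  fixes M :: "'a measure" and N :: nat and u :: "nat \<Rightarrow> int" and V :: "nat \<Rightarrow> nat \<Rightarrow> 'a \<Rightarrow> int"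
    and L :: "nat \<Rightarrow> real measure" and W :: "nat \<Rightarrow> nat \<Rightarrow> 'a \<Rightarrow> real" and T :: nat
  assumes N: "1 \<le> N" and u_less: "\<And>j k. j < k \<Longrightarrow> k < N \<Longrightarrow> u j < u k" and u_even: "\<And>j. j < N \<Longrightarrow> even (u j)"
    and walks: "simple_random_walks M N u V"
    and copies: "independent_copies M N V L W"
    and LT: "prob_space (L T)" and LT_moments: "\<And>n. integrable (L T) (\<lambda>w. w ^ n)"
begin

interpretation prob_space M
  using walks by (simp add: simple_random_walks_def)

lemma W_rv: "j < N \<Longrightarrow> W j T \<in> borel_measurable M" and W_distr: "j < N \<Longrightarrow> distr M borel (W j T) = L T"
  using copies by (auto simp: independent_copies_def)

lemma Phi_W_indep: "indep_vars (\<lambda>_. borel) (\<lambda>j \<omega>. Phi N u (p j) (Complex (x j) (W j T \<omega>))) {..<N}"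
  unfolding indep_vars_def2
proof (intro conjI ballI)
  fix j assume j: "j \<in> {..<N}"
  then show "(\<lambda>\<omega>. Phi N u (p j) (Complex (x j) (W j T \<omega>))) \<in> borel_measurable M"
    by (intro measurable_compose[OF W_rv measurable_Phi]) simp
next
  have "indep_sets (\<lambda>j. sigma_gen M UNIV (W j)) {..<N}"
    using copies by (simp add: independent_copies_def)
  then show "indep_sets (\<lambda>i. {(\<lambda>\<omega>. Phi N u (p i) (Complex (x i) (W i T \<omega>))) -` A \<inter> space M |A. A \<in> sets borel}) {..<N}"
  proof (rule indep_sets_mono_sets)
    fix j
    have "(\<lambda>\<omega>. Phi N u (p j) (Complex (x j) (W j T \<omega>))) \<in> borel_measurable (gen_space M UNIV (W j))"
      by (intro measurable_compose[OF measurable_gen_space measurable_Phi]) simp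
    from measurable_sets[OF this]
    show "{(\<lambda>\<omega>. Phi N u (p j) (Complex (x j) (W j T \<omega>))) -` A \<inter> space M |A. A \<in> sets borel} \<subseteq> sigma_gen M UNIV (W j)"
      by auto
  qed
qed

lemma Phi_W_expectation:
  assumes "j < N" "k < N"
  shows "integrable M (\<lambda>\<omega>. Phi N u k (Complex y (W j T \<omega>)))"
    and "(LINT \<omega>|M. Phi N u k (Complex y (W j T \<omega>))) = mart N u L k T y"
  using integrable_Phi[OF LT LT_moments assms(2), of u y] measurable_Phi[of N u k y] W_rv[OF assms(1)]
  unfolding mart_def W_distr[OF assms(1), symmetric]
  by (auto simp: integrable_distr_eq integral_distr)

text \<open>A Leibniz term has one factor from each row, and different rows involve independent
  copies, so expectation passes to the entries.\<close>

lemma Phi_det_expectation: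
  shows "integrable M (Phi_det N u W T x)" and "expectation (Phi_det N u W T x) = det_mart N u L T x"
proof -
  let ?X = "\<lambda>p j \<omega>. Phi N u (p j) (Complex (x j) (W j T \<omega>))"
  have p: "p permutes {..<N} \<Longrightarrow> j < N \<Longrightarrow> p j < N" for p j
    using permutes_in_image[of p "{..<N}" j] by simp
  have X: "integrable M (\<lambda>\<omega>. \<Prod>j<N. ?X p j \<omega>)"
      "(LINT \<omega>|M. (\<Prod>j<N. ?X p j \<omega>)) = (\<Prod>j<N. mart N u L (p j) T (x j))" if "p permutes {..<N}" for p
  proof -
    show "integrable M (\<lambda>\<omega>. \<Prod>j<N. ?X p j \<omega>)"
      by (rule indep_vars_integrable[of "{..<N}" "?X p"])
        (simp_all add: Phi_W_indep Phi_W_expectation(1) p[OF that])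
    have "(LINT \<omega>|M. (\<Prod>j<N. ?X p j \<omega>)) = (\<Prod>j<N. LINT \<omega>|M. ?X p j \<omega>)"
      by (rule indep_vars_lebesgue_integral[of "{..<N}" "?X p"])
        (simp_all add: Phi_W_indep Phi_W_expectation(1) p[OF that])
    also have "\<dots> = (\<Prod>j<N. mart N u L (p j) T (x j))"
      by (intro prod.cong refl) (simp add: Phi_W_expectation(2) p[OF that])
    finally show "(LINT \<omega>|M. (\<Prod>j<N. ?X p j \<omega>)) = (\<Prod>j<N. mart N u L (p j) T (x j))" .
  qed
  have eq: "Phi_det N u W T x = (\<lambda>\<omega>. \<Sum>p | p permutes {..<N}. signof p * (\<Prod>j<N. ?X p j \<omega>))"
    by (simp add: fun_eq_iff Phi_det_def det_mat_leibniz)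
  show "integrable M (Phi_det N u W T x)"
    unfolding eq by (intro Bochner_Integration.integrable_sum integrable_mult_right X) simp
  show "expectation (Phi_det N u W T x) = det_mart N u L T x"
    unfolding eq det_mart_def det_mat_leibniz
    by (subst Bochner_Integration.integral_sum) (simp_all add: X)
qed

lemma Phi_det_measurable_gen:
  "Phi_det N u W T x \<in> borel_measurable (gen_space M ({..<N} \<times> UNIV) (\<lambda>(j, t). W j t))"
proof -
  have W: "(\<lambda>\<omega>. W j T \<omega>) \<in> borel_measurable (gen_space M ({..<N} \<times> UNIV) (\<lambda>(j, t). W j t))" if "j < N" for j
    using measurable_gen_space[of "(j, T)" "{..<N} \<times> UNIV" "\<lambda>(j, t). W j t" M] that by simp
  show ?thesis
    unfolding Phi_det_def[abs_def] det_mat_leibniz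
    by (intro borel_measurable_sum borel_measurable_times borel_measurable_prod borel_measurable_const)
      (auto intro!: measurable_compose[OF W measurable_Phi])
qed

lemma complex_process_expectation:
  fixes H :: "int list list \<Rightarrow> complex"
  shows "integrable M (\<lambda>\<omega>. H (walk_values N V T \<omega>) * Phi_det N u W T (\<lambda>j. real_of_int (V j T \<omega>)) \<omega>)"
    and "(LINT \<omega>|M. H (walk_values N V T \<omega>) * Phi_det N u W T (\<lambda>j. real_of_int (V j T \<omega>)) \<omega>) =
      (LINT \<omega>|M. H (walk_values N V T \<omega>) * det_mart N u L T (\<lambda>j. real_of_int (V j T \<omega>)))"
proof -
  let ?Y = "walk_values N V T"
  let ?x = "\<lambda>y j. real_of_int (y ! T ! j)"
  note vals = AE_walk_values_finite[OF N u_less u_even walks, of T]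
    measurable_walk_values_M[OF N u_less u_even walks, of T]
  have V_eq: "Phi_det N u W T (\<lambda>j. real_of_int (V j T \<omega>)) \<omega> = Phi_det N u W T (?x (?Y \<omega>)) \<omega>" for \<omega>
    unfolding Phi_det_def det_mat_leibniz
    by (intro sum.cong prod.cong arg_cong2[where f = "(*)"] refl) (auto simp: walk_values_nth)
  have mart_eq: "det_mart N u L T (\<lambda>j. real_of_int (V j T \<omega>)) = det_mart N u L T (?x (?Y \<omega>))" for \<omega>
    unfolding det_mart_def det_mat_leibniz
    by (intro sum.cong prod.cong arg_cong2[where f = "(*)"] refl) (auto simp: walk_values_nth)
  have mX: "(\<lambda>\<omega>. H (?Y \<omega>) * Phi_det N u W T (?x (?Y \<omega>)) \<omega>) \<in> borel_measurable M"
    by (rule measurable_compose_countable[where f = "\<lambda>y \<omega>. H y * Phi_det N u W T (?x y) \<omega>" and g = ?Y])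
      (intro borel_measurable_times borel_measurable_integrable Phi_det_expectation borel_measurable_const vals(2))+
  have ind: "indep_var borel (\<lambda>\<omega>. indicator {y} (?Y \<omega>) :: complex) borel (Phi_det N u W T (?x y))" for y
  proof (rule indep_set_imp_indep_var[OF _ _ _ _ Phi_det_measurable_gen])
    let ?G = "gen_space M ({..<N} \<times> UNIV) (\<lambda>(j, t) \<omega>. real_of_int (V j t \<omega>))"
    show "indep_set (sets ?G) (sigma_gen M ({..<N} \<times> UNIV) (\<lambda>(j, t). W j t))"
      using copies by (simp add: independent_copies_def)
    have "?Y \<in> measurable ?G (count_space UNIV)"
    proof (rule measurable_walk_values)
      fix j s assume "j < N"
      then show "(\<lambda>\<omega>. real_of_int (V j s \<omega>)) \<in> borel_measurable ?G"
        using measurable_gen_space[of "(j, s)" "{..<N} \<times> UNIV" "\<lambda>(j, t) \<omega>. real_of_int (V j t \<omega>)" M] by simp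
    qed
    then show "(\<lambda>\<omega>. indicator {y} (?Y \<omega>) :: complex) \<in> borel_measurable ?G"
      by (rule measurable_compose[of _ _ _ "indicator {y}"]) simp
  qed simp_all
  note cond = integral_finite_conditioning[where X = "\<lambda>y. Phi_det N u W T (?x y)" and H = H and Y = ?Y,
      OF _ vals mX Phi_det_expectation(1) ind]
  show "integrable M (\<lambda>\<omega>. H (?Y \<omega>) * Phi_det N u W T (\<lambda>j. real_of_int (V j T \<omega>)) \<omega>)"
    unfolding V_eq by (rule cond(1)) simp
  show "(LINT \<omega>|M. H (?Y \<omega>) * Phi_det N u W T (\<lambda>j. real_of_int (V j T \<omega>)) \<omega>) =
      (LINT \<omega>|M. H (?Y \<omega>) * det_mart N u L T (\<lambda>j. real_of_int (V j T \<omega>)))"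
    using cond(2) by (simp add: V_eq mart_eq Phi_det_expectation(2))
qed

end

subsection \<open>The noncolliding walk\<close>

text \<open>F read off a finite record. Times after t receive the empty configuration, a default
  that F cannot see.\<close>

definition observed :: "nat \<Rightarrow> nat \<Rightarrow> ((nat \<Rightarrow> real multiset) \<Rightarrow> real) \<Rightarrow> int list list \<Rightarrow> real" where
  "observed N t F y = F (\<lambda>s. if s \<le> t \<and> s < length y then config N (\<lambda>j. real_of_int (y ! s ! j)) else {#})"

text \<open>The same in Bernoulli coordinates. The guard on the length keeps it invariant under
  relabelling for lists of any length, as \<open>future_antisymmetric\<close> requires.\<close>

definition observed_positions ::
    "nat \<Rightarrow> nat \<Rightarrow> int \<Rightarrow> ((nat \<Rightarrow> real multiset) \<Rightarrow> real) \<Rightarrow> (nat \<Rightarrow> nat) list \<Rightarrow> real" where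
  "observed_positions N t c F l = F (\<lambda>s. if s \<le> t \<and> s < length l
     then config N (\<lambda>j. real_of_int (c + 2 * int ((l ! s) j) - int s)) else {#})"

lemma observed_walk_values:
  assumes "F \<in> borel_measurable (path_filtration t)" "t \<le> n"
  shows "F (walk_path N V \<omega>) = observed N t F (walk_values N V n \<omega>)"
  unfolding observed_def
proof (rule path_filtration_determined[OF assms(1)])
  fix s assume s: "s \<le> t"
  have "s < length (walk_values N V n \<omega>)" using s assms(2) by (simp add: walk_values_def)
  then show "walk_path N V \<omega> s = (if s \<le> t \<and> s < length (walk_values N V n \<omega>)
      then config N (\<lambda>j. real_of_int (walk_values N V n \<omega> ! s ! j)) else {#})"
    using s assms(2) unfolding walk_path_def by (auto simp: walk_values_nth intro!: config_cong)
qed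

lemma observed_position_values:
  assumes "t \<le> n" "length l = Suc n"
  shows "observed N t F (position_values N u n l) = observed_positions N t (u 0) F (take (Suc t) l)"
  unfolding observed_def observed_positions_def
proof (intro arg_cong[of _ _ F] ext)
  fix s
  show "(if s \<le> t \<and> s < length (position_values N u n l)
      then config N (\<lambda>j. real_of_int (position_values N u n l ! s ! j)) else {#}) =
    (if s \<le> t \<and> s < length (take (Suc t) l)
      then config N (\<lambda>j. real_of_int (u 0 + 2 * int ((take (Suc t) l ! s) j) - int s)) else {#})"
    using assms by (auto simp: position_values_nth intro!: config_cong)
qed

lemma observed_positions_permute:
  assumes p: "p permutes {..<N}"
  shows "observed_positions N t c F (a @ map (\<lambda>k. k \<circ> p) l) = observed_positions N t c F (a @ l)"
  unfolding observed_positions_def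
proof (intro arg_cong[of _ _ F] ext)
  fix s
  have "config N (\<lambda>j. real_of_int (c + 2 * int (((a @ map (\<lambda>k. k \<circ> p) l) ! s) j) - int s)) =
      config N (\<lambda>j. real_of_int (c + 2 * int (((a @ l) ! s) j) - int s))" if "s < length (a @ l)"
  proof (cases "s < length a")
    case False
    then show ?thesis
      using that config_permute[OF p, of "\<lambda>j. real_of_int (c + 2 * int (((a @ l) ! s) j) - int s)"]
      by (simp add: nth_append o_def)
  qed (simp add: nth_append)
  then show "(if s \<le> t \<and> s < length (a @ map (\<lambda>k. k \<circ> p) l)
      then config N (\<lambda>j. real_of_int (c + 2 * int (((a @ map (\<lambda>k. k \<circ> p) l) ! s) j) - int s)) else {#}) =
    (if s \<le> t \<and> s < length (a @ l)
      then config N (\<lambda>j. real_of_int (c + 2 * int (((a @ l) ! s) j) - int s)) else {#})"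
    by simp
qed

definition values_alive :: "nat \<Rightarrow> nat \<Rightarrow> int list list \<Rightarrow> bool" where
  "values_alive N n y \<longleftrightarrow> (\<forall>s. 1 \<le> s \<and> s \<le> n \<longrightarrow> (\<lambda>j. real_of_int (y ! s ! j)) \<in> weyl N)"

lemma exit_time_walk_values: "enat n < exit_time N V \<omega> \<longleftrightarrow> values_alive N n (walk_values N V n \<omega>)"
  unfolding exit_time_gt_iff values_alive_def weyl_def by (auto simp: walk_values_nth)

text \<open>The exit time is tested from time 1 on, \<open>alive\<close> from time 0; the start lies
  in the chamber.\<close>

lemma values_alive_position_values:
  assumes "length l = Suc n" "hd l = k" "chamber N k"
  shows "values_alive N n (position_values N u n l) \<longleftrightarrow> alive N l"
proof -
  have "values_alive N n (position_values N u n l) \<longleftrightarrow> (\<forall>s. 1 \<le> s \<and> s \<le> n \<longrightarrow> chamber N (l ! s))"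
    unfolding values_alive_def weyl_def chamber_def by (auto simp: position_values_nth)
  also have "\<dots> \<longleftrightarrow> (\<forall>s<length l. chamber N (l ! s))"
  proof -
    have "l \<noteq> []" using assms(1) by auto
    then have "chamber N (l ! 0)" using assms by (simp add: hd_conv_nth)
    then show ?thesis
      using assms(1) by (metis One_nat_def Suc_leI less_Suc_eq_le not_gr_zero)
  qed
  also have "\<dots> \<longleftrightarrow> alive N l" by (simp add: alive_def all_set_conv_all_nth)
  finally show ?thesis .
qed

lemma survival_expectation_eq:
  assumes setting: "1 \<le> N" "\<And>j k. j < k \<Longrightarrow> k < N \<Longrightarrow> u j < u k" "\<And>j. j < N \<Longrightarrow> even (u j)"
      "simple_random_walks M N u V"
    and F: "F \<in> borel_measurable (path_filtration t)" and tn: "t \<le> n"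
  shows "survival_expectation M N V n F =
    walk_mean N n (\<lambda>l. of_bool (alive N l) * observed_positions N t (u 0) F (take (Suc t) l)) (start_index u) /
      survival N n (start_index u)"
proof -
  let ?k = "start_index u" and ?Y = "walk_values N V n"
  let ?S = "{\<omega> \<in> space M. exit_time N V \<omega> > enat n}"
  note E = expectation_walk_values[OF setting]
  have ch: "chamber N ?k" by (rule chamber_start_index[OF setting])
  have ind: "indicator ?S \<omega> = (of_bool (values_alive N n (?Y \<omega>)) :: real)" if "\<omega> \<in> space M" for \<omega>
    using that by (simp add: exit_time_walk_values indicator_def)
  have "(LINT \<omega>|M. F (walk_path N V \<omega>) * indicator ?S \<omega>) =
      (LINT \<omega>|M. of_bool (values_alive N n (?Y \<omega>)) * observed N t F (?Y \<omega>))"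
    by (intro Bochner_Integration.integral_cong refl) (simp add: ind observed_walk_values[OF F tn])
  also have "\<dots> = walk_mean N n (\<lambda>l. of_bool (values_alive N n (position_values N u n l)) * observed N t F (position_values N u n l)) ?k"
    by (rule E[where H = "\<lambda>y. of_bool (values_alive N n y) * observed N t F y"])
  also have "\<dots> = walk_mean N n (\<lambda>l. of_bool (alive N l) * observed_positions N t (u 0) F (take (Suc t) l)) ?k"
    by (rule walk_mean_cong) (simp add: values_alive_position_values[OF _ _ ch] observed_position_values[OF tn])
  finally have num: "(LINT \<omega>|M. F (walk_path N V \<omega>) * indicator ?S \<omega>) =
      walk_mean N n (\<lambda>l. of_bool (alive N l) * observed_positions N t (u 0) F (take (Suc t) l)) ?k" .
  have "measure M ?S = (LINT \<omega>|M. indicator ?S \<omega>)"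
    by (simp add: Int_def conj_commute)
  also have "\<dots> = (LINT \<omega>|M. of_bool (values_alive N n (?Y \<omega>)))"
    by (intro Bochner_Integration.integral_cong refl ind)
  also have "\<dots> = walk_mean N n (\<lambda>l. of_bool (values_alive N n (position_values N u n l))) ?k"
    by (rule E)
  also have "\<dots> = survival N n ?k"
    unfolding survival_def by (rule walk_mean_cong) (simp add: values_alive_position_values[OF _ _ ch])
  finally have den: "measure M ?S = survival N n ?k" .
  show ?thesis
    unfolding survival_expectation_def Let_def num den ..
qed

text \<open>The powers of 2 undo the halving of coordinates and cancel against those in
  h(u).\<close>

lemma vandermonde_position_values:
  assumes "length l = Suc n"
  shows "vandermonde_det N (\<lambda>j. real_of_int (position_values N u n l ! n ! j)) =
    (\<Prod>i<N. 2 ^ i) * vandermonde_nat N (last l)"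
proof -
  have "l \<noteq> []" using assms by auto
  then have last: "last l = l ! n" using assms by (simp add: last_conv_nth)
  have "vandermonde_det N (\<lambda>j. real_of_int (position_values N u n l ! n ! j)) =
      vandermonde_det N (\<lambda>j. (real_of_int (u 0) - real n) + 2 * real (last l j))"
    by (rule vandermonde_det_cong) (simp add: position_values_nth last)
  then show ?thesis by (simp only: vandermonde_det_affine)
qed

theorem theorem6p1:
  fixes N t T :: nat
    and u :: "nat \<Rightarrow> int"
    and M :: "'a measure"
    and V :: "nat \<Rightarrow> nat \<Rightarrow> 'a \<Rightarrow> int"
    and W :: "nat \<Rightarrow> nat \<Rightarrow> 'a \<Rightarrow> real"
    and Q :: "'q measure"
    and B :: "real \<Rightarrow> 'q \<Rightarrow> real"
    and \<eta> :: "nat \<Rightarrow> nat \<Rightarrow> 'q \<Rightarrow> real"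
    and F :: "(nat \<Rightarrow> real multiset) \<Rightarrow> real"
  assumes "1 \<le> N"
    and "\<And>j k. j < k \<Longrightarrow> k < N \<Longrightarrow> u j < u k"
    and "\<And>j. j < N \<Longrightarrow> even (u j)"
    and "1 \<le> t" and "t \<le> T"
    and "simple_random_walks M N u V"
    and "clock_setup Q B \<eta>"
    and "independent_copies M N V (tilde_law Q B \<eta>) W"
    and "F \<in> borel_measurable (path_filtration t)"
    and "bounded (range F)"
  shows
    "convergent (\<lambda>n. survival_expectation M N V n F) \<and>
     integrable M (\<lambda>\<omega>. complex_of_real (F (walk_path N V \<omega>)) *
       det_mart N u (tilde_law Q B \<eta>) T (\<lambda>j. real_of_int (V j T \<omega>))) \<and>
     integrable M (\<lambda>\<omega>. complex_of_real (F (\<lambda>s. config N (\<lambda>j. Re (cprocess V W j s \<omega>)))) *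
       Determinant.det (Matrix.mat N N (\<lambda>(j, k). Phi N u k (cprocess V W j T \<omega>)))) \<and>
     complex_of_real (noncolliding_expectation M N V F) =
       (LINT \<omega>|M. complex_of_real (F (walk_path N V \<omega>)) *
         det_mart N u (tilde_law Q B \<eta>) T (\<lambda>j. real_of_int (V j T \<omega>))) \<and>
     (LINT \<omega>|M. complex_of_real (F (walk_path N V \<omega>)) *
         det_mart N u (tilde_law Q B \<eta>) T (\<lambda>j. real_of_int (V j T \<omega>))) =
       (LINT \<omega>|M. complex_of_real (F (\<lambda>s. config N (\<lambda>j. Re (cprocess V W j s \<omega>)))) *
         Determinant.det (Matrix.mat N N (\<lambda>(j, k). Phi N u k (cprocess V W j T \<omega>))))"
proof -
  let ?L = "tilde_law Q B \<eta>" and ?k = "start_index u" and ?Y = "walk_values N V T"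
  let ?D = "\<lambda>\<omega>. det_mart N u ?L T (\<lambda>j. real_of_int (V j T \<omega>))"
  let ?P = "\<lambda>\<omega>. Determinant.det (Matrix.mat N N (\<lambda>(j, k). Phi N u k (cprocess V W j T \<omega>)))"
  let ?r = "\<lambda>y. vandermonde_det N (\<lambda>j. real_of_int (y ! T ! j)) / vandermonde_det N (\<lambda>j. real_of_int (u j))"
  let ?obs = "observed_positions N t (u 0) F"
  note setting = assms(1-3) assms(6)
  have T: "1 \<le> T" using assms(4,5) by simp
  have law: "prob_space (?L T)" "integrable (?L T) (\<lambda>w. w ^ n)" for n
    using prob_space_tilde_law[OF assms(7) T] integrable_tilde_law_power[OF assms(7) T] by auto
  have ch: "chamber N ?k" by (rule chamber_start_index[OF setting])
  have inj: "inj_on u {..<N}"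
  proof (rule inj_onI, rule ccontr)
    fix i j assume "i \<in> {..<N}" "j \<in> {..<N}" "u i = u j" "i \<noteq> j"
    then show False using assms(2)[of i j] assms(2)[of j i] by (cases i j rule: linorder_cases) auto
  qed
  have D: "?D \<omega> = of_real (?r (?Y \<omega>))" for \<omega>
  proof -
    \<comment> \<open>Only the law at time T enters, so the family of laws may be taken
      constant.\<close>
    have "?D \<omega> = det_mart N u (\<lambda>_. ?L T) T (\<lambda>j. real_of_int (V j T \<omega>))"
      by (simp add: det_mart_def mart_def)
    also have "\<dots> = of_real (vandermonde_det N (\<lambda>j. real_of_int (V j T \<omega>)) / vandermonde_det N (\<lambda>j. real_of_int (u j)))"
      by (rule det_mart_eq[OF law inj])
    also have "vandermonde_det N (\<lambda>j. real_of_int (V j T \<omega>)) = vandermonde_det N (\<lambda>j. real_of_int (?Y \<omega> ! T ! j))"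
      by (rule vandermonde_det_cong) (simp add: walk_values_nth)
    finally show ?thesis .
  qed
  have FY: "F (walk_path N V \<omega>) = observed N t F (?Y \<omega>)" for \<omega>
    by (rule observed_walk_values[OF assms(9,5)])
  have path: "(\<lambda>s. config N (\<lambda>j. Re (cprocess V W j s \<omega>))) = walk_path N V \<omega>" for \<omega>
    by (simp add: walk_path_def cprocess_def)
  have P: "?P \<omega> = Phi_det N u W T (\<lambda>j. real_of_int (V j T \<omega>)) \<omega>" for \<omega>
    by (simp add: Phi_det_def cprocess_def)
  \<comment> \<open>The common value: the Doob transform in Bernoulli coordinates, to be matched
    with the limit and with the determinantal expectation.\<close>
  let ?R = "walk_mean N T (\<lambda>l. ?obs (take (Suc t) l) * vandermonde_nat N (last l)) ?k / vandermonde_nat N ?k"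

  have "?obs (a @ map (\<lambda>k. k \<circ> Transposition.transpose i j) l) = ?obs (a @ l)"
    if "i < N" "j < N" for a l i j
    using that by (intro observed_positions_permute permutes_swap_id) auto
  then have "(\<lambda>n. walk_mean N n (\<lambda>l. of_bool (alive N l) * ?obs (take (Suc t) l)) ?k / survival N n ?k) \<longlonglongrightarrow> ?R"
    by (intro doob_transform_limit[OF ch assms(5)])
  moreover have "eventually (\<lambda>n. walk_mean N n (\<lambda>l. of_bool (alive N l) * ?obs (take (Suc t) l)) ?k / survival N n ?k =
      survival_expectation M N V n F) sequentially"
    using eventually_ge_at_top[of t]
    by eventually_elim (simp add: survival_expectation_eq[OF setting assms(9)])
  ultimately have lim: "(\<lambda>n. survival_expectation M N V n F) \<longlonglongrightarrow> ?R"
    by (rule Lim_transform_eventually)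

  have "(LINT \<omega>|M. complex_of_real (F (walk_path N V \<omega>)) * ?D \<omega>) =
      of_real (LINT \<omega>|M. observed N t F (?Y \<omega>) * ?r (?Y \<omega>))"
    unfolding D FY of_real_mult[symmetric]
    by (rule integral_of_real)
      (rule integrable_walk_values[OF setting, where H = "\<lambda>y. observed N t F y * ?r y"])
  also have "(LINT \<omega>|M. observed N t F (?Y \<omega>) * ?r (?Y \<omega>)) =
      walk_mean N T (\<lambda>l. observed N t F (position_values N u T l) * ?r (position_values N u T l)) ?k"
    by (rule expectation_walk_values[OF setting, where H = "\<lambda>y. observed N t F y * ?r y"])
  also have "\<dots> = walk_mean N T (\<lambda>l. 1 / vandermonde_nat N ?k * (?obs (take (Suc t) l) * vandermonde_nat N (last l))) ?k"
  proof (rule walk_mean_cong)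
    fix l :: "(nat \<Rightarrow> nat) list" assume l: "length l = Suc T"
    have "vandermonde_det N (\<lambda>j. real_of_int (u j)) = vandermonde_det N (\<lambda>j. real_of_int (u 0) + 2 * real (?k j))"
    proof (rule vandermonde_det_cong)
      fix j assume "j < N"
      then have "real_of_int (u j) = real_of_int (u 0 + 2 * int (?k j))"
        by (intro arg_cong[of _ _ real_of_int] start_index[OF setting])
      then show "real_of_int (u j) = real_of_int (u 0) + 2 * real (?k j)" by simp
    qed
    then have "vandermonde_det N (\<lambda>j. real_of_int (u j)) = (\<Prod>i<N. 2 ^ i) * vandermonde_nat N ?k"
      by (simp only: vandermonde_det_affine)
    moreover have "(\<Prod>i<N. 2 ^ i) \<noteq> (0 :: real)" by simp
    ultimately have "?r (position_values N u T l) = vandermonde_nat N (last l) / vandermonde_nat N ?k"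
      unfolding vandermonde_position_values[OF l] by simp
    then show "observed N t F (position_values N u T l) * ?r (position_values N u T l) =
        1 / vandermonde_nat N ?k * (?obs (take (Suc t) l) * vandermonde_nat N (last l))"
      by (simp add: observed_position_values[OF assms(5) l])
  qed
  also have "\<dots> = ?R" unfolding walk_mean_cmult by simp
  finally have martingale_value: "(LINT \<omega>|M. complex_of_real (F (walk_path N V \<omega>)) * ?D \<omega>) = of_real ?R" .

  have int: "integrable M (\<lambda>\<omega>. complex_of_real (F (walk_path N V \<omega>)) * ?D \<omega>)"
    unfolding D FY
    by (rule integrable_walk_values[OF setting, where H = "\<lambda>y. complex_of_real (observed N t F y) * of_real (?r y)"])
  note cp = complex_process_expectation[OF setting assms(8) law, where H = "\<lambda>y. complex_of_real (observed N t F y)"]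
  show ?thesis
    unfolding path P
    using lim int martingale_value cp
    by (auto simp: FY convergent_def noncolliding_expectation_def limI)
qed

end
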